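(* Let $R$ be a preparation map with $R\mathcal Q_0=\mathcal Q_0R$ such that, for all finite families of $\tau_i\in\mathcal T_0$, $i\in I$, and $\tau\in\mathcal T_0$, $$(R-\mathrm{id})\Big[\Big(\prod_{i\in I}\mathcal I(\tau_i)\Big)\mathcal I_2(\tau)\Big]=\sum_{i\in J}c_i\Big(\prod_{j\in K_i}\mathcal I(\tau_{i,j})\Big)$$ for some finite sets $J,K_i$, constants $c_i$ and $\tau_{i,j}\in\mathcal T_0$. Put $$F_{xy}=\delta\Pi_x^{R,1}-\Pi_y^{R,1}d\Gamma_{yx}^R,\qquad \hat F_{xy}=\delta\hat\Pi_x^{R,1}-\hat\Pi_y^{R,1}d\Gamma_{yx}^R .$$ Then for every $\tau\in\mathcal T_0$, every finite family $(\tau_i)_i$ in $\mathcal T_0$ and all space-time points $x,y$, $$\Big(F_{xy}\Big[\Big(\prod_i\mathcal I(\tau_i)\Big)\mathcal I_2(\tau)\Big]\Big)(y)=\Big(\prod_i\big(\hat\Pi_x^{R,1}\mathcal I(\tau_i)\big)(y)\Big)\,\big(\hat F_{xy}\mathcal I_2(\tau)\big)(y).$$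
   Context: **Trees.** Let $d=1$. For $k=(k_0,k_1)\in\mathbb N^{2}$ put $|k|=2k_0+k_1$ and $k!=k_0!k_1!$. A decorated tree is a non-planar rooted tree with node decorations in $\mathbb N^{2}$ and edge decorations in $\{\mathcal I,\Xi_0,\Xi_1\}\times\mathbb N^{2}$. $T$ is the set of decorated trees, $\mathcal T$ its linear span. The tree product identifies the roots and adds their decorations; its unit $\mathbf 1$ is the single node decorated by $0$. $X^k$ is the single node decorated by $k$, $X_j=X^{e_j}$ ($j=0,1$); $\Xi_i$ is the tree with one edge, decorated by $(\Xi_i,0)$; $\mathcal I_a(\tau)$ grafts $\tau$ onto a new root (decorated $0$) via an edge decorated by $(\mathcal I,a)$ (a planted tree); $\mathcal I=\mathcal I_0$ and $\mathcal I_2=\mathcal I_{(0,2)}$. Trees have the form $X^k\Xi_0^l\Xi_1^m\prod_{i}\mathcal I_{a_i}(\tau_i)$ with $l+m\le1$. $|\tau|_\Xi$ is the number of noises $\Xi_0,\Xi_1$ in $\tau$. **Degrees.** Let $\alpha\in\mathbb R$ be the space-time regularity of the noise $\xi$. Put $\deg_0(\Xi_0)=\deg_1(\Xi_0)=\deg_1(\Xi_1)=\alpha$, $\deg_0(\Xi_1)=\alpha+\frac{d+2}2$, and for $i=0,1$: $\deg_i(X^k)=|k|$, $\deg_i$ is additive for the tree product, $\deg_i(\mathcal I_a(\tau))=\deg_i(\tau)+2-|a|$. **Spaces.** The setting is the quasilinear equation $\partial_tu-\partial_x^2u=f(u)\partial_x^2u+\xi$ on $\mathbb R_+\times\mathbb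 R$. $T_0\subset T$ is the set of trees (without $\Xi_1$) generated by the complete rule: the edges leaving any node away from the root form either $\prod_{i\in I}\mathcal I(\cdot)$, or $(\prod_{i\in I}\mathcal I(\cdot))\mathcal I_2(\cdot)$, or $\Xi_0$, with $I$ a finite set (polynomial node decorations are allowed). $\mathcal T_0$ is its span, which is stable under the preparation map $R$ and under the coactions below. $T_1$ is the set of trees obtained from trees in $T_0$ by replacing at most one $\Xi_0$ by $\Xi_1$; $\mathcal T_1$ is its span. $\mathcal T^{+,i}$ is the algebra spanned by $X^k\prod_j\mathcal I^{+,i}_{a_j}(\tau_j)$ with $\tau_j\in T$, $\deg_i(\mathcal I_{a_j}(\tau_j))>0$; $\mathcal I^{+,i}_a$ is a new symbol, extended linearly, with $\mathcal I^{+,i}_a(\tau)=0$ if $\deg_i(\mathcal I_a(\tau))\le0$. $\mathcal T^+=\mathcal T^{+,0}$, and $\mathcal M^+$ is the multiplication on $\mathcal T^+$. **Coactions.** $\Delta_i$ (with values in $\mathcal T\otimes\mathcal T^{+,i}$) is linear and multiplicative with $\Delta_i\mathbf 1=\mathbf 1\otimes\mathbf 1$, $\Delta_iX_j=X_j\otimes\mathbf 1+\mathbf 1\otimes X_j$, $\Delta_i\Xi_j=\Xi_j\otimes\mathbf 1$, $\Delta_i\mathcal I_a\tau=(\mathcal I_a\otimes\mathrm{Id})\Delta_i\tau+\sum_{|\ell+m|<\deg_i(\mathcal I_a\tau)}\frac{X^\ell}{\ell!}\otimes\frac{X^m}{m!}\mathcal I^{+,i}_{a+\ell+m}(\tau)$.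 The coproduct $\Delta_i^+:\mathcal T^{+,i}\to\mathcal T^{+,i}\otimes\mathcal T^{+,i}$ is multiplicative with $\Delta^+_iX_j=X_j\otimes\mathbf1+\mathbf1\otimes X_j$, $\Delta_i^+\mathcal I_a^{+,i}\tau=\sum_{|\ell|<\deg_i(\mathcal I_a\tau)}\big(\mathcal I^{+,i}_{a+\ell}\otimes\frac{(-X)^\ell}{\ell!}\big)\Delta_i\tau+\mathbf 1\otimes\mathcal I_a^{+,i}\tau$; it makes $\mathcal T^{+,i}$ a Hopf algebra with antipode $\mathcal A_i$. The map $\hat\Delta_0$ (with values in $\mathcal T\otimes\mathcal T^+$) is linear and multiplicative with $\hat\Delta_0(\bullet)=\bullet\otimes\mathbf 1$ for $\bullet\in\{\mathbf 1,X_j,\Xi_i\}$ and $\hat\Delta_0(\mathcal I_a\tau)=(\mathcal I_a\otimes\mathrm{Id})\hat\Delta_0\tau-\sum_{\deg_1(\mathcal I_a\tau)\le|\ell|}\frac{X^\ell}{\ell!}\otimes\mathcal M^+(\mathcal I^{+,0}_{a+\ell}\otimes\mathrm{Id})\hat\Delta_0\tau$. **Malliavin derivative on trees.** $D_\Xi:\mathcal T_0\to\mathcal T_1$ is linear, satisfies the Leibniz rule for the tree product, and $D_\Xi\Xi_0=\Xi_1$, $D_\Xi X^k=0$, $D_\Xi\mathbf 1=0$, $D_\Xi\mathcal I_a(\tau)=\mathcal I_a(D_\Xi\tau)$. $\mathcal Q_0$ is the projection sending to zero all trees containing $\Xi_1$. **Preparation map.** A linear map $R:\mathcal T\to\mathcal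 T$ fixing polynomials $X^k$, noises and planted trees such that: for each tree $\tau$, $R\tau=\tau+\sum_j\lambda_j\tau_j$ (finite sum) with $\deg_1(\tau_j)\ge\deg_1(\tau)$ and $|\tau_j|_\Xi<|\tau|_\Xi$; $(R\otimes\mathrm{Id})\Delta_i=\Delta_iR$ for $i=0,1$; and $RD_\Xi=D_\Xi R$ on $\mathcal T_0$. **Models.** $K$ is the compactly supported truncation of the heat kernel, $\xi$ is the regularised (smooth) noise and $\delta\xi$ an infinitesimal (smooth) perturbation of it. For $i=0,1$, $\Pi_x^{R,i}\tau=\hat\Pi_x^{R,i}R\tau$, $\hat\Pi^{R,i}_x$ is multiplicative, $\hat\Pi_x^{R,i}X^k=(\cdot-x)^k$, $\hat\Pi_x^{R,i}\Xi_0=\xi$, $\hat\Pi_x^{R,i}\Xi_1=\delta\xi$, and $(\hat\Pi_x^{R,i}\mathcal I_a\tau)(y)=(D^aK*\Pi_x^{R,i}\tau)(y)-\sum_{|k|<\deg_i(\mathcal I_a\tau)}\frac{(y-x)^k}{k!}(D^{a+k}K*\Pi_x^{R,i}\tau)(x)$. $\delta$ denotes the Malliavin (Fréchet) derivative with respect to $\xi$ in the direction $\delta\xi$; $R$ does not depend on $\xi$. The character $f_x^{R,i}:\mathcal T^{+,i}\to\mathbb R$ is given by $f_x^{R,i}(\mathbf 1)=1$, $f_x^{R,i}(X_j)=-x_j$, $f_x^{R,i}(\mathcal I_a^{+,i}(\tau))=-(D^aK*\Pi_x^{R,i}\tau)(x)$. Put $\gamma_{xy}^{R,i}=(f_x^{R,i}\mathcal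 A_i\otimes f_y^{R,i})\Delta_i^+$ and $\Gamma_{xy}^{R,i}=(\mathrm{Id}\otimes\gamma_{xy}^{R,i})\Delta_i$. Finally, for $\tau\in\mathcal T_0$, $$d\Gamma_{yx}^R\tau=\mathcal Q_0\big(\Gamma_{yx}^{R,0}\otimes f_x^{R,0}\big)\hat\Delta_0D_\Xi\tau .$$
   Formalization: The noise regularity is assumed to satisfy α ≥ -2; for α < -2 the identity is false in general, e.g. α = -4, R = id, one τ_1 = Ξ_0 and τ = Ξ_0, where the two sides differ by (K*δξ)(y)·(D^{(0,2)}K*ξ)(y). *)

theory Defs
  imports
    "HOL-Analysis.Analysis"
    "HOL-Library.Multiset"
    "HOL-Library.Poly_Mapping"
    "HOL-Library.Groups_Big_Fun"
begin

section \<open>Multi-indices\<close>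

text \<open>Component 0 of a multi-index is time, component 1 is space. Addition and \<open>0\<close> are componentwise.\<close>

type_synonym idx = "nat \<times> nat"

definition sdeg :: "idx \<Rightarrow> nat" where
  "sdeg k = 2 * fst k + snd k"

definition mfact :: "idx \<Rightarrow> real" where
  "mfact k = fact (fst k) * fact (snd k)"

definition mpow :: "real \<times> real \<Rightarrow> idx \<Rightarrow> real" where
  "mpow z k = fst z ^ fst k * snd z ^ snd k"

section \<open>Linear spaces with a basis\<close>

text \<open>
  A linear space with basis \<^typ>\<open>'a\<close> is \<^typ>\<open>'a \<Rightarrow>\<^sub>0 real\<close>, the subspace spanned by a
  set \<open>S\<close> of basis elements is \<open>span_of S\<close>, and a linear map is given by its values on the
  basis and extended by \<open>lin\<close>. If the basis is an additively written commutative monoid, the product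
  of \<^typ>\<open>'a \<Rightarrow>\<^sub>0 real\<close> is the bilinear extension of the monoid operation. The tensor product
  of two such spaces has the product of the two bases as basis; its multiplication is the
  multiplication of the tensor product algebra.
\<close>

definition span_of :: "'a set \<Rightarrow> ('a \<Rightarrow>\<^sub>0 real) set" where
  "span_of S = {v. Poly_Mapping.keys v \<subseteq> S}"

abbreviation basis :: "'a \<Rightarrow> ('a \<Rightarrow>\<^sub>0 real)" where
  "basis a \<equiv> Poly_Mapping.single a 1"

definition scale :: "real \<Rightarrow> ('a \<Rightarrow>\<^sub>0 real) \<Rightarrow> ('a \<Rightarrow>\<^sub>0 real)" where
  "scale c v = Poly_Mapping.map ((*) c) v"

definition lin :: "('a \<Rightarrow> ('b \<Rightarrow>\<^sub>0 real)) \<Rightarrow> ('a \<Rightarrow>\<^sub>0 real) \<Rightarrow> ('b \<Rightarrow>\<^sub>0 real)" where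
  "lin f v = (\<Sum>a\<in>Poly_Mapping.keys v. scale (Poly_Mapping.lookup v a) (f a))"

definition lin_real :: "('a \<Rightarrow> real) \<Rightarrow> ('a \<Rightarrow>\<^sub>0 real) \<Rightarrow> real" where
  "lin_real f v = (\<Sum>a\<in>Poly_Mapping.keys v. Poly_Mapping.lookup v a * f a)"

definition lin_fun :: "('a \<Rightarrow> 'p \<Rightarrow> real) \<Rightarrow> ('a \<Rightarrow>\<^sub>0 real) \<Rightarrow> 'p \<Rightarrow> real" where
  "lin_fun f v = (\<lambda>z. lin_real (\<lambda>a. f a z) v)"

lemma lin_fun_cong [fundef_cong]:
  "v = w \<Longrightarrow> (\<And>a. a \<in> Poly_Mapping.keys w \<Longrightarrow> f a = g a) \<Longrightarrow> lin_fun f v = lin_fun g w"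
  by (simp add: lin_fun_def lin_real_def)

definition tens :: "('a \<Rightarrow>\<^sub>0 real) \<Rightarrow> ('b \<Rightarrow>\<^sub>0 real) \<Rightarrow> ('a \<times> 'b \<Rightarrow>\<^sub>0 real)"  (infixr \<open>\<otimes>\<^sub>t\<close> 75) where
  "u \<otimes>\<^sub>t v = lin (\<lambda>a. lin (\<lambda>b. basis (a, b)) v) u"

section \<open>Decorated trees\<close>

text \<open>
  \<open>Tree k l m M\<close> is \<open>X\<^sup>k \<Xi>\<^sub>0\<^sup>l \<Xi>\<^sub>1\<^sup>m \<Prod>\<^bsub>(a,\<tau>) \<in># M\<^esub> I\<^sub>a(\<tau>)\<close>: \<open>k\<close> is the root decoration, \<open>l\<close> and \<open>m\<close>
  count the noise edges at the root (decorated \<open>(\<Xi>\<^sub>0,0)\<close>, \<open>(\<Xi>\<^sub>1,0)\<close> and leading to a bare leaf), and \<open>M\<close>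
  lists the remaining edges at the root with the trees above them. The condition \<open>l + m \<le> 1\<close> at
  every node is imposed by the set \<open>trees\<close>; without it the tree product is total.
\<close>

datatype dtree = Tree idx nat nat "(idx \<times> dtree) multiset"

lemma dtree_size_less [termination_simp]:
  "(a, \<tau>) \<in># M \<Longrightarrow> size \<tau> < Suc (size_multiset (\<lambda>x. Suc (size (snd x))) M)"
  by (auto dest!: multi_member_split)

instantiation dtree :: comm_monoid_add
begin

definition zero_dtree :: dtree where
  "0 = Tree 0 0 0 {#}"

fun plus_dtree :: "dtree \<Rightarrow> dtree \<Rightarrow> dtree" where
  "Tree k l m M + Tree k' l' m' M' = Tree (k + k') (l + l') (m + m') (M + M')"

instance
proof
  fix s t u :: dtree
  show "s + t + u = s + (t + u)" by (cases s; cases t; cases u) (simp add: add.assoc)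
  show "s + t = t + s" by (cases s; cases t) (simp add: add.commute)
  show "0 + s = s" by (cases s) (simp add: zero_dtree_def)
qed

end

type_synonym tvec = "dtree \<Rightarrow>\<^sub>0 real"

abbreviation graft :: "idx \<Rightarrow> dtree \<Rightarrow> dtree" where
  "graft a \<tau> \<equiv> Tree 0 0 0 {#(a, \<tau>)#}"

abbreviation monoX :: "idx \<Rightarrow> dtree" where
  "monoX k \<equiv> Tree k 0 0 {#}"

abbreviation Xi0 :: dtree where "Xi0 \<equiv> Tree 0 1 0 {#}"
abbreviation Xi1 :: dtree where "Xi1 \<equiv> Tree 0 0 1 {#}"

definition II :: "idx \<Rightarrow> tvec \<Rightarrow> tvec" where
  "II a = lin (\<lambda>\<tau>. basis (graft a \<tau>))"

inductive_set trees :: "dtree set" where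
  "l + m \<le> 1 \<Longrightarrow> (\<And>a \<tau>. (a, \<tau>) \<in># M \<Longrightarrow> \<tau> \<in> trees) \<Longrightarrow> Tree k l m M \<in> trees"

inductive_set trees0 :: "dtree set" where
  "(\<And>a \<tau>. (a, \<tau>) \<in># M \<Longrightarrow> a = 0 \<and> \<tau> \<in> trees0) \<Longrightarrow> Tree k 0 0 M \<in> trees0"
| "(\<And>a \<tau>. (a, \<tau>) \<in># M \<Longrightarrow> a = 0 \<and> \<tau> \<in> trees0) \<Longrightarrow> \<sigma> \<in> trees0 \<Longrightarrow>
     Tree k 0 0 (add_mset ((0, 2), \<sigma>) M) \<in> trees0"
| "Tree k 1 0 {#} \<in> trees0"

fun noises :: "dtree \<Rightarrow> nat" where
  "noises (Tree k l m M) = l + m + (\<Sum>(a, \<tau>)\<in>#M. noises \<tau>)"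

fun noises1 :: "dtree \<Rightarrow> nat" where
  "noises1 (Tree k l m M) = m + (\<Sum>(a, \<tau>)\<in>#M. noises1 \<tau>)"

text \<open>
  In \<open>deg \<alpha> i\<close> and everywhere below, the argument \<open>i\<close> is 0 or 1; \<open>3/2\<close> is \<open>(d+2)/2\<close> for \<open>d = 1\<close>.
\<close>

fun deg :: "real \<Rightarrow> nat \<Rightarrow> dtree \<Rightarrow> real" where
  "deg \<alpha> i (Tree k l m M) =
     real (sdeg k) + real l * \<alpha> + real m * (if i = 0 then \<alpha> + 3/2 else \<alpha>)
     + (\<Sum>(a, \<tau>)\<in>#M. deg \<alpha> i \<tau> + 2 - real (sdeg a))"

fun DXi_tree :: "dtree \<Rightarrow> tvec" where
  "DXi_tree (Tree k l m M) =
     scale (real l) (basis (Tree k (l - 1) (m + 1) M))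
     + (\<Sum>(a, \<tau>)\<in>#M. basis (Tree k l m (M - {#(a, \<tau>)#})) * II a (DXi_tree \<tau>))"

definition DXi :: "tvec \<Rightarrow> tvec" where
  "DXi = lin DXi_tree"

definition Q0 :: "tvec \<Rightarrow> tvec" where
  "Q0 = lin (\<lambda>\<tau>. if noises1 \<tau> = 0 then basis \<tau> else 0)"

section \<open>The algebras \<open>T\<^sup>+\<^sup>,\<^sup>i\<close> and the coactions\<close>

text \<open>
  \<open>(k, N)\<close> stands for \<open>X\<^sup>k \<Prod>\<^bsub>(a,\<tau>) \<in># N\<^esub> I\<^sup>+\<^sup>,\<^sup>i\<^sub>a(\<tau>)\<close>; the monoid operation of the product type is the product of
  such monomials. The same type carries both algebras, the positivity of degrees is in \<open>Tplus\<close>.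
\<close>

type_synonym pmon = "idx \<times> (idx \<times> dtree) multiset"
type_synonym pvec = "pmon \<Rightarrow>\<^sub>0 real"

definition Tplus :: "real \<Rightarrow> nat \<Rightarrow> pmon set" where
  "Tplus \<alpha> i = {(k, N). \<forall>(a, \<tau>)\<in>#N. \<tau> \<in> trees \<and> 0 < deg \<alpha> i (graft a \<tau>)}"

definition IIp :: "real \<Rightarrow> nat \<Rightarrow> idx \<Rightarrow> tvec \<Rightarrow> pvec" where
  "IIp \<alpha> i a = lin (\<lambda>\<tau>. if 0 < deg \<alpha> i (graft a \<tau>) then basis (0, {#(a, \<tau>)#}) else 0)"

abbreviation Xp :: "idx \<Rightarrow> pvec" where
  "Xp k \<equiv> basis (k, {#})"

fun coact_tree :: "real \<Rightarrow> nat \<Rightarrow> dtree \<Rightarrow> (dtree \<times> pmon \<Rightarrow>\<^sub>0 real)" where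
  "coact_tree \<alpha> i (Tree k l m M) =
     (basis (monoX (1, 0)) \<otimes>\<^sub>t 1 + 1 \<otimes>\<^sub>t Xp (1, 0)) ^ fst k
     * (basis (monoX (0, 1)) \<otimes>\<^sub>t 1 + 1 \<otimes>\<^sub>t Xp (0, 1)) ^ snd k
     * (basis Xi0 \<otimes>\<^sub>t 1) ^ l * (basis Xi1 \<otimes>\<^sub>t 1) ^ m
     * (\<Prod>(a, \<tau>)\<in>#M.
          lin (\<lambda>(\<sigma>, p). basis (graft a \<sigma>) \<otimes>\<^sub>t basis p) (coact_tree \<alpha> i \<tau>)
          + (\<Sum>(b, c) | real (sdeg (b + c)) < deg \<alpha> i (graft a \<tau>).
               scale (1 / mfact b) (basis (monoX b))
               \<otimes>\<^sub>t (scale (1 / mfact c) (Xp c) * IIp \<alpha> i (a + b + c) (basis \<tau>))))"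

definition coact :: "real \<Rightarrow> nat \<Rightarrow> tvec \<Rightarrow> (dtree \<times> pmon \<Rightarrow>\<^sub>0 real)" where
  "coact \<alpha> i = lin (coact_tree \<alpha> i)"

text \<open>The factor \<open>(-X)\<^sup>b/b!\<close> acts by multiplication on the right tensor factor.\<close>

fun coprod_mon :: "real \<Rightarrow> nat \<Rightarrow> pmon \<Rightarrow> (pmon \<times> pmon \<Rightarrow>\<^sub>0 real)" where
  "coprod_mon \<alpha> i (k, N) =
     (Xp (1, 0) \<otimes>\<^sub>t 1 + 1 \<otimes>\<^sub>t Xp (1, 0)) ^ fst k
     * (Xp (0, 1) \<otimes>\<^sub>t 1 + 1 \<otimes>\<^sub>t Xp (0, 1)) ^ snd k
     * (\<Prod>(a, \<tau>)\<in>#N.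
          (\<Sum>b | real (sdeg b) < deg \<alpha> i (graft a \<tau>).
             lin (\<lambda>(\<sigma>, p). IIp \<alpha> i (a + b) (basis \<sigma>)
                    \<otimes>\<^sub>t (scale ((-1) ^ (fst b + snd b) / mfact b) (Xp b) * basis p))
               (coact_tree \<alpha> i \<tau>))
          + 1 \<otimes>\<^sub>t IIp \<alpha> i a (basis \<tau>))"

definition is_antipode :: "real \<Rightarrow> nat \<Rightarrow> (pmon \<Rightarrow> pvec) \<Rightarrow> bool" where
  "is_antipode \<alpha> i A \<longleftrightarrow>
     (\<forall>p\<in>Tplus \<alpha> i.
        A p \<in> span_of (Tplus \<alpha> i)
        \<and> lin (\<lambda>(q, r). A q * basis r) (coprod_mon \<alpha> i p) = (if p = 0 then 1 else 0)
        \<and> lin (\<lambda>(q, r). basis q * A r) (coprod_mon \<alpha> i p) = (if p = 0 then 1 else 0))"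

text \<open>
  The sum over \<open>b\<close> has only finitely many nonzero terms because \<open>IIp\<close> vanishes on trees of
  nonpositive degree; \<^const>\<open>Sum_any\<close> sums over the support.
\<close>

fun coact_hat_tree :: "real \<Rightarrow> dtree \<Rightarrow> (dtree \<times> pmon \<Rightarrow>\<^sub>0 real)" where
  "coact_hat_tree \<alpha> (Tree k l m M) =
     basis (Tree k l m {#}) \<otimes>\<^sub>t 1
     * (\<Prod>(a, \<tau>)\<in>#M.
          lin (\<lambda>(\<sigma>, p). basis (graft a \<sigma>) \<otimes>\<^sub>t basis p) (coact_hat_tree \<alpha> \<tau>)
          - Sum_any (\<lambda>b. if deg \<alpha> 1 (graft a \<tau>) \<le> real (sdeg b)
              then scale (1 / mfact b) (basis (monoX b))
                   \<otimes>\<^sub>t lin (\<lambda>(\<sigma>, p). IIp \<alpha> 0 (a + b) (basis \<sigma>) * basis p) (coact_hat_tree \<alpha> \<tau>)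
              else 0))"

definition coact_hat :: "real \<Rightarrow> tvec \<Rightarrow> (dtree \<times> pmon \<Rightarrow>\<^sub>0 real)" where
  "coact_hat \<alpha> = lin (coact_hat_tree \<alpha>)"

section \<open>Preparation maps\<close>

text \<open>
  \<open>R \<tau>\<close> is the value on a basis tree, \<open>lin R\<close> the linear map; only the values on \<open>trees\<close> matter.
  The third clause is the triangularity of \<open>R\<close>: the trees occurring in \<open>R \<tau> - \<tau>\<close> have no smaller
  degree and fewer noises.
\<close>

definition preparation_map :: "real \<Rightarrow> (dtree \<Rightarrow> tvec) \<Rightarrow> bool" where
  "preparation_map \<alpha> R \<longleftrightarrow>
     (\<forall>\<tau>\<in>trees. R \<tau> \<in> span_of trees) \<and>
     (\<forall>\<tau>\<in>trees0. R \<tau> \<in> span_of trees0) \<and>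
     (\<forall>\<tau>\<in>trees. \<forall>\<sigma>\<in>Poly_Mapping.keys (R \<tau> - basis \<tau>).
         deg \<alpha> 1 \<tau> \<le> deg \<alpha> 1 \<sigma> \<and> noises \<sigma> < noises \<tau>) \<and>
     (\<forall>k. R (monoX k) = basis (monoX k)) \<and>
     R Xi0 = basis Xi0 \<and> R Xi1 = basis Xi1 \<and>
     (\<forall>a. \<forall>\<tau>\<in>trees. R (graft a \<tau>) = basis (graft a \<tau>)) \<and>
     (\<forall>i\<in>{0, 1}. \<forall>\<tau>\<in>trees.
         lin (\<lambda>(\<sigma>, p). R \<sigma> \<otimes>\<^sub>t basis p) (coact_tree \<alpha> i \<tau>) = coact \<alpha> i (R \<tau>)) \<and>
     (\<forall>\<tau>\<in>trees0. lin R (DXi (basis \<tau>)) = DXi (R \<tau>))"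

section \<open>Kernel and noise\<close>

text \<open>\<open>pderivs k f = \<partial>\<^sub>t\<^bsup>k\<^sub>0\<^esup> \<partial>\<^sub>x\<^bsup>k\<^sub>1\<^esup> f\<close>.\<close>

definition pderivs :: "idx \<Rightarrow> (real \<times> real \<Rightarrow> real) \<Rightarrow> (real \<times> real \<Rightarrow> real)" where
  "pderivs k f = ((\<lambda>g z. deriv (\<lambda>s. g (s, snd z)) (fst z)) ^^ fst k)
           (((\<lambda>g z. deriv (\<lambda>s. g (fst z, s)) (snd z)) ^^ snd k) f)"

text \<open>\<open>f\<close> is \<open>C\<^sup>\<infinity>\<close>; \<open>J k\<close> is the partial derivative of order \<open>k\<close> of \<open>f\<close>.\<close>

definition smooth :: "(real \<times> real \<Rightarrow> real) \<Rightarrow> bool" where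
  "smooth f \<longleftrightarrow> (\<exists>J :: idx \<Rightarrow> real \<times> real \<Rightarrow> real. J 0 = f \<and>
     (\<forall>k z. (J k has_derivative
        (\<lambda>h. fst h * J (k + (1, 0)) z + snd h * J (k + (0, 1)) z)) (at z)))"

definition heat_kernel :: "real \<times> real \<Rightarrow> real" where
  "heat_kernel = (\<lambda>(t, x). if 0 < t then exp (- x\<^sup>2 / (4 * t)) / sqrt (4 * pi * t) else 0)"

text \<open>
  Besides a smooth cutoff times the heat kernel, this also admits truncations corrected by a smooth
  function (for instance in order to annihilate polynomials).
\<close>

definition truncated_heat_kernel :: "(real \<times> real \<Rightarrow> real) \<Rightarrow> bool" where
  "truncated_heat_kernel K \<longleftrightarrow>
     (\<exists>C. compact C \<and> (\<forall>z. z \<notin> C \<longrightarrow> K z = 0)) \<and> smooth (\<lambda>z. heat_kernel z - K z)"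

text \<open>
  \<open>D\<^sup>aK * f\<close> for smooth \<open>f\<close>. For large \<open>a\<close> the kernel \<open>D\<^sup>aK\<close> is not locally integrable, and the
  convolution is that of the distribution \<open>D\<^sup>aK\<close>, which is \<open>D\<^sup>a(K * f)\<close>.
\<close>

definition convD ::
  "(real \<times> real \<Rightarrow> real) \<Rightarrow> idx \<Rightarrow> (real \<times> real \<Rightarrow> real) \<Rightarrow> (real \<times> real \<Rightarrow> real)" where
  "convD K a f = pderivs a (\<lambda>z. integral\<^sup>L lborel (\<lambda>w. K w * f (z - w)))"

section \<open>Models\<close>

text \<open>
  The arguments are the parameters \<open>\<alpha>, i, R, K\<close>, the noise \<open>\<xi>\<close>, the perturbation \<open>\<eta> = \<delta>\<xi>\<close>, and the
  base point \<open>x\<close>. The recursion passes from \<open>I\<^sub>a(\<tau>)\<close> to the trees of \<open>R \<tau>\<close>; it terminates on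
  \<open>trees\<close> when \<open>R\<close> is a preparation map, since these are \<open>\<tau>\<close> itself and trees with fewer noises.
  For arbitrary \<open>R\<close> the function is partial, so the equation is conditional (\<open>PiHat.psimps\<close>).
\<close>

function (domintros) PiHat ::
  "real \<Rightarrow> nat \<Rightarrow> (dtree \<Rightarrow> tvec) \<Rightarrow> (real \<times> real \<Rightarrow> real) \<Rightarrow> (real \<times> real \<Rightarrow> real) \<Rightarrow>
   (real \<times> real \<Rightarrow> real) \<Rightarrow> real \<times> real \<Rightarrow> dtree \<Rightarrow> (real \<times> real \<Rightarrow> real)" where
  "PiHat \<alpha> i R K \<xi> \<eta> x (Tree k l m M) =
     (\<lambda>y. mpow (y - x) k * \<xi> y ^ l * \<eta> y ^ m *
       (\<Prod>(a, \<tau>)\<in>#M.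
          convD K a (lin_fun (\<lambda>\<sigma>. PiHat \<alpha> i R K \<xi> \<eta> x \<sigma>) (R \<tau>)) y
          - (\<Sum>b | real (sdeg b) < deg \<alpha> i (graft a \<tau>).
               mpow (y - x) b / mfact b
               * convD K (a + b) (lin_fun (\<lambda>\<sigma>. PiHat \<alpha> i R K \<xi> \<eta> x \<sigma>) (R \<tau>)) x)))"
  by pat_completeness auto

lemma PiHat_dom_trees:
  assumes P: "preparation_map \<alpha> R"
  shows "\<tau> \<in> trees \<Longrightarrow> PiHat_dom (\<beta>, i, R, K, \<xi>, \<eta>, x, \<tau>)"
proof (induction "(noises \<tau>, size \<tau>)" arbitrary: \<tau> rule: wf_induct[OF wf_lex_prod[OF wf_less_than wf_less_than]])
  case (1 \<tau>)
  obtain k l m M where \<tau>: "\<tau> = Tree k l m M" by (cases \<tau>)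
  have sub: "PiHat_dom (\<beta>, i, R, K, \<xi>, \<eta>, x, s)"
      if ab: "(ab, t) \<in># M" and s: "s \<in> Poly_Mapping.keys (R t)" for ab t s
  proof -
    have tT: "t \<in> trees" using 1(2) ab unfolding \<tau> by (auto elim: trees.cases)
    have sT: "s \<in> trees" using P tT s unfolding preparation_map_def span_of_def by blast
    have n: "noises t \<le> noises \<tau>" using ab unfolding \<tau> by (auto dest!: multi_member_split)
    have sz: "size t < size \<tau>" using ab unfolding \<tau> by (auto dest!: multi_member_split)
    have "s = t \<or> s \<in> Poly_Mapping.keys (R t - basis t)"
      using s by (auto simp: in_keys_iff lookup_minus lookup_single)
    then have "s = t \<or> noises s < noises t" using P tT unfolding preparation_map_def by blast
    then have "((noises s, size s), (noises \<tau>, size \<tau>)) \<in> less_than <*lex*> less_than" using n sz by auto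
    then show ?thesis using 1(1) sT by blast
  qed
  show ?case unfolding \<tau> by (rule PiHat.domintros) (use sub in auto)
qed

definition PiR ::
  "real \<Rightarrow> nat \<Rightarrow> (dtree \<Rightarrow> tvec) \<Rightarrow> (real \<times> real \<Rightarrow> real) \<Rightarrow> (real \<times> real \<Rightarrow> real) \<Rightarrow>
   (real \<times> real \<Rightarrow> real) \<Rightarrow> real \<times> real \<Rightarrow> dtree \<Rightarrow> (real \<times> real \<Rightarrow> real)" where
  "PiR \<alpha> i R K \<xi> \<eta> x \<tau> = lin_fun (PiHat \<alpha> i R K \<xi> \<eta> x) (R \<tau>)"

text \<open>
  The derivative at the noise \<open>\<xi>\<close> in the direction \<open>\<eta>\<close> of a function-valued \<open>G\<close>, evaluated at a point.
\<close>

definition malliavin ::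
  "(real \<times> real \<Rightarrow> real) \<Rightarrow> (real \<times> real \<Rightarrow> real) \<Rightarrow>
   ((real \<times> real \<Rightarrow> real) \<Rightarrow> real \<times> real \<Rightarrow> real) \<Rightarrow> (real \<times> real \<Rightarrow> real)" where
  "malliavin \<xi> \<eta> G = (\<lambda>y. deriv (\<lambda>\<epsilon>. G (\<lambda>z. \<xi> z + \<epsilon> * \<eta> z) y) 0)"

fun fchar ::
  "real \<Rightarrow> nat \<Rightarrow> (dtree \<Rightarrow> tvec) \<Rightarrow> (real \<times> real \<Rightarrow> real) \<Rightarrow> (real \<times> real \<Rightarrow> real) \<Rightarrow>
   (real \<times> real \<Rightarrow> real) \<Rightarrow> real \<times> real \<Rightarrow> pmon \<Rightarrow> real" where
  "fchar \<alpha> i R K \<xi> \<eta> x (k, N) =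
     mpow (- x) k * (\<Prod>(a, \<tau>)\<in>#N. - convD K a (PiR \<alpha> i R K \<xi> \<eta> x \<tau>) x)"

text \<open>Below, \<open>A\<close> is the antipode of \<open>T\<^sup>+\<^sup>,\<^sup>i\<close>.\<close>

definition gammachar ::
  "real \<Rightarrow> nat \<Rightarrow> (pmon \<Rightarrow> pvec) \<Rightarrow> (dtree \<Rightarrow> tvec) \<Rightarrow> (real \<times> real \<Rightarrow> real) \<Rightarrow>
   (real \<times> real \<Rightarrow> real) \<Rightarrow> (real \<times> real \<Rightarrow> real) \<Rightarrow> real \<times> real \<Rightarrow> real \<times> real \<Rightarrow> pmon \<Rightarrow> real" where
  "gammachar \<alpha> i A R K \<xi> \<eta> x y p =
     lin_real (\<lambda>(q, r). lin_real (fchar \<alpha> i R K \<xi> \<eta> x) (A q) * fchar \<alpha> i R K \<xi> \<eta> y r)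
       (coprod_mon \<alpha> i p)"

definition Gamma ::
  "real \<Rightarrow> nat \<Rightarrow> (pmon \<Rightarrow> pvec) \<Rightarrow> (dtree \<Rightarrow> tvec) \<Rightarrow> (real \<times> real \<Rightarrow> real) \<Rightarrow>
   (real \<times> real \<Rightarrow> real) \<Rightarrow> (real \<times> real \<Rightarrow> real) \<Rightarrow> real \<times> real \<Rightarrow> real \<times> real \<Rightarrow> tvec \<Rightarrow> tvec" where
  "Gamma \<alpha> i A R K \<xi> \<eta> x y v =
     lin (\<lambda>(\<sigma>, p). scale (gammachar \<alpha> i A R K \<xi> \<eta> x y p) (basis \<sigma>)) (coact \<alpha> i v)"

definition dGamma ::
  "real \<Rightarrow> (pmon \<Rightarrow> pvec) \<Rightarrow> (dtree \<Rightarrow> tvec) \<Rightarrow> (real \<times> real \<Rightarrow> real) \<Rightarrow>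
   (real \<times> real \<Rightarrow> real) \<Rightarrow> (real \<times> real \<Rightarrow> real) \<Rightarrow> real \<times> real \<Rightarrow> real \<times> real \<Rightarrow> tvec \<Rightarrow> tvec" where
  "dGamma \<alpha> A R K \<xi> \<eta> y x v =
     Q0 (lin (\<lambda>(\<sigma>, p). scale (fchar \<alpha> 0 R K \<xi> \<eta> x p) (Gamma \<alpha> 0 A R K \<xi> \<eta> y x (basis \<sigma>)))
          (coact_hat \<alpha> (DXi v)))"

definition Fdiff ::
  "real \<Rightarrow> (pmon \<Rightarrow> pvec) \<Rightarrow> (dtree \<Rightarrow> tvec) \<Rightarrow> (real \<times> real \<Rightarrow> real) \<Rightarrow> (real \<times> real \<Rightarrow> real) \<Rightarrow>
   (real \<times> real \<Rightarrow> real) \<Rightarrow> real \<times> real \<Rightarrow> real \<times> real \<Rightarrow> tvec \<Rightarrow> (real \<times> real \<Rightarrow> real)" where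
  "Fdiff \<alpha> A R K \<xi> \<eta> x y v = (\<lambda>z.
     malliavin \<xi> \<eta> (\<lambda>\<zeta>. lin_fun (PiR \<alpha> 1 R K \<zeta> \<eta> x) v) z
     - lin_fun (PiR \<alpha> 1 R K \<xi> \<eta> y) (dGamma \<alpha> A R K \<xi> \<eta> y x v) z)"

definition Fdiff_hat ::
  "real \<Rightarrow> (pmon \<Rightarrow> pvec) \<Rightarrow> (dtree \<Rightarrow> tvec) \<Rightarrow> (real \<times> real \<Rightarrow> real) \<Rightarrow> (real \<times> real \<Rightarrow> real) \<Rightarrow>
   (real \<times> real \<Rightarrow> real) \<Rightarrow> real \<times> real \<Rightarrow> real \<times> real \<Rightarrow> tvec \<Rightarrow> (real \<times> real \<Rightarrow> real)" where
  "Fdiff_hat \<alpha> A R K \<xi> \<eta> x y v = (\<lambda>z.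
     malliavin \<xi> \<eta> (\<lambda>\<zeta>. lin_fun (PiHat \<alpha> 1 R K \<zeta> \<eta> x) v) z
     - lin_fun (PiHat \<alpha> 1 R K \<xi> \<eta> y) (dGamma \<alpha> A R K \<xi> \<eta> y x v) z)"

end

theory Submission
  imports Defs "HOL-Probability.Distributions"
begin

text \<open>
  Write \<open>G\<close> for \<open>(\<Gamma>\<^sub>y\<^sub>x \<otimes> f\<^sub>x)\<close> applied to the coaction \<open>coact_hat\<close>, so that \<open>d\<Gamma> = Q0 G DXi\<close>. All models come from
  one model without recentering by the action of the characters \<open>f\<^sub>x\<close>, which are invertible by the
  antipode. Hence \<open>G\<close> is multiplicative, commutes with \<open>R\<close>, and turns the model with index 0 at \<open>y\<close> into the one
  with index 1 at \<open>x\<close>. As the derivative of the latter is its value on \<open>DXi\<close>, and both indices give the same model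
  on trees without \<open>\<Xi>\<^sub>1\<close>, the hatted remainder at \<open>y\<close> is \<open>v \<mapsto> \<Pi>\<^sub>y\<^sup>0 ((1 - Q0) G (DXi v)) (y)\<close>. This is a derivation
  along \<open>\<Pi>\<^sub>x\<^sup>1\<close>, and it vanishes on \<open>II 0 v\<close> because \<open>1 - Q0\<close> kills polynomials and leaves planted trees of positive
  degree. The remainder without hats is the hatted one after \<open>R\<close>, and the terms added by \<open>R\<close> are products of
  \<open>II 0\<close>'s.
\<close>


section \<open>Smooth functions and convolution with the kernel\<close>

text \<open>The obstacle is that two properties of the overview are not among the hypotheses.
  \<open>is_antipode\<close> gives only the two convolution identities on \<open>Tplus\<close>, so
  the inverse of \<open>fchar\<close>, and with it the functional in \<open>Gamma\<close>, does not
  come as a multiplicative one; and \<open>R\<close> is assumed to commute with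
  \<open>coact_tree\<close>, not with \<open>coact_hat_tree\<close>. One cancellation closes both
  gaps: the action of \<open>fchar\<close> with index 0 is multiplicative, commutes with
  \<open>R\<close> on \<open>span_of trees\<close>, is invertible on
  \<open>span_of wide_trees\<close>, and after \<open>act_hat\<close> becomes the action with index
  1. Whatever holds after applying it can be pulled back.

  The bound -2 \<le> \<alpha> enters through degrees. The additional 3/2 that
  \<open>deg \<alpha> 0\<close> gives to \<open>Xi1\<close> lifts the relevant trees containing it
  to degree at least -2 + 3/2 = -1/2, and planting by \<open>II 0\<close> adds 2, so the result is
  positive. Planting by \<open>II (0, 2)\<close> adds nothing; the degree may stay negative, and
  this is why the remainder of that factor remains in the formula.\<close>

definition smooth_family :: "(idx \<Rightarrow> real \<times> real \<Rightarrow> real) \<Rightarrow> bool" where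
  "smooth_family J \<longleftrightarrow> (\<forall>k z. (J k has_derivative
        (\<lambda>h. fst h * J (k + (1, 0)) z + snd h * J (k + (0, 1)) z)) (at z))"

lemma smooth_iff: "smooth f \<longleftrightarrow> (\<exists>J. J 0 = f \<and> smooth_family J)"
  by (auto simp: smooth_def smooth_family_def)

lemma smooth_familyD:
  "smooth_family J \<Longrightarrow> (J k has_derivative
        (\<lambda>h. fst h * J (k + (1, 0)) z + snd h * J (k + (0, 1)) z)) (at z)"
  unfolding smooth_family_def by blast

text \<open>Differentiating a family means shifting its index, so derivatives of all orders are
  treated by the same lemmas.\<close>

lemma smooth_family_shift: "smooth_family J \<Longrightarrow> smooth_family (\<lambda>k. J (a + k))"
  unfolding smooth_family_def add.assoc[symmetric] by blast

lemma smooth_family_continuous: "smooth_family J \<Longrightarrow> continuous_on S (J k)"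
  by (meson continuous_at_imp_continuous_on has_derivative_continuous smooth_familyD)

lemma smooth_continuous: "smooth f \<Longrightarrow> continuous_on S f"
  by (auto simp: smooth_iff intro: smooth_family_continuous)

lemma smooth_family_deriv:
  assumes "smooth_family J"
  shows "deriv (\<lambda>s. J k (s, snd z)) (fst z) = J (k + (1, 0)) z"
    and "deriv (\<lambda>s. J k (fst z, s)) (snd z) = J (k + (0, 1)) z"
proof -
  have "((\<lambda>s. J k (s, snd z)) has_derivative
     (\<lambda>h. fst (h, 0::real) * J (k + (1, 0)) z + snd (h, 0::real) * J (k + (0, 1)) z)) (at (fst z))"
    by (rule has_derivative_compose[where f="\<lambda>s. (s, snd z)" and g="J k"])
       (use smooth_familyD[OF assms, of k z] in \<open>auto intro!: derivative_eq_intros\<close>)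
  then have "((\<lambda>s. J k (s, snd z)) has_real_derivative J (k + (1, 0)) z) (at (fst z))"
    by (simp add: has_field_derivative_def mult_commute_abs)
  then show "deriv (\<lambda>s. J k (s, snd z)) (fst z) = J (k + (1, 0)) z" by (rule DERIV_imp_deriv)
  have "((\<lambda>s. J k (fst z, s)) has_derivative
     (\<lambda>h. fst (0::real, h) * J (k + (1, 0)) z + snd (0::real, h) * J (k + (0, 1)) z)) (at (snd z))"
    by (rule has_derivative_compose[where f="\<lambda>s. (fst z, s)" and g="J k"])
       (use smooth_familyD[OF assms, of k z] in \<open>auto intro!: derivative_eq_intros\<close>)
  then have "((\<lambda>s. J k (fst z, s)) has_real_derivative J (k + (0, 1)) z) (at (snd z))"
    by (simp add: has_field_derivative_def mult_commute_abs)
  then show "deriv (\<lambda>s. J k (fst z, s)) (snd z) = J (k + (0, 1)) z" by (rule DERIV_imp_deriv)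
qed

text \<open>\<open>deriv\<close> is a choice operator, so \<open>pderivs\<close> can be computed
  only through a witness of smoothness. The space derivatives lead from index 0 to
  \<open>(0, n)\<close>, the time derivatives from there to \<open>(m, n)\<close>.\<close>

lemma pderivs_smooth_family:
  assumes "smooth_family J"
  shows "pderivs k (J 0) = J k"
proof -
  have 1: "((\<lambda>g z. deriv (\<lambda>s. g (fst z, s)) (snd z)) ^^ n) (J 0) = J (0, n)" for n
    by (induction n) (auto simp: zero_prod_def smooth_family_deriv[OF assms])
  have 2: "((\<lambda>g z. deriv (\<lambda>s. g (s, snd z)) (fst z)) ^^ m) (J (0, n)) = J (m, n)" for m n
    by (induction m) (auto simp: smooth_family_deriv[OF assms])
  show ?thesis by (simp add: pderivs_def 1 2)
qed

section \<open>Elementary smooth functions, their sums and products\<close>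

lemma smooth_const: "smooth (\<lambda>z. c)"
  unfolding smooth_iff
  by (rule exI[of _ "\<lambda>k z. if k = 0 then c else 0"])
     (auto simp: smooth_family_def zero_prod_def fun_eq_iff plus_prod_def)

lemma smooth_fst: "smooth fst"
  unfolding smooth_iff
  by (rule exI[of _ "\<lambda>k z. if k = 0 then fst z else if k = (1, 0) then 1 else 0"])
     (auto simp: smooth_family_def zero_prod_def fun_eq_iff plus_prod_def intro!: derivative_eq_intros)

lemma smooth_snd: "smooth snd"
  unfolding smooth_iff
  by (rule exI[of _ "\<lambda>k z. if k = 0 then snd z else if k = (0, 1) then 1 else 0"])
     (auto simp: smooth_family_def zero_prod_def fun_eq_iff plus_prod_def intro!: derivative_eq_intros)

lemma smooth_family_add:
  "smooth_family J \<Longrightarrow> smooth_family L \<Longrightarrow> smooth_family (\<lambda>k z. J k z + L k z)"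
  unfolding smooth_family_def
  by (intro allI) (rule derivative_eq_intros, blast, blast, simp add: algebra_simps fun_eq_iff)

lemma smooth_family_cmult: "smooth_family J \<Longrightarrow> smooth_family (\<lambda>k z. c * J k z)"
  unfolding smooth_family_def
  by (intro allI) (rule derivative_eq_intros, blast, simp add: algebra_simps fun_eq_iff)

lemma smooth_add: "smooth f \<Longrightarrow> smooth g \<Longrightarrow> smooth (\<lambda>z. f z + g z)"
  unfolding smooth_iff using smooth_family_add by fastforce

lemma smooth_cmult: "smooth f \<Longrightarrow> smooth (\<lambda>z. c * f z)"
  unfolding smooth_iff using smooth_family_cmult by fastforce

lemma smooth_diff: "smooth f \<Longrightarrow> smooth g \<Longrightarrow> smooth (\<lambda>z. f z - g z)"
  using smooth_add[of f "\<lambda>z. (-1) * g z"] smooth_cmult[of g "-1"] by simp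

lemma smooth_sum: "(\<And>i. i \<in> S \<Longrightarrow> smooth (f i)) \<Longrightarrow> smooth (\<lambda>z. \<Sum>i\<in>S. f i z)"
  by (induction S rule: infinite_finite_induct) (auto intro: smooth_const smooth_add)

text \<open>The partial derivative of order \<open>(a, b)\<close> of a product, when
  \<open>F\<close> and \<open>G\<close> are the families of the factors. Splitting off one
  derivative at a time replaces binomial coefficients by shifts of the two families.\<close>

fun leibniz ::
  "nat \<Rightarrow> nat \<Rightarrow> (idx \<Rightarrow> real \<times> real \<Rightarrow> real) \<Rightarrow> (idx \<Rightarrow> real \<times> real \<Rightarrow> real) \<Rightarrow> real \<times> real \<Rightarrow> real" where
  "leibniz (Suc a) b F G = (\<lambda>z. leibniz a b (\<lambda>k. F (k + (1, 0))) G z + leibniz a b F (\<lambda>k. G (k + (1, 0))) z)"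
| "leibniz 0 (Suc b) F G = (\<lambda>z. leibniz 0 b (\<lambda>k. F (k + (0, 1))) G z + leibniz 0 b F (\<lambda>k. G (k + (0, 1))) z)"
| "leibniz 0 0 F G = (\<lambda>z. F 0 z * G 0 z)"

text \<open>The recursion splits off a space derivative only once no time derivative is left; since
  shifts of the index commute, it can be done at any stage.\<close>

lemma leibniz_Suc_right:
  "leibniz a (Suc b) F G =
     (\<lambda>z. leibniz a b (\<lambda>k. F (k + (0, 1))) G z + leibniz a b F (\<lambda>k. G (k + (0, 1))) z)"
proof (induction a arbitrary: F G)
  case (Suc a)
  have c: "k + (0, 1) + (1, 0) = k + (1, 0) + (0, 1)" for k :: idx by (simp add: add_ac)
  show ?case by (simp add: Suc.IH c algebra_simps fun_eq_iff del: One_nat_def)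
qed simp

lemma smooth_mult:
  assumes "smooth f" and "smooth g"
  shows "smooth (\<lambda>z. f z * g z)"
proof -
  have shift: "smooth_family (\<lambda>k. F (k + e))" if "smooth_family F" for F e
    using smooth_family_shift[OF that, of e] by (simp add: add.commute)
  have base: "(leibniz a b F G has_derivative
      (\<lambda>h. fst h * leibniz (Suc a) b F G z + snd h * leibniz a (Suc b) F G z)) (at z)"
    if "smooth_family F" "smooth_family G" for a b F G z
    using that
  proof (induction a arbitrary: F G)
    case 0
    then show ?case
    proof (induction b arbitrary: F G)
      case 0
      show ?case
        by (auto intro!: derivative_eq_intros smooth_familyD 0 simp: algebra_simps)
    next
      case (Suc b)
      note d1 = Suc.IH[OF shift[OF Suc.prems(1)] Suc.prems(2), of "(0, 1)"]
      note d2 = Suc.IH[OF Suc.prems(1) shift[OF Suc.prems(2)], of "(0, 1)"]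
      have c: "k + (0, 1) + (1, 0) = k + (1, 0) + (0, 1)" for k :: idx by (simp add: add_ac)
      show ?case
        using has_derivative_add[OF d1 d2] by (simp add: algebra_simps c del: One_nat_def)
    qed
  next
    case (Suc a)
    note d1 = Suc.IH[OF shift[OF Suc.prems(1)] Suc.prems(2), of "(1, 0)"]
    note d2 = Suc.IH[OF Suc.prems(1) shift[OF Suc.prems(2)], of "(1, 0)"]
    show ?case
      using has_derivative_add[OF d1 d2]
      by (simp add: algebra_simps leibniz_Suc_right del: One_nat_def)
  qed
  obtain F G where F: "F 0 = f" "smooth_family F" and G: "G 0 = g" "smooth_family G"
    using assms by (auto simp: smooth_iff)
  have "smooth_family (\<lambda>k. leibniz (fst k) (snd k) F G)"
    using base[OF F(2) G(2)] by (simp add: smooth_family_def)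
  then show ?thesis unfolding smooth_iff
    by (intro exI[of _ "\<lambda>k. leibniz (fst k) (snd k) F G"]) (simp add: F G)
qed

lemma smooth_power: "smooth f \<Longrightarrow> smooth (\<lambda>z. f z ^ n)"
  by (induction n) (auto intro: smooth_const smooth_mult)

lemma smooth_prod_mset:
  "(\<And>a. a \<in># M \<Longrightarrow> smooth (f a)) \<Longrightarrow> smooth (\<lambda>z. \<Prod>a\<in>#M. f a z)"
  by (induction M) (auto intro: smooth_const smooth_mult)

lemma smooth_mpow: "smooth (\<lambda>z. mpow (z - x) k)"
  unfolding mpow_def fst_diff snd_diff
  by (intro smooth_mult smooth_power smooth_diff smooth_fst smooth_snd smooth_const)

section \<open>Integrability of the truncated heat kernel\<close>

lemma heat_kernel_measurable [measurable]: "heat_kernel \<in> borel_measurable borel"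
  unfolding heat_kernel_def borel_prod[symmetric] by measurable

text \<open>For t > 0 the slice at time t is the centred Gaussian density of variance 2t and has
  mass 1, so by Tonelli the slab has the mass of \<open>{0<..T}\<close>. The kernel vanishes for t
  \<le> 0, hence only an upper bound on time is imposed.\<close>

lemma heat_kernel_integrable_slab:
  "integrable lborel (\<lambda>z. heat_kernel z * indicator {..T} (fst z))"
proof (rule integrableI_nonneg)
  have b: "(\<lambda>z::real \<times> real. indicator {..T} (fst z) :: real) \<in> borel_measurable borel"
    unfolding borel_prod[symmetric] by measurable
  then show "(\<lambda>z. heat_kernel z * indicator {..T} (fst z)) \<in> borel_measurable lborel"
    by simp
  show "AE z in lborel. 0 \<le> heat_kernel z * indicator {..T} (fst z)"
    by (auto simp: heat_kernel_def indicator_def)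
  have m: "(\<lambda>z. ennreal (heat_kernel z * indicator {..T} (fst z))) \<in> borel_measurable (lborel \<Otimes>\<^sub>M lborel)"
    unfolding lborel_prod using b by simp
  have inner: "(\<integral>\<^sup>+ x. ennreal (heat_kernel (t, x) * indicator {..T} t) \<partial>lborel) = indicator {0<..T} t" for t
  proof (cases "0 < t \<and> t \<le> T")
    case True
    have "heat_kernel (t, x) = normal_density 0 (sqrt (2 * t)) x" for x
      using True by (simp add: heat_kernel_def normal_density_def mult_ac)
    then have "(\<integral>\<^sup>+ x. ennreal (heat_kernel (t, x) * indicator {..T} t) \<partial>lborel)
        = (\<integral>\<^sup>+ x. ennreal (normal_density 0 (sqrt (2 * t)) x) \<partial>lborel)"
      using True by simp
    also have "\<dots> = ennreal (\<integral>x. normal_density 0 (sqrt (2 * t)) x \<partial>lborel)"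
      using True by (intro nn_integral_eq_integral) auto
    finally show ?thesis using True by simp
  next
    case False
    then show ?thesis by (auto simp: heat_kernel_def indicator_def)
  qed
  have "(\<integral>\<^sup>+ z. ennreal (heat_kernel z * indicator {..T} (fst z)) \<partial>lborel)
     = (\<integral>\<^sup>+ z. ennreal (heat_kernel z * indicator {..T} (fst z)) \<partial>(lborel \<Otimes>\<^sub>M lborel))"
    by (simp add: lborel_prod)
  also have "\<dots> = (\<integral>\<^sup>+ t. \<integral>\<^sup>+ x. ennreal (heat_kernel (t, x) * indicator {..T} t) \<partial>lborel \<partial>lborel)"
    by (subst lborel.nn_integral_fst[OF m, symmetric]) simp
  also have "\<dots> = emeasure lborel {0<..T}" by (simp add: inner)
  also have "\<dots> < \<infinity>" by (cases "0 \<le> T") auto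
  finally show "(\<integral>\<^sup>+ z. ennreal (heat_kernel z * indicator {..T} (fst z)) \<partial>lborel) < \<infinity>" .
qed

text \<open>On the compact support \<open>K\<close> differs from the heat kernel by a continuous
  function, and a compact set lies in a slab, where the heat kernel is integrable.\<close>

lemma truncated_heat_kernel_integrable:
  assumes "truncated_heat_kernel K"
  obtains C where "compact C" and "\<And>z. z \<notin> C \<Longrightarrow> K z = 0" and "integrable lborel K"
proof -
  obtain C where C: "compact C" "\<And>z. z \<notin> C \<Longrightarrow> K z = 0" and s: "smooth (\<lambda>z. heat_kernel z - K z)"
    using assms by (auto simp: truncated_heat_kernel_def)
  define g where "g z = heat_kernel z - K z" for z
  have g: "continuous_on UNIV g" using smooth_continuous[OF s] by (simp add: g_def[abs_def])
  obtain T where T: "\<And>z. z \<in> C \<Longrightarrow> norm z \<le> T"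
    using compact_imp_bounded[OF C(1)] by (auto simp: bounded_iff)
  have Cb: "C \<in> sets borel" using C(1) by (simp add: compact_imp_closed)
  have i1: "integrable lborel (\<lambda>z. heat_kernel z * indicator {..T} (fst z) * indicator C z)"
    using heat_kernel_integrable_slab Cb
    by (intro integrable_real_mult_indicator) (auto)
  have i2: "integrable lborel (\<lambda>z. indicator C z *\<^sub>R g z)"
    by (rule borel_integrable_compact[OF C(1) continuous_on_subset[OF g]]) simp
  have eq: "heat_kernel z * indicator {..T} (fst z) * indicator C z - indicator C z *\<^sub>R g z = K z" for z
  proof (cases "z \<in> C")
    case True
    then have "fst z \<le> T" using T[OF True] norm_fst_le[of "fst z" "snd z"] by simp
    then show ?thesis using True by (simp add: g_def)
  next
    case False
    then show ?thesis using C(2)[OF False] by simp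
  qed
  have "integrable lborel K"
    using Bochner_Integration.integrable_diff[OF i1 i2] unfolding eq .
  then show ?thesis using C that by blast
qed

section \<open>Convolution of the kernel with smooth functions\<close>

lemma convolution_integrable:
  assumes "compact C" and "\<And>z. z \<notin> C \<Longrightarrow> K z = 0" and "integrable lborel K"
    and "continuous_on UNIV f"
  shows "integrable lborel (\<lambda>w. K w * (f (z - w) :: real))"
proof -
  have f': "continuous_on UNIV (\<lambda>w. f (z - w))"
    by (rule continuous_on_compose2[OF assms(4)]) (auto intro!: continuous_intros)
  have "bounded ((\<lambda>w. f (z - w)) ` C)"
    by (rule compact_imp_bounded[OF compact_continuous_image[OF continuous_on_subset[OF f'] assms(1)]]) simp
  then obtain B where B: "\<And>w. w \<in> C \<Longrightarrow> \<bar>f (z - w)\<bar> \<le> B"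
    unfolding bounded_iff real_norm_def by blast
  have fm: "(\<lambda>w. f (z - w)) \<in> borel_measurable lborel"
    using borel_measurable_continuous_onI[OF f'] by simp
  show ?thesis
  proof (rule Bochner_Integration.integrable_bound)
    show "integrable lborel (\<lambda>w. B * K w)" using assms(3) by simp
    show "(\<lambda>w. K w * f (z - w)) \<in> borel_measurable lborel"
      by (rule borel_measurable_times[OF borel_measurable_integrable[OF assms(3)] fm])
    show "AE w in lborel. norm (K w * f (z - w)) \<le> norm (B * K w)"
    proof (rule AE_I2)
      fix w
      show "norm (K w * f (z - w)) \<le> norm (B * K w)"
      proof (cases "w \<in> C")
        case True
        then have "\<bar>f (z - w)\<bar> \<le> \<bar>B\<bar>" using B[OF True] by linarith
        then have "\<bar>K w\<bar> * \<bar>f (z - w)\<bar> \<le> \<bar>K w\<bar> * \<bar>B\<bar>" by (rule mult_left_mono) simp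
        then show ?thesis by (simp add: abs_mult mult.commute)
      next
        case False
        then show ?thesis using assms(2)[OF False] by simp
      qed
    qed
  qed
qed

text \<open>The mean value theorem along the segment from \<open>u\<close> to \<open>u + h\<close>;
  the factor 2 counts the two coordinates. The explicit bound is what can be integrated against the
  kernel.\<close>

lemma first_order_remainder:
  assumes J: "smooth_family J" and d: "\<And>s. 0 \<le> s \<Longrightarrow> s \<le> 1 \<Longrightarrow>
      \<bar>J (k + (1, 0)) (u + s *\<^sub>R h) - J (k + (1, 0)) u\<bar> \<le> e
      \<and> \<bar>J (k + (0, 1)) (u + s *\<^sub>R h) - J (k + (0, 1)) u\<bar> \<le> e"
  shows "\<bar>J k (u + h) - J k u - (fst h * J (k + (1, 0)) u + snd h * J (k + (0, 1)) u)\<bar> \<le> 2 * e * norm h"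
proof -
  define D where "D v = fst h * J (k + (1, 0)) v + snd h * J (k + (0, 1)) v" for v
  have "((\<lambda>s. J k (u + s *\<^sub>R h)) has_real_derivative D (u + s *\<^sub>R h)) (at s)" for s
  proof -
    have "((\<lambda>s. J k (u + s *\<^sub>R h)) has_derivative
       (\<lambda>r. fst (r *\<^sub>R h) * J (k + (1, 0)) (u + s *\<^sub>R h) + snd (r *\<^sub>R h) * J (k + (0, 1)) (u + s *\<^sub>R h))) (at s)"
      by (rule has_derivative_compose[where f="\<lambda>s. u + s *\<^sub>R h" and g="J k"])
         (use smooth_familyD[OF J] in \<open>auto intro!: derivative_eq_intros\<close>)
    then show ?thesis
      by (rule has_derivative_imp_has_field_derivative) (simp add: D_def distrib_left mult.assoc mult.commute[of "D _"] mult.commute[of "_ + _"])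
  qed
  then obtain s where s: "0 < s" "s < 1" and eq: "J k (u + 1 *\<^sub>R h) - J k (u + 0 *\<^sub>R h) = (1 - 0) * D (u + s *\<^sub>R h)"
    using MVT2[of 0 1 "\<lambda>s. J k (u + s *\<^sub>R h)" "\<lambda>s. D (u + s *\<^sub>R h)"] by auto
  let ?p = "J (k + (1, 0)) (u + s *\<^sub>R h) - J (k + (1, 0)) u"
  let ?q = "J (k + (0, 1)) (u + s *\<^sub>R h) - J (k + (0, 1)) u"
  have "J k (u + h) - J k u - D u = fst h * ?p + snd h * ?q"
  proof -
    have "J k (u + h) - J k u = D (u + s *\<^sub>R h)" using eq by simp
    then show ?thesis unfolding D_def by (simp only: right_diff_distrib)
  qed
  also have "\<bar>\<dots>\<bar> \<le> \<bar>fst h\<bar> * \<bar>?p\<bar> + \<bar>snd h\<bar> * \<bar>?q\<bar>"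
    unfolding abs_mult[symmetric] by (rule abs_triangle_ineq)
  also have "\<dots> \<le> norm h * e + norm h * e"
    using d[of s] s norm_fst_le[of "fst h" "snd h"] norm_snd_le[of "snd h" "fst h"]
    by (intro add_mono mult_mono) (simp_all del: One_nat_def)
  finally show ?thesis by (simp add: D_def)
qed

text \<open>The derivative falls on \<open>J\<close>, never on the singular \<open>K\<close>. The
  first-order remainder of \<open>J\<close> is small uniformly over the support of \<open>K\<close>,
  and integrating it against the integrable \<open>K\<close> keeps it small.\<close>

lemma convolution_smooth_family:
  assumes C: "compact C" "\<And>z. z \<notin> C \<Longrightarrow> K z = 0" and K: "integrable lborel K"
    and J: "smooth_family J"
  shows "smooth_family (\<lambda>k z. integral\<^sup>L lborel (\<lambda>w. K w * J k (z - w)))"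
  unfolding smooth_family_def
proof (intro allI)
  fix k :: idx and z :: "real \<times> real"
  define G where "G k z = integral\<^sup>L lborel (\<lambda>w. K w * J k (z - w))" for k z
  have int: "integrable lborel (\<lambda>w. K w * J k (z - w))" for k z
    by (rule convolution_integrable[OF C K]) (auto intro: smooth_family_continuous[OF J])
  define c where "c = integral\<^sup>L lborel (\<lambda>w. \<bar>K w\<bar>)"
  have c: "0 \<le> c" by (simp add: c_def)
  have "(G k has_derivative (\<lambda>h. fst h * G (k + (1, 0)) z + snd h * G (k + (0, 1)) z)) (at z)"
    unfolding has_derivative_at_alt
  proof (intro conjI allI impI)
    show "bounded_linear (\<lambda>h. fst h * G (k + (1, 0)) z + snd h * G (k + (0, 1)) z)"
      by (intro bounded_linear_add bounded_linear_mult_left[THEN bounded_linear_compose, unfolded o_def]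
          bounded_linear_fst bounded_linear_snd)
    fix e :: real assume e: "0 < e"
    \<comment> \<open>The integrated remainder is at most 2 e' c times the norm of the increment,
      \<open>c\<close> being the L1 norm of \<open>K\<close>; the summand 1 keeps the denominator
      positive.\<close>
    define e' where "e' = e / (2 * (c + 1))"
    have e': "0 < e'" using e c by (simp add: e'_def)
    \<comment> \<open>A compact set containing all arguments z - w + s h with w in the support and h
      of norm at most 1, so that one modulus of continuity serves them all.\<close>
    let ?S = "(\<lambda>(w, u). z - w + u) ` (C \<times> cball 0 1)"
    have S: "compact ?S"
      using C(1) by (intro compact_continuous_image compact_Times)
        (auto intro!: continuous_intros simp: case_prod_unfold)
    have uc: "uniformly_continuous_on ?S (J i)" for i
      by (rule compact_uniformly_continuous[OF smooth_family_continuous[OF J] S])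
    obtain d1 where d1: "d1 > 0" "\<And>a b. a \<in> ?S \<Longrightarrow> b \<in> ?S \<Longrightarrow> dist b a < d1
        \<Longrightarrow> dist (J (k + (1, 0)) b) (J (k + (1, 0)) a) < e'"
      using uc[unfolded uniformly_continuous_on_def] e' by metis
    obtain d2 where d2: "d2 > 0" "\<And>a b. a \<in> ?S \<Longrightarrow> b \<in> ?S \<Longrightarrow> dist b a < d2
        \<Longrightarrow> dist (J (k + (0, 1)) b) (J (k + (0, 1)) a) < e'"
      using uc[unfolded uniformly_continuous_on_def] e' by metis
    define d where "d = min 1 (min d1 d2)"
    have d: "d > 0" using d1 d2 by (simp add: d_def)
    have "norm (G k y - G k z - (fst (y - z) * G (k + (1, 0)) z + snd (y - z) * G (k + (0, 1)) z)) \<le> e * norm (y - z)"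
      if y: "norm (y - z) < d" for y
    proof -
      define h where "h = y - z"
      have yz: "y - w = (z - w) + h" for w by (simp add: h_def)
      define r where "r w = J k (z - w + h) - J k (z - w)
         - (fst h * J (k + (1, 0)) (z - w) + snd h * J (k + (0, 1)) (z - w))" for w
      have r: "\<bar>r w\<bar> \<le> 2 * e' * norm h" if w: "w \<in> C" for w
        unfolding r_def
      proof (rule first_order_remainder[OF J])
        fix s :: real assume s: "0 \<le> s" "s \<le> 1"
        have n: "norm (s *\<^sub>R h) \<le> norm h" using s by (simp add: mult_left_le_one_le)
        have "norm (s *\<^sub>R h) < d" using n y by (simp add: h_def)
        then have n: "norm (s *\<^sub>R h) \<le> 1" "norm (s *\<^sub>R h) < d1" "norm (s *\<^sub>R h) < d2" by (auto simp: d_def)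
        have m: "z - w \<in> ?S" "z - w + s *\<^sub>R h \<in> ?S"
          using w n by (force intro!: image_eqI[of _ _ "(w, 0)"], force intro!: image_eqI[of _ _ "(w, s *\<^sub>R h)"])
        show "\<bar>J (k + (1, 0)) (z - w + s *\<^sub>R h) - J (k + (1, 0)) (z - w)\<bar> \<le> e'
            \<and> \<bar>J (k + (0, 1)) (z - w + s *\<^sub>R h) - J (k + (0, 1)) (z - w)\<bar> \<le> e'"
          using d1(2)[OF m] d2(2)[OF m] n by (auto simp: dist_norm)
      qed
      have i1: "integrable lborel (\<lambda>w. K w * J k (z - w + h))" using int[of k y] by (simp add: yz)
      have Kr: "(\<lambda>w. K w * r w) = (\<lambda>w. K w * J k (z - w + h) - K w * J k (z - w)
          - (fst h * (K w * J (k + (1, 0)) (z - w)) + snd h * (K w * J (k + (0, 1)) (z - w))))"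
        by (auto simp: r_def algebra_simps)
      have eq: "G k y - G k z - (fst h * G (k + (1, 0)) z + snd h * G (k + (0, 1)) z)
          = integral\<^sup>L lborel (\<lambda>w. K w * r w)"
        unfolding Kr using i1 int by (simp add: G_def yz del: One_nat_def)
      have ir: "integrable lborel (\<lambda>w. K w * r w)"
        unfolding Kr using i1 int by (simp del: One_nat_def)
      have "\<bar>integral\<^sup>L lborel (\<lambda>w. K w * r w)\<bar> \<le> integral\<^sup>L lborel (\<lambda>w. (2 * e' * norm h) * \<bar>K w\<bar>)"
      proof (rule integral_abs_bound_integral[OF ir])
        show "integrable lborel (\<lambda>w. (2 * e' * norm h) * \<bar>K w\<bar>)" using K by simp
        fix w
        show "\<bar>K w * r w\<bar> \<le> (2 * e' * norm h) * \<bar>K w\<bar>"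
        proof (cases "w \<in> C")
          case True
          then show ?thesis using r[OF True] by (simp add: abs_mult mult.commute mult_left_mono)
        qed (simp add: C)
      qed
      also have "\<dots> = 2 * e' * c * norm h" by (simp add: c_def)
      also have "\<dots> \<le> e * norm h"
      proof (rule mult_right_mono)
        show "2 * e' * c \<le> e" using e c by (simp add: e'_def field_simps)
      qed simp
      finally show ?thesis using eq by (simp add: h_def)
    qed
    then show "\<exists>d>0. \<forall>y. norm (y - z) < d \<longrightarrow>
        norm (G k y - G k z - (fst (y - z) * G (k + (1, 0)) z + snd (y - z) * G (k + (0, 1)) z)) \<le> e * norm (y - z)"
      using d by blast
  qed
  then show "((\<lambda>z. integral\<^sup>L lborel (\<lambda>w. K w * J k (z - w))) has_derivative
      (\<lambda>h. fst h * integral\<^sup>L lborel (\<lambda>w. K w * J (k + (1, 0)) (z - w))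
         + snd h * integral\<^sup>L lborel (\<lambda>w. K w * J (k + (0, 1)) (z - w)))) (at z)"
    by (simp add: G_def[abs_def])
qed

text \<open>The distributional derivative of the kernel is carried over to the smooth factor, where
  integrability of \<open>K\<close> suffices for every order \<open>a\<close>.\<close>

lemma convD_smooth_family:
  assumes "truncated_heat_kernel K" and "smooth_family J"
  shows "convD K a (J 0) = (\<lambda>z. integral\<^sup>L lborel (\<lambda>w. K w * J a (z - w)))"
proof -
  obtain C where C: "compact C" "\<And>z. z \<notin> C \<Longrightarrow> K z = 0" "integrable lborel K"
    using truncated_heat_kernel_integrable[OF assms(1)] by blast
  show ?thesis unfolding convD_def
    by (rule pderivs_smooth_family[OF convolution_smooth_family[OF C assms(2)]])
qed

lemma smooth_convD:
  assumes K: "truncated_heat_kernel K" and "smooth f"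
  shows "smooth (convD K a f)"
proof -
  obtain J where J: "J 0 = f" "smooth_family J" using assms(2) by (auto simp: smooth_iff)
  obtain C where C: "compact C" "\<And>z. z \<notin> C \<Longrightarrow> K z = 0" "integrable lborel K"
    using truncated_heat_kernel_integrable[OF K] by blast
  have "smooth_family (\<lambda>k z. integral\<^sup>L lborel (\<lambda>w. K w * J (a + k) (z - w)))"
    by (rule convolution_smooth_family[OF C smooth_family_shift[OF J(2)]])
  then show ?thesis
    unfolding smooth_iff J(1)[symmetric] convD_smooth_family[OF K J(2)]
    by (intro exI[of _ "\<lambda>k z. integral\<^sup>L lborel (\<lambda>w. K w * J (a + k) (z - w))"]) simp
qed

text \<open>The integral is additive only on integrable functions and \<open>pderivs\<close> only
  where derivatives exist, so linearity is obtained by comparing families of smooth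
  arguments.\<close>

lemma convD_add_cmult:
  assumes K: "truncated_heat_kernel K" and "smooth f" and "smooth g"
  shows "convD K a (\<lambda>z. c * f z + g z) = (\<lambda>y. c * convD K a f y + convD K a g y)"
proof -
  obtain F where F: "F 0 = f" "smooth_family F" using assms(2) by (auto simp: smooth_iff)
  obtain G where G: "G 0 = g" "smooth_family G" using assms(3) by (auto simp: smooth_iff)
  obtain C where C: "compact C" "\<And>z. z \<notin> C \<Longrightarrow> K z = 0" "integrable lborel K"
    using truncated_heat_kernel_integrable[OF K] by blast
  have int: "integrable lborel (\<lambda>w. K w * J (z - w))" if "continuous_on UNIV J" for J z
    by (rule convolution_integrable[OF C that])
  have H: "smooth_family (\<lambda>k z. c * F k z + G k z)"
    by (rule smooth_family_add[OF smooth_family_cmult[OF F(2)] G(2)])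
  have "convD K a (\<lambda>z. c * F 0 z + G 0 z) = (\<lambda>y. c * convD K a (F 0) y + convD K a (G 0) y)"
    unfolding convD_smooth_family[OF K H] convD_smooth_family[OF K F(2)] convD_smooth_family[OF K G(2)]
    using int[OF smooth_family_continuous[OF F(2)]] int[OF smooth_family_continuous[OF G(2)]]
    by (simp add: distrib_left mult.left_commute[of _ c])
  then show ?thesis by (simp add: F G)
qed

lemma convD_zero:
  assumes "truncated_heat_kernel K"
  shows "convD K a (\<lambda>z. 0) = (\<lambda>y. 0)"
  using convD_add_cmult[OF assms smooth_const smooth_const, of a 1 0 0] by (simp add: fun_eq_iff)

lemma convD_sum:
  assumes K: "truncated_heat_kernel K" and "finite S" and "\<And>i. i \<in> S \<Longrightarrow> smooth (f i)"
  shows "convD K a (\<lambda>z. \<Sum>i\<in>S. c i * f i z) = (\<lambda>y. \<Sum>i\<in>S. c i * convD K a (f i) y)"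
  using assms(2,3)
proof (induction S rule: finite_induct)
  case (insert i S)
  have "convD K a (\<lambda>z. c i * f i z + (\<Sum>i\<in>S. c i * f i z))
      = (\<lambda>y. c i * convD K a (f i) y + convD K a (\<lambda>z. \<Sum>i\<in>S. c i * f i z) y)"
    using insert.prems by (intro convD_add_cmult[OF K] smooth_sum smooth_cmult) auto
  then show ?case using insert by simp
qed (simp add: convD_zero[OF K])

section \<open>Linear maps on spaces with a basis\<close>

lemma lookup_scale [simp]: "Poly_Mapping.lookup (scale c v) a = c * Poly_Mapping.lookup v a"
  unfolding scale_def by transfer (simp add: when_def)

lemma scale_add_right: "scale c (u + v) = scale c u + scale c v"
  by (rule poly_mapping_eqI) (simp add: lookup_add distrib_left)

lemma scale_add_left: "scale (c + d) v = scale c v + scale d v"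
  by (rule poly_mapping_eqI) (simp add: lookup_add distrib_right)

lemma scale_scale [simp]: "scale c (scale d v) = scale (c * d) v"
  by (rule poly_mapping_eqI) (simp add: mult.assoc)

lemma scale_simps [simp]: "scale c 0 = 0" "scale 0 v = 0" "scale 1 v = v"
  by (rule poly_mapping_eqI, simp)+

lemma scale_minus: "scale (- c) v = - scale c v" "scale c (- v) = - scale c v"
  by (rule poly_mapping_eqI, simp)+

lemma scale_sum: "scale c (sum f S) = (\<Sum>a\<in>S. scale c (f a))"
  by (induction S rule: infinite_finite_induct) (simp_all add: scale_add_right)

lemma scale_conv_mult: "scale c v = Poly_Mapping.single 0 c * v"
  by (simp add: scale_def mult_map_scale_conv_mult)

lemma scale_mult_left [simp]: "scale c u * v = scale c (u * v :: 'a::comm_monoid_add \<Rightarrow>\<^sub>0 real)"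
  by (simp add: scale_conv_mult mult.assoc)

lemma scale_mult_right [simp]: "u * scale c v = scale c (u * v :: 'a::comm_monoid_add \<Rightarrow>\<^sub>0 real)"
  by (simp add: scale_conv_mult mult.left_commute)

lemma scale_power: "scale c (v :: 'a::comm_monoid_add \<Rightarrow>\<^sub>0 real) ^ n = scale (c ^ n) (v ^ n)"
  by (induction n) (simp_all add: mult.commute)

lemma basis_add: "basis (a + b) = basis a * basis b"
  by (simp add: mult_single)

lemma basis_zero: "basis 0 = 1"
  by simp

lemma keys_scale: "Poly_Mapping.keys (scale c v) \<subseteq> Poly_Mapping.keys v"
  by (auto simp: in_keys_iff)

lemma lin_superset:
  assumes "finite S" and "Poly_Mapping.keys v \<subseteq> S"
  shows "lin f v = (\<Sum>a\<in>S. scale (Poly_Mapping.lookup v a) (f a))"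
  unfolding lin_def using assms
  by (intro sum.mono_neutral_left) (auto simp: in_keys_iff)

lemma lin_real_superset:
  assumes "finite S" and "Poly_Mapping.keys v \<subseteq> S"
  shows "lin_real f v = (\<Sum>a\<in>S. Poly_Mapping.lookup v a * f a)"
  unfolding lin_real_def using assms
  by (intro sum.mono_neutral_left) (auto simp: in_keys_iff)

lemma lin_cong:
  "v = w \<Longrightarrow> (\<And>a. a \<in> Poly_Mapping.keys w \<Longrightarrow> f a = g a) \<Longrightarrow> lin f v = lin g w"
  by (simp add: lin_def)

lemma lin_real_cong:
  "v = w \<Longrightarrow> (\<And>a. a \<in> Poly_Mapping.keys w \<Longrightarrow> f a = g a) \<Longrightarrow> lin_real f v = lin_real g w"
  by (simp add: lin_real_def)

lemma lin_zero [simp]: "lin f 0 = 0"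
  by (simp add: lin_def)

lemma lin_real_zero [simp]: "lin_real f 0 = 0"
  by (simp add: lin_real_def)

lemma lin_basis [simp]: "lin f (basis a) = f a"
  by (simp add: lin_def)

lemma lin_real_basis [simp]: "lin_real f (basis a) = f a"
  by (simp add: lin_real_def)

lemma lin_add: "lin f (u + v) = lin f u + lin f v"
proof -
  let ?S = "Poly_Mapping.keys u \<union> Poly_Mapping.keys v"
  have "Poly_Mapping.keys (u + v) \<subseteq> ?S" by (rule keys_add)
  then show ?thesis
    by (simp add: lin_superset[of ?S] lookup_add scale_add_left sum.distrib)
qed

lemma lin_real_add: "lin_real f (u + v) = lin_real f u + lin_real f v"
proof -
  let ?S = "Poly_Mapping.keys u \<union> Poly_Mapping.keys v"
  have "Poly_Mapping.keys (u + v) \<subseteq> ?S" by (rule keys_add)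
  then show ?thesis
    by (simp add: lin_real_superset[of ?S] lookup_add distrib_right sum.distrib)
qed

lemma lin_scale: "lin f (scale c v) = scale c (lin f v)"
  using keys_scale[of c v]
  by (simp add: lin_superset[of "Poly_Mapping.keys v"] scale_sum)

lemma lin_real_scale: "lin_real f (scale c v) = c * lin_real f v"
  using keys_scale[of c v]
  by (simp add: lin_real_superset[of "Poly_Mapping.keys v"] sum_distrib_left mult.assoc)

lemma lin_uminus: "lin f (- v) = - lin f v"
  using lin_scale[of f "-1" v] by (simp add: scale_minus)

lemma lin_diff: "lin f (u - v) = lin f u - lin f v"
  using lin_add[of f u "- v"] by (simp add: lin_uminus)

lemma lin_sum: "lin f (sum g S) = (\<Sum>a\<in>S. lin f (g a))"
  by (induction S rule: infinite_finite_induct) (simp_all add: lin_add)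

lemma lin_real_sum: "lin_real f (sum g S) = (\<Sum>a\<in>S. lin_real f (g a))"
  by (induction S rule: infinite_finite_induct) (simp_all add: lin_real_add)

lemma lin_single_coeff [simp]: "lin f (Poly_Mapping.single a c) = scale c (f a)"
proof -
  have "Poly_Mapping.single a c = scale c (basis a)"
    by (rule poly_mapping_eqI) (simp add: lookup_single when_def)
  then show ?thesis by (simp add: lin_scale)
qed

lemma lin_id: "lin basis v = v"
proof (rule poly_mapping_eqI)
  fix a
  have "Poly_Mapping.lookup (lin basis v) a
      = (\<Sum>b\<in>Poly_Mapping.keys v. if b = a then Poly_Mapping.lookup v b else 0)"
    unfolding lin_def lookup_sum by (intro sum.cong) (auto simp: lookup_single when_def)
  also have "\<dots> = Poly_Mapping.lookup v a" by (simp add: in_keys_iff)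
  finally show "Poly_Mapping.lookup (lin basis v) a = Poly_Mapping.lookup v a" .
qed

lemma lin_pointwise_add: "lin (\<lambda>a. f a + g a) v = lin f v + lin g v"
  by (simp add: lin_def scale_add_right sum.distrib)

lemma lin_pointwise_scale: "lin (\<lambda>a. scale c (f a)) v = scale c (lin f v)"
  by (simp add: lin_def scale_sum mult.commute)

lemma lin_pointwise_sum: "lin (\<lambda>a. \<Sum>s\<in>S. f s a) v = (\<Sum>s\<in>S. lin (f s) v)"
  by (induction S rule: infinite_finite_induct) (simp_all add: lin_pointwise_add, simp_all add: lin_def)

lemma lin_pointwise_mult: "lin (\<lambda>a. u * f a) v = (u :: 'b::comm_monoid_add \<Rightarrow>\<^sub>0 real) * lin f v"
  by (simp add: lin_def sum_distrib_left)

lemma lin_lin: "lin f (lin g v) = lin (\<lambda>a. lin f (g a)) v"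
  by (simp add: lin_def[of g] lin_sum lin_scale) (simp add: lin_def[of "\<lambda>a. lin f (g a)"])

lemma lin_real_lin: "lin_real f (lin g v) = lin_real (\<lambda>a. lin_real f (g a)) v"
  by (simp add: lin_def[of g] lin_real_sum lin_real_scale) (simp add: lin_real_def[of "\<lambda>a. lin_real f (g a)"])

lemma lin_scale_fixed:
  fixes v :: "'a \<Rightarrow>\<^sub>0 real"
  shows "lin (\<lambda>a. scale (f a) u) v = scale (lin_real f v) u"
proof -
  have "(\<Sum>a\<in>S. scale (h a) u) = scale (sum h S) u" for h :: "'a \<Rightarrow> real" and S
    by (induction S rule: infinite_finite_induct) (simp_all add: scale_add_left)
  then show ?thesis by (simp add: lin_def lin_real_def)
qed

lemma lin_fun_lin: "lin_fun f (lin g v) = lin_fun (\<lambda>a. lin_fun f (g a)) v"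
  by (simp add: lin_fun_def lin_real_lin)

lemma lin_fun_add: "lin_fun f (u + v) z = lin_fun f u z + lin_fun f v z"
  by (simp add: lin_fun_def lin_real_add)

lemma lin_fun_scale: "lin_fun f (scale c v) z = c * lin_fun f v z"
  by (simp add: lin_fun_def lin_real_scale)

lemma lin_fun_sum: "lin_fun f (sum g S) z = (\<Sum>a\<in>S. lin_fun f (g a) z)"
  by (simp add: lin_fun_def lin_real_sum)

lemma lin_fun_basis [simp]: "lin_fun f (basis a) = f a"
  by (simp add: lin_fun_def)

lemma lin_fun_zero [simp]: "lin_fun f 0 = (\<lambda>z. 0)"
  by (simp add: lin_fun_def)

section \<open>Spans of sets of basis elements\<close>

lemma span_of_mono: "S \<subseteq> S' \<Longrightarrow> v \<in> span_of S \<Longrightarrow> v \<in> span_of S'"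
  by (auto simp: span_of_def)

lemma span_of_zero [simp]: "0 \<in> span_of S"
  by (simp add: span_of_def)

lemma span_of_basis [simp]: "basis a \<in> span_of S \<longleftrightarrow> a \<in> S"
  by (simp add: span_of_def)

lemma span_of_add: "u \<in> span_of S \<Longrightarrow> v \<in> span_of S \<Longrightarrow> u + v \<in> span_of S"
  using keys_add[of u v] by (auto simp: span_of_def)

lemma span_of_scale: "v \<in> span_of S \<Longrightarrow> scale c v \<in> span_of S"
  using keys_scale[of c v] by (auto simp: span_of_def)

lemma span_of_diff: "u \<in> span_of S \<Longrightarrow> v \<in> span_of S \<Longrightarrow> u - v \<in> span_of S"
  using span_of_add[of u S "scale (-1) v"] span_of_scale[of v S "-1"] by (simp add: scale_minus)

lemma span_of_sum: "(\<And>a. a \<in> F \<Longrightarrow> g a \<in> span_of S) \<Longrightarrow> sum g F \<in> span_of S"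
  by (induction F rule: infinite_finite_induct) (auto intro: span_of_add)

lemma span_of_lin: "v \<in> span_of S \<Longrightarrow> (\<And>a. a \<in> S \<Longrightarrow> f a \<in> span_of S') \<Longrightarrow> lin f v \<in> span_of S'"
  unfolding lin_def by (intro span_of_sum span_of_scale) (auto simp: span_of_def)

lemma span_of_mult:
  "u \<in> span_of S \<Longrightarrow> v \<in> span_of S' \<Longrightarrow> (\<And>a b. a \<in> S \<Longrightarrow> b \<in> S' \<Longrightarrow> a + b \<in> S'') \<Longrightarrow> u * v \<in> span_of S''"
  using keys_mult[of u v] by (fastforce simp: span_of_def)

lemma span_of_induct [consumes 1, case_names zero step]:
  assumes v: "v \<in> span_of S" and zero: "P 0"
    and step: "\<And>c a u. a \<in> S \<Longrightarrow> u \<in> span_of S \<Longrightarrow> P u \<Longrightarrow> P (scale c (basis a) + u)"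
  shows "P v"
proof -
  have "F \<subseteq> S \<Longrightarrow> P (\<Sum>a\<in>F. scale (Poly_Mapping.lookup v a) (basis a))" if "finite F" for F
    using that
  proof (induction F rule: finite_induct)
    case (insert a F)
    then show ?case
      by (simp add: step span_of_sum span_of_scale subset_eq del: lin_single_coeff)
  qed (simp add: zero)
  from this[of "Poly_Mapping.keys v"] v show ?thesis
    unfolding span_of_def lin_def[of basis v, symmetric] lin_id by simp
qed

lemma lin_eq_on_span:
  "v \<in> span_of S \<Longrightarrow> (\<And>a. a \<in> S \<Longrightarrow> f a = g a) \<Longrightarrow> lin f v = lin g v"
  by (rule lin_cong) (auto simp: span_of_def)

lemma lin_real_eq_on_span:
  "v \<in> span_of S \<Longrightarrow> (\<And>a. a \<in> S \<Longrightarrow> f a = g a) \<Longrightarrow> lin_real f v = lin_real g v"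
  by (rule lin_real_cong) (auto simp: span_of_def)

lemma lin_fun_eq_on_span:
  "v \<in> span_of S \<Longrightarrow> (\<And>a. a \<in> S \<Longrightarrow> f a = g a) \<Longrightarrow> lin_fun f v = lin_fun g v"
  by (rule lin_fun_cong) (auto simp: span_of_def)

lemma lin_mult_span:
  fixes u v :: "'a::comm_monoid_add \<Rightarrow>\<^sub>0 real"
  assumes v: "v \<in> span_of S'" and u: "u \<in> span_of S"
    and f: "\<And>a b. a \<in> S \<Longrightarrow> b \<in> S' \<Longrightarrow> f (a + b) = f a * (f b :: 'b::comm_monoid_add \<Rightarrow>\<^sub>0 real)"
  shows "lin f (u * v) = lin f u * lin f v"
  using u
proof (induction u rule: span_of_induct)
  case (step c a u)
  have "lin f (basis a * v) = f a * lin f v"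
    using v
  proof (induction v rule: span_of_induct)
    case (step d b v)
    then show ?case using f \<open>a \<in> S\<close>
      by (simp add: distrib_left lin_add lin_scale basis_add[symmetric] del: lin_single_coeff)
  qed simp
  then show ?case using step by (simp add: distrib_right lin_add lin_scale del: lin_single_coeff)
qed simp

text \<open>Asking for multiplicativity only on pairs from \<open>S\<close> and \<open>S'\<close>
  admits the models, whose recursion equation is available only on
  \<open>wide_trees\<close>.\<close>

lemma lin_real_mult_span:
  fixes u v :: "'a::comm_monoid_add \<Rightarrow>\<^sub>0 real"
  assumes v: "v \<in> span_of S'" and u: "u \<in> span_of S"
    and f: "\<And>a b. a \<in> S \<Longrightarrow> b \<in> S' \<Longrightarrow> f (a + b) = f a * f b"
  shows "lin_real f (u * v) = lin_real f u * lin_real f v"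
  using u
proof (induction u rule: span_of_induct)
  case (step c a u)
  have "lin_real f (basis a * v) = f a * lin_real f v"
    using v
  proof (induction v rule: span_of_induct)
    case (step d b v)
    then show ?case using f \<open>a \<in> S\<close>
      by (simp add: distrib_left lin_real_add lin_real_scale basis_add[symmetric] mult.left_commute)
  qed simp
  then show ?case using step
    by (simp add: distrib_right lin_real_add lin_real_scale mult.assoc)
qed simp

text \<open>On a monoid basis these are the maps whose linear extensions are unital algebra
  homomorphisms; the real-valued ones are the characters.\<close>

definition mhom :: "('a::comm_monoid_add \<Rightarrow> 'b::comm_monoid_mult) \<Rightarrow> bool" where
  "mhom f \<longleftrightarrow> f 0 = 1 \<and> (\<forall>a b. f (a + b) = f a * f b)"

lemma mhom_lin_mult: "mhom f \<Longrightarrow> lin f (u * v) = lin f u * lin f v"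
  by (rule lin_mult_span[of _ UNIV _ UNIV]) (auto simp: mhom_def span_of_def)

lemma mhom_lin_one: "mhom f \<Longrightarrow> lin f 1 = 1"
  unfolding basis_zero[symmetric] lin_basis by (simp add: mhom_def)

lemma mhom_lin_power: "mhom f \<Longrightarrow> lin f (u ^ n) = lin f u ^ n"
  by (induction n) (simp_all add: mhom_lin_mult mhom_lin_one)

lemma mhom_lin_real_mult: "mhom f \<Longrightarrow> lin_real f (u * v) = lin_real f u * lin_real f v"
  by (rule lin_real_mult_span[of _ UNIV _ UNIV]) (auto simp: mhom_def span_of_def)

lemma mhom_lin_real_one: "mhom f \<Longrightarrow> lin_real f 1 = 1"
  unfolding basis_zero[symmetric] lin_real_basis by (simp add: mhom_def)

lemma mhom_compose_lin: "mhom f \<Longrightarrow> mhom g \<Longrightarrow> mhom (\<lambda>a. lin f (g a))"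
  by (simp add: mhom_def[of g] mhom_def[of "\<lambda>a. lin f (g a)"] mhom_lin_mult mhom_lin_one)

subsection \<open>Tensor products\<close>

lemma lin_tens: "lin f (u \<otimes>\<^sub>t v) = lin (\<lambda>a. lin (\<lambda>b. f (a, b)) v) u"
  by (simp add: tens_def lin_lin)

lemma tens_basis: "basis a \<otimes>\<^sub>t basis b = basis (a, b)"
  by (simp add: tens_def)

lemma tens_add_right: "u \<otimes>\<^sub>t (v + v') = u \<otimes>\<^sub>t v + u \<otimes>\<^sub>t v'"
  by (simp add: tens_def lin_add lin_pointwise_add)

lemma tens_scale_left [simp]: "scale c u \<otimes>\<^sub>t v = scale c (u \<otimes>\<^sub>t v)"
  by (simp add: tens_def lin_scale)

lemma tens_scale_right [simp]: "u \<otimes>\<^sub>t scale c v = scale c (u \<otimes>\<^sub>t v)"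
  by (simp add: tens_def lin_scale lin_pointwise_scale)

lemma tens_zero [simp]: "0 \<otimes>\<^sub>t v = 0" "u \<otimes>\<^sub>t 0 = 0"
  by (simp_all add: tens_def, simp add: lin_def)

lemma tens_mult:
  fixes u u' :: "'a::comm_monoid_add \<Rightarrow>\<^sub>0 real" and v v' :: "'b::comm_monoid_add \<Rightarrow>\<^sub>0 real"
  shows "(u \<otimes>\<^sub>t v) * (u' \<otimes>\<^sub>t v') = (u * u') \<otimes>\<^sub>t (v * v')"
proof -
  have m: "lin f w * x = lin (\<lambda>a. f a * x) w" for f :: "'z \<Rightarrow> 'a \<times> 'b \<Rightarrow>\<^sub>0 real" and w x
    by (simp add: lin_def sum_distrib_right)
  have b: "basis (a, b) * (u' \<otimes>\<^sub>t v') = (basis a * u') \<otimes>\<^sub>t (basis b * v')" for a b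
  proof -
    have u: "basis a * u' = lin (\<lambda>c. basis (a + c)) u'" 
      by (subst (1) lin_id[of u', symmetric]) (simp add: basis_add lin_pointwise_mult del: lin_single_coeff)
    have v: "basis b * v' = lin (\<lambda>c. basis (b + c)) v'" 
      by (subst (1) lin_id[of v', symmetric]) (simp add: basis_add lin_pointwise_mult del: lin_single_coeff)
    show ?thesis unfolding u v
      by (simp add: tens_def lin_pointwise_mult[symmetric] lin_lin basis_add[symmetric])
  qed
  have "(u * u') \<otimes>\<^sub>t (v * v') = lin (\<lambda>a. lin (\<lambda>b. (basis a * u') \<otimes>\<^sub>t (basis b * v')) v) u"
  proof -
    have 1: "u * u' = lin (\<lambda>a. basis a * u') u"
      by (subst (1) lin_id[of u, symmetric]) (simp add: lin_def sum_distrib_right del: lin_single_coeff)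
    have 2: "v * v' = lin (\<lambda>a. basis a * v') v"
      by (subst (1) lin_id[of v, symmetric]) (simp add: lin_def sum_distrib_right del: lin_single_coeff)
    have 3: "w \<otimes>\<^sub>t lin f x = lin (\<lambda>b. w \<otimes>\<^sub>t f b) x" for w :: "'a \<Rightarrow>\<^sub>0 real" and f and x :: "'b \<Rightarrow>\<^sub>0 real"
    proof -
      have "x \<in> span_of UNIV" by (simp add: span_of_def)
      then show ?thesis
        by (induction x rule: span_of_induct)
          (simp_all add: lin_add lin_scale tens_add_right del: lin_single_coeff)
    qed
    have 4: "lin f x \<otimes>\<^sub>t w = lin (\<lambda>b. f b \<otimes>\<^sub>t w) x" for w :: "'b \<Rightarrow>\<^sub>0 real" and f and x :: "'a \<Rightarrow>\<^sub>0 real"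
      by (simp add: tens_def lin_lin)
    show ?thesis by (simp only: 1 2 4) (simp only: 3)
  qed
  also have "\<dots> = (u \<otimes>\<^sub>t v) * (u' \<otimes>\<^sub>t v')"
    by (simp add: tens_def[of u v] m b)
  finally show ?thesis ..
qed

lemma tens_one: "1 \<otimes>\<^sub>t 1 = 1"
  unfolding basis_zero[symmetric] tens_basis by (simp add: zero_prod_def)

text \<open>Through \<open>tens_conv\<close> every pure tensor becomes a product in a commutative
  algebra, so identities between coactions reduce to commutative ring arithmetic.\<close>

definition embl :: "('a::comm_monoid_add \<Rightarrow>\<^sub>0 real) \<Rightarrow> ('a \<times> 'b::comm_monoid_add \<Rightarrow>\<^sub>0 real)" where
  "embl u = u \<otimes>\<^sub>t 1"

definition embr :: "('b::comm_monoid_add \<Rightarrow>\<^sub>0 real) \<Rightarrow> ('a::comm_monoid_add \<times> 'b \<Rightarrow>\<^sub>0 real)" where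
  "embr v = 1 \<otimes>\<^sub>t v"

lemma tens_conv: "u \<otimes>\<^sub>t v = embl u * embr v"
  by (simp add: embl_def embr_def tens_mult)

lemma embl_mult: "embl (u * v) = embl u * embl v"
  by (simp add: embl_def tens_mult)

lemma embr_mult: "embr (u * v) = embr u * embr v"
  by (simp add: embr_def tens_mult)

lemma embl_scale: "embl (scale c u) = scale c (embl u)"
  by (simp add: embl_def)

lemma embr_scale: "embr (scale c u) = scale c (embr u)"
  by (simp add: embr_def)

lemma embl_one: "embl 1 = 1" and embr_one: "embr 1 = 1"
  by (simp_all add: embl_def embr_def tens_one)

lemma embl_power: "embl (u ^ n) = embl u ^ n" and embr_power: "embr (v ^ n) = embr v ^ n"
  by (induction n) (simp_all add: embl_mult embl_one embr_mult embr_one)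

subsection \<open>Divided powers\<close>

text \<open>The divided power \<open>X^k/k!\<close> with arbitrary elements in place of the two
  coordinates. Divided powers obey a binomial formula without coefficients,
  \<open>divpow_add\<close>, which drives all manipulations of Taylor sums below.\<close>

definition divpow :: "('a::comm_monoid_add \<Rightarrow>\<^sub>0 real) \<Rightarrow> ('a \<Rightarrow>\<^sub>0 real) \<Rightarrow> idx \<Rightarrow> ('a \<Rightarrow>\<^sub>0 real)" where
  "divpow u v k = scale (1 / mfact k) (u ^ fst k * v ^ snd k)"

lemma divpow_lin: "mhom f \<Longrightarrow> lin f (divpow u v k) = divpow (lin f u) (lin f v) k"
  by (simp add: divpow_def lin_scale mhom_lin_mult mhom_lin_power)

lemma divpow_embl: "embl (divpow u v k) = divpow (embl u) (embl v) k"
  by (simp add: divpow_def embl_scale embl_mult embl_power)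

lemma divpow_embr: "embr (divpow u v k) = divpow (embr u) (embr v) k"
  by (simp add: divpow_def embr_scale embr_mult embr_power)

lemma divided_binomial:
  fixes u v :: "'a::comm_monoid_add \<Rightarrow>\<^sub>0 real"
  shows "scale (1 / fact n) ((u + v) ^ n)
    = (\<Sum>i\<le>n. scale (1 / fact i) (u ^ i) * scale (1 / fact (n - i)) (v ^ (n - i)))"
proof -
  have n: "of_nat m * (w :: 'a \<Rightarrow>\<^sub>0 real) = scale (real m) w" for m w
    by (induction m) (simp_all add: distrib_right scale_add_left)
  show ?thesis
    unfolding binomial_ring scale_sum
  proof (rule sum.cong)
    fix i assume i: "i \<in> {..n}"
    have "1 / fact n * real (n choose i) = 1 / fact i * (1 / fact (n - i))"
      using i by (simp add: binomial_fact)
    then show "scale (1 / fact n) (of_nat (n choose i) * u ^ i * v ^ (n - i))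
       = scale (1 / fact i) (u ^ i) * scale (1 / fact (n - i)) (v ^ (n - i))"
      by (simp add: n mult.assoc mult.commute[of "fact i"])
  qed simp
qed

lemma divpow_add:
  fixes u v u' v' :: "'a::comm_monoid_add \<Rightarrow>\<^sub>0 real"
  shows "divpow (u + u') (v + v') k = (\<Sum>(b, c) | b + c = k. divpow u v b * divpow u' v' c)"
proof -
  obtain m n where k: "k = (m, n)" by (cases k)
  define g where "g = (\<lambda>(i, j). ((i, j), (m - i, n - j)))"
  have im: "{(b, c). b + c = k} = g ` ({..m} \<times> {..n})"
  proof (rule set_eqI, rule iffI)
    fix x assume "x \<in> {(b, c). b + c = k}"
    then obtain b c where x: "x = (b, c)" and bc: "b + c = (m, n)" by (auto simp: k)
    then have "x = g b" "b \<in> {..m} \<times> {..n}"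
      by (cases b; cases c; auto simp: g_def)+
    then show "x \<in> g ` ({..m} \<times> {..n})" by blast
  qed (auto simp: k g_def)
  have inj: "inj_on g ({..m} \<times> {..n})" by (auto simp: inj_on_def g_def)
  have s: "divpow u v (i, j) = scale (1 / fact i) (u ^ i) * scale (1 / fact j) (v ^ j)" for i j u v
    by (simp add: divpow_def mfact_def mult.commute)
  have "(\<Sum>(b, c) | b + c = k. divpow u v b * divpow u' v' c)
      = (\<Sum>(i, j)\<in>{..m} \<times> {..n}. divpow u v (i, j) * divpow u' v' (m - i, n - j))"
    unfolding im by (subst sum.reindex[OF inj]) (simp add: g_def o_def case_prod_unfold)
  also have "\<dots> = scale (1 / fact m) ((u + u') ^ m) * scale (1 / fact n) ((v + v') ^ n)"
    unfolding divided_binomial s sum_product sum.cartesian_product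
    by (intro sum.cong) (auto simp: mult_ac)
  finally show ?thesis by (simp add: k s)
qed

lemma sdeg_add: "sdeg (a + b) = sdeg a + sdeg b"
  by (simp add: sdeg_def)

lemma finite_sdeg_less: "finite {k. real (sdeg k) < D}"
proof (rule finite_subset)
  show "{k. real (sdeg k) < D} \<subseteq> {..nat \<lceil>D\<rceil>} \<times> {..nat \<lceil>D\<rceil>}"
  proof (clarsimp)
    fix a b :: nat assume "real (sdeg (a, b)) < D"
    then have "real a < D" "real b < D" by (auto simp: sdeg_def)
    then show "a \<le> nat \<lceil>D\<rceil> \<and> b \<le> nat \<lceil>D\<rceil>" by linarith
  qed
qed simp

lemma finite_sdeg_pair_less: "finite {(b, c). real (sdeg (b + c)) < D}"
  by (rule finite_subset[of _ "{k. real (sdeg k) < D} \<times> {k. real (sdeg k) < D}"])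
     (auto simp: sdeg_add finite_sdeg_less)

text \<open>Since cutoff and factor \<open>G\<close> depend on \<open>b + c\<close> only, the pairs
  are grouped by their sum and the binomial formula is applied to each group.\<close>

lemma sum_divpow_add:
  fixes u v u' v' :: "'a::comm_monoid_add \<Rightarrow>\<^sub>0 real"
  shows "(\<Sum>(b, c) | real (sdeg (b + c)) < D. divpow u v b * divpow u' v' c * G (b + c))
    = (\<Sum>k | real (sdeg k) < D. divpow (u + u') (v + v') k * G k)"
proof -
  let ?S = "{(b, c). real (sdeg (b + c)) < D}" and ?T = "{k. real (sdeg k) < D}"
  let ?h = "\<lambda>(b, c). divpow u v b * divpow u' v' c * G (b + c)"
  have "(\<Sum>(b, c) | real (sdeg (b + c)) < D. divpow u v b * divpow u' v' c * G (b + c))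
     = (\<Sum>k\<in>?T. sum ?h {x \<in> ?S. fst x + snd x = k})"
    by (rule sum.group[symmetric]) (auto simp: finite_sdeg_less finite_sdeg_pair_less)
  also have "\<dots> = (\<Sum>k\<in>?T. divpow (u + u') (v + v') k * G k)"
  proof (rule sum.cong)
    fix k assume "k \<in> ?T"
    then have "{x \<in> ?S. fst x + snd x = k} = {(b, c). b + c = k}" by auto
    then show "sum ?h {x \<in> ?S. fst x + snd x = k} = divpow (u + u') (v + v') k * G k"
      unfolding divpow_add sum_distrib_right by (auto intro!: sum.cong)
  qed simp
  finally show ?thesis by simp
qed

text \<open>The inner cutoff, reduced by the degree of \<open>b\<close>, is exactly the cutoff of
  \<open>b + c\<close> at \<open>D\<close>. With \<open>u'\<close> cancelling a summand of
  \<open>u\<close> this removes a variable, as coassociativity requires.\<close>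

lemma sum_divpow_nested:
  fixes u v u' v' :: "'a::comm_monoid_add \<Rightarrow>\<^sub>0 real"
  shows "(\<Sum>b | real (sdeg b) < D. divpow u v b *
            (\<Sum>c | real (sdeg c) < D - real (sdeg b). divpow u' v' c * G (b + c)))
    = (\<Sum>k | real (sdeg k) < D. divpow (u + u') (v + v') k * G k)"
proof -
  have "(\<Sum>b | real (sdeg b) < D. divpow u v b *
            (\<Sum>c | real (sdeg c) < D - real (sdeg b). divpow u' v' c * G (b + c)))
     = (\<Sum>(b, c)\<in>(SIGMA b:{b. real (sdeg b) < D}. {c. real (sdeg c) < D - real (sdeg b)}).
            divpow u v b * divpow u' v' c * G (b + c))"
    by (subst sum.Sigma[symmetric]) (auto simp: finite_sdeg_less sum_distrib_left mult.assoc)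
  also have "(SIGMA b:{b. real (sdeg b) < D}. {c. real (sdeg c) < D - real (sdeg b)})
      = {(b, c). real (sdeg (b + c)) < D}"
    by (auto simp: sdeg_add)
  finally show ?thesis unfolding sum_divpow_add[symmetric] by simp
qed

section \<open>Trees and the coactions on generators\<close>

text \<open>Induction over the generators at the root only: the branches actually present enter as
  planted trees, and information about them is left to an outer induction, by size or along
  \<open>R\<close>.\<close>

lemma dtree_gen_induct [case_names zero time space noise0 noise1 graft add]:
  assumes zero: "P 0" and t: "P (monoX (1, 0))" and x: "P (monoX (0, 1))"
    and n0: "l > 0 \<Longrightarrow> P Xi0" and n1: "m > 0 \<Longrightarrow> P Xi1"
    and graft: "\<And>a \<sigma>. (a, \<sigma>) \<in># M \<Longrightarrow> P (graft a \<sigma>)"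
    and add: "\<And>\<sigma> \<tau>. P \<sigma> \<Longrightarrow> P \<tau> \<Longrightarrow> P (\<sigma> + \<tau>)"
  shows "P (Tree k l m M)"
proof -
  have 1: "P (Tree (i, 0) 0 0 {#})" for i
  proof (induction i)
    case (Suc i)
    then show ?case using add[OF t Suc] by simp
  qed (use zero in \<open>simp add: zero_dtree_def zero_prod_def\<close>)
  have 2: "P (Tree (0, j) 0 0 {#})" for j
  proof (induction j)
    case (Suc j)
    then show ?case using add[OF x Suc] by simp
  qed (use zero in \<open>simp add: zero_dtree_def zero_prod_def\<close>)
  have 3: "P (Tree 0 i 0 {#})" if "i \<le> l" for i
    using that
  proof (induction i)
    case (Suc i)
    then show ?case using add[OF n0, of "Tree 0 i 0 {#}"] by simp
  qed (use zero in \<open>simp add: zero_dtree_def\<close>)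
  have 4: "P (Tree 0 0 j {#})" if "j \<le> m" for j
    using that
  proof (induction j)
    case (Suc j)
    then show ?case using add[OF n1, of "Tree 0 0 j {#}"] by simp
  qed (use zero in \<open>simp add: zero_dtree_def\<close>)
  have 5: "P (Tree 0 0 0 N)" if "N \<subseteq># M" for N
    using that
  proof (induction N)
    case (add x N)
    obtain a \<sigma> where x: "x = (a, \<sigma>)" by (cases x)
    have "(a, \<sigma>) \<in># M" using mset_subset_eqD[OF add.prems] x by simp
    moreover have "P (Tree 0 0 0 N)"
      by (rule add.IH, rule subset_mset.order_trans[OF _ add.prems]) simp
    ultimately show ?case using assms(7)[OF graft, of a \<sigma> "Tree 0 0 0 N"] x by simp
  qed (use zero in \<open>simp add: zero_dtree_def\<close>)
  have "P ((((Tree (fst k, 0) 0 0 {#} + Tree (0, snd k) 0 0 {#}) + Tree 0 l 0 {#}) + Tree 0 0 m {#}) + Tree 0 0 0 M)"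
    by (intro add 1 2 3 4 5) simp_all
  then show ?thesis by (cases k) simp
qed

lemma dtree_full_induct [case_names zero time space noise0 noise1 graft add]:
  assumes "P 0" and "P (monoX (1, 0))" and "P (monoX (0, 1))" and "P Xi0" and "P Xi1"
    and graft: "\<And>a \<sigma>. P \<sigma> \<Longrightarrow> P (graft a \<sigma>)"
    and "\<And>\<sigma> \<tau>. P \<sigma> \<Longrightarrow> P \<tau> \<Longrightarrow> P (\<sigma> + \<tau>)"
  shows "P \<tau>"
proof (induction \<tau> rule: measure_induct_rule[of size])
  case (less \<tau>)
  obtain k l m M where \<tau>: "\<tau> = Tree k l m M" by (cases \<tau>)
  have "P (graft a \<sigma>)" if "(a, \<sigma>) \<in># M" for a \<sigma>
    by (rule graft, rule less) (use that \<tau> in \<open>auto dest!: multi_member_split\<close>)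
  then show ?case unfolding \<tau> by (rule dtree_gen_induct[OF assms(1-5) _ assms(7)])
qed

lemma Tree_eq_0_iff [simp]: "Tree k l m M = 0 \<longleftrightarrow> k = 0 \<and> l = 0 \<and> m = 0 \<and> M = {#}"
  by (simp add: zero_dtree_def)

section \<open>Monomials and the coactions on generators\<close>

lemma basis_monoX: "basis (monoX k) = basis (monoX (1, 0)) ^ fst k * basis (monoX (0, 1)) ^ snd k"
proof -
  have 1: "basis (monoX (1, 0)) ^ i = basis (monoX (i, 0))" for i
  proof (induction i)
    case 0
    show ?case using basis_zero[where 'a=dtree] by (simp add: zero_dtree_def zero_prod_def)
  qed (simp add: mult_single)
  have 2: "basis (monoX (0, 1)) ^ i = basis (monoX (0, i))" for i
  proof (induction i)
    case 0
    show ?case using basis_zero[where 'a=dtree] by (simp add: zero_dtree_def zero_prod_def)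
  qed (simp add: mult_single)
  show ?thesis unfolding 1 2 by (simp add: mult_single)
qed

lemma basis_Xp: "Xp k = Xp (1, 0) ^ fst k * Xp (0, 1) ^ snd k"
proof -
  have 1: "Xp (1, 0) ^ i = Xp (i, 0)" for i
  proof (induction i)
    case 0
    show ?case using basis_zero[where 'a=pmon] by (simp add: zero_prod_def)
  qed (simp add: mult_single)
  have 2: "Xp (0, 1) ^ i = Xp (0, i)" for i
  proof (induction i)
    case 0
    show ?case using basis_zero[where 'a=pmon] by (simp add: zero_prod_def)
  qed (simp add: mult_single)
  show ?thesis unfolding 1 2 by (simp add: mult_single)
qed

abbreviation X0 :: tvec where "X0 \<equiv> basis (monoX (1, 0))"
abbreviation X1 :: tvec where "X1 \<equiv> basis (monoX (0, 1))"
abbreviation P0 :: pvec where "P0 \<equiv> Xp (1, 0)"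
abbreviation P1 :: pvec where "P1 \<equiv> Xp (0, 1)"

lemma divpow_monoX: "scale (1 / mfact k) (basis (monoX k)) = divpow X0 X1 k"
  unfolding divpow_def basis_monoX[of k] ..

lemma divpow_Xp: "scale (1 / mfact k) (Xp k) = divpow P0 P1 k"
  unfolding divpow_def basis_Xp[of k] ..

lemma divpow_neg_Xp: "scale ((-1) ^ (fst k + snd k) / mfact k) (Xp k) = divpow (- P0) (- P1) k"
proof -
  have "- v = scale (-1) v" for v :: pvec by (simp add: scale_minus)
  then show ?thesis unfolding divpow_def basis_Xp[of k] by (simp add: scale_power power_add mult.commute del: lin_single_coeff)
qed

text \<open>The map \<open>II a\<close> tensor identity. The right leg stays polymorphic because the
  map is also applied in the triple tensor product.\<close>

definition graft_left :: "idx \<Rightarrow> (dtree \<times> 'b \<Rightarrow>\<^sub>0 real) \<Rightarrow> (dtree \<times> 'b \<Rightarrow>\<^sub>0 real)" where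
  "graft_left a = lin (\<lambda>(\<sigma>, p). basis (graft a \<sigma>, p))"

lemma mhom_coact_tree: "mhom (coact_tree \<alpha> i)"
  unfolding mhom_def
proof (intro conjI allI)
  show "coact_tree \<alpha> i 0 = 1" by (simp add: zero_dtree_def)
  fix s t :: dtree
  show "coact_tree \<alpha> i (s + t) = coact_tree \<alpha> i s * coact_tree \<alpha> i t"
    by (cases s; cases t) (simp add: power_add mult_ac)
qed

lemma mhom_coprod_mon: "mhom (coprod_mon \<alpha> i)"
  unfolding mhom_def
proof (intro conjI allI)
  show "coprod_mon \<alpha> i 0 = 1" by (simp add: zero_prod_def)
  fix s t :: pmon
  show "coprod_mon \<alpha> i (s + t) = coprod_mon \<alpha> i s * coprod_mon \<alpha> i t"
    by (cases s; cases t) (simp add: power_add mult_ac)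
qed

lemma mhom_coact_hat_tree: "mhom (coact_hat_tree \<alpha>)"
  unfolding mhom_def
proof (intro conjI allI)
  show "coact_hat_tree \<alpha> 0 = 1"
    using basis_zero[where 'a=dtree, unfolded zero_dtree_def] by (simp add: zero_dtree_def tens_one)
  fix s t :: dtree
  obtain k l m M where s: "s = Tree k l m M" by (cases s)
  obtain k' l' m' M' where t: "t = Tree k' l' m' M'" by (cases t)
  have "basis (Tree (k + k') (l + l') (m + m') {#}) = basis (Tree k l m {#}) * basis (Tree k' l' m' {#})"
    by (simp add: mult_single)
  then have "(basis (Tree (k + k') (l + l') (m + m') {#}) \<otimes>\<^sub>t 1 :: dtree \<times> pmon \<Rightarrow>\<^sub>0 real)
     = (basis (Tree k l m {#}) \<otimes>\<^sub>t 1) * (basis (Tree k' l' m' {#}) \<otimes>\<^sub>t 1)"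
    by (simp add: tens_mult)
  then show "coact_hat_tree \<alpha> (s + t) = coact_hat_tree \<alpha> s * coact_hat_tree \<alpha> t"
    by (simp add: s t mult_ac)
qed

lemma coact_tree_gen:
  "coact_tree \<alpha> i (monoX (1, 0)) = embl X0 + embr P0"
  "coact_tree \<alpha> i (monoX (0, 1)) = embl X1 + embr P1"
  "coact_tree \<alpha> i Xi0 = embl (basis Xi0)"
  "coact_tree \<alpha> i Xi1 = embl (basis Xi1)"
  by (simp_all add: embl_def embr_def)

lemma coact_tree_graft_raw:
  "coact_tree \<alpha> i (graft a \<tau>) = graft_left a (coact_tree \<alpha> i \<tau>)
     + (\<Sum>(b, c) | real (sdeg (b + c)) < deg \<alpha> i (graft a \<tau>).
          embl (divpow X0 X1 b) * embr (divpow P0 P1 c * IIp \<alpha> i (a + b + c) (basis \<tau>)))"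
  by (simp add: graft_left_def tens_basis divpow_monoX divpow_Xp tens_conv[symmetric])

text \<open>Summing over all splittings of \<open>k\<close> into two multi-indices gives the
  coaction of \<open>X^k/k!\<close>. In this form a multiplicative functional passes through the
  sum.\<close>

lemma coact_tree_graft:
  "coact_tree \<alpha> i (graft a \<tau>) = graft_left a (coact_tree \<alpha> i \<tau>)
     + (\<Sum>k | real (sdeg k) < deg \<alpha> i (graft a \<tau>).
          divpow (embl X0 + embr P0) (embl X1 + embr P1) k * embr (IIp \<alpha> i (a + k) (basis \<tau>)))"
  unfolding coact_tree_graft_raw sum_divpow_add[symmetric]
  by (simp add: divpow_embl divpow_embr embr_mult mult.assoc add.assoc)

lemma coact_hat_tree_gen:
  "coact_hat_tree \<alpha> (Tree k l m {#}) = embl (basis (Tree k l m {#}))"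
  by (simp add: embl_def)

lemma coact_hat_tree_graft:
  "coact_hat_tree \<alpha> (graft a \<tau>) = graft_left a (coact_hat_tree \<alpha> \<tau>)
     - Sum_any (\<lambda>b. if deg \<alpha> 1 (graft a \<tau>) \<le> real (sdeg b)
         then divpow X0 X1 b \<otimes>\<^sub>t
              lin (\<lambda>(\<sigma>, p). IIp \<alpha> 0 (a + b) (basis \<sigma>) * basis p) (coact_hat_tree \<alpha> \<tau>)
         else 0)"
  unfolding divpow_monoX[symmetric]
  by (simp add: graft_left_def tens_basis zero_dtree_def[symmetric] tens_one del: Tree_eq_0_iff)

lemma coprod_mon_gen:
  "coprod_mon \<alpha> i ((1, 0), {#}) = embl P0 + embr P0"
  "coprod_mon \<alpha> i ((0, 1), {#}) = embl P1 + embr P1"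
  by (simp_all add: embl_def embr_def)

lemma coprod_mon_graft:
  "coprod_mon \<alpha> i (0, {#(a, \<tau>)#}) =
     (\<Sum>b | real (sdeg b) < deg \<alpha> i (graft a \<tau>).
        lin (\<lambda>(\<sigma>, p). embl (IIp \<alpha> i (a + b) (basis \<sigma>)) * (divpow (embr (- P0)) (embr (- P1)) b * embr (basis p)))
            (coact_tree \<alpha> i \<tau>))
     + embr (IIp \<alpha> i a (basis \<tau>))"
  by (simp add: divpow_neg_Xp divpow_embr[symmetric] embr_mult[symmetric] tens_conv[symmetric] embr_def[symmetric])

lemma IIp_basis:
  "IIp \<alpha> i a (basis \<tau>) = (if 0 < deg \<alpha> i (graft a \<tau>) then basis (0, {#(a, \<tau>)#}) else 0)"
  by (simp add: IIp_def)

lemma deg_add: "deg \<alpha> i (\<sigma> + \<tau>) = deg \<alpha> i \<sigma> + deg \<alpha> i \<tau>"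
  by (cases \<sigma>; cases \<tau>) (simp add: sdeg_add algebra_simps)

lemma deg_graft: "deg \<alpha> i (graft a \<tau>) = deg \<alpha> i \<tau> + 2 - real (sdeg a)"
  by (simp add: sdeg_def)

lemma deg_monoX: "deg \<alpha> i (monoX k) = real (sdeg k)"
  by simp

lemma span_of_one [simp]: "1 \<in> span_of S \<longleftrightarrow> 0 \<in> S"
  by (simp add: span_of_def)

lemma span_of_tens:
  "u \<in> span_of S \<Longrightarrow> v \<in> span_of S' \<Longrightarrow> u \<otimes>\<^sub>t v \<in> span_of (S \<times> S')"
  unfolding tens_def by (auto intro!: span_of_lin[of u S] span_of_lin[of v S'])

lemma span_of_UNIV [simp]: "v \<in> span_of UNIV"
  by (simp add: span_of_def)

lemma span_of_divpow_monoX: "divpow X0 X1 k \<in> span_of {monoX k}"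
  unfolding divpow_monoX[symmetric] by (intro span_of_scale) simp

text \<open>A template for support statements: \<open>P \<sigma> \<tau>\<close> is any relation
  allowing \<open>\<sigma>\<close> on the left leg of the coaction of \<open>\<tau>\<close>. It only
  has to be compatible with products, planting and the cutting of a planted tree down to a
  polynomial.\<close>

lemma coact_tree_left_leg:
  assumes zero: "P 0 0" and t: "P (monoX (1, 0)) (monoX (1, 0))" "P 0 (monoX (1, 0))"
    and x: "P (monoX (0, 1)) (monoX (0, 1))" "P 0 (monoX (0, 1))"
    and n: "P Xi0 Xi0" "P Xi1 Xi1"
    and graft: "\<And>a \<sigma> \<tau>. P \<sigma> \<tau> \<Longrightarrow> P (graft a \<sigma>) (graft a \<tau>)"
    and poly: "\<And>a b \<tau>. real (sdeg b) < deg \<alpha> i (graft a \<tau>) \<Longrightarrow> P (monoX b) (graft a \<tau>)"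
    and add: "\<And>\<sigma> \<tau> \<sigma>' \<tau>'. P \<sigma> \<tau> \<Longrightarrow> P \<sigma>' \<tau>' \<Longrightarrow> P (\<sigma> + \<sigma>') (\<tau> + \<tau>')"
  shows "coact_tree \<alpha> i \<tau> \<in> span_of ({\<sigma>. P \<sigma> \<tau>} \<times> UNIV)"
proof (induction \<tau> rule: dtree_full_induct)
  case zero
  show ?case using assms(1) mhom_coact_tree[of \<alpha> i] by (simp add: mhom_def zero_prod_def)
next
  case time
  show ?case unfolding coact_tree_gen embl_def embr_def using t
    by (intro span_of_add span_of_tens) simp_all
next
  case space
  show ?case unfolding coact_tree_gen embl_def embr_def using x
    by (intro span_of_add span_of_tens) simp_all
next
  case noise0
  show ?case unfolding coact_tree_gen embl_def using n by (intro span_of_tens) simp_all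
next
  case noise1
  show ?case unfolding coact_tree_gen embl_def using n by (intro span_of_tens) simp_all
next
  case (graft a \<tau>)
  have "graft_left a (coact_tree \<alpha> i \<tau>) \<in> span_of ({\<sigma>. P \<sigma> (graft a \<tau>)} \<times> UNIV)"
    unfolding graft_left_def by (rule span_of_lin[OF graft]) (auto intro: assms(8))
  moreover have "embl (divpow X0 X1 b) * embr v \<in> span_of ({\<sigma>. P \<sigma> (graft a \<tau>)} \<times> UNIV)"
    if "real (sdeg (b + c)) < deg \<alpha> i (graft a \<tau>)" for b c and v :: pvec
  proof -
    have "P (monoX b) (graft a \<tau>)" using that by (intro poly) (simp add: sdeg_add)
    then show ?thesis unfolding tens_conv[symmetric]
      by (intro span_of_tens span_of_mono[OF _ span_of_divpow_monoX]) auto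
  qed
  ultimately show ?case unfolding coact_tree_graft_raw
    by (intro span_of_add span_of_sum) auto
next
  case (add \<sigma> \<tau>)
  have "coact_tree \<alpha> i (\<sigma> + \<tau>) = coact_tree \<alpha> i \<sigma> * coact_tree \<alpha> i \<tau>"
    using mhom_coact_tree[of \<alpha> i] by (simp add: mhom_def)
  then show ?case using span_of_mult[OF add] assms(10) by fastforce
qed

lemma coact_hat_tree_left_leg:
  assumes zero: "P 0 0" and t: "P (monoX (1, 0)) (monoX (1, 0))"
    and x: "P (monoX (0, 1)) (monoX (0, 1))"
    and n: "P Xi0 Xi0" "P Xi1 Xi1"
    and graft: "\<And>a \<sigma> \<tau>. P \<sigma> \<tau> \<Longrightarrow> P (graft a \<sigma>) (graft a \<tau>)"
    and poly: "\<And>a b \<tau>. deg \<alpha> 1 (graft a \<tau>) \<le> real (sdeg b) \<Longrightarrow> P (monoX b) (graft a \<tau>)"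
    and add: "\<And>\<sigma> \<tau> \<sigma>' \<tau>'. P \<sigma> \<tau> \<Longrightarrow> P \<sigma>' \<tau>' \<Longrightarrow> P (\<sigma> + \<sigma>') (\<tau> + \<tau>')"
  shows "coact_hat_tree \<alpha> \<tau> \<in> span_of ({\<sigma>. P \<sigma> \<tau>} \<times> UNIV)"
proof (induction \<tau> rule: dtree_full_induct)
  case zero
  show ?case using assms(1) mhom_coact_hat_tree[of \<alpha>] by (simp add: mhom_def zero_prod_def)
next
  case time
  show ?case unfolding coact_hat_tree_gen embl_def using t by (intro span_of_tens) simp_all
next
  case space
  show ?case unfolding coact_hat_tree_gen embl_def using x by (intro span_of_tens) simp_all
next
  case noise0
  show ?case unfolding coact_hat_tree_gen embl_def using n by (intro span_of_tens) simp_all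
next
  case noise1
  show ?case unfolding coact_hat_tree_gen embl_def using n by (intro span_of_tens) simp_all
next
  case (graft a \<tau>)
  have "graft_left a (coact_hat_tree \<alpha> \<tau>) \<in> span_of ({\<sigma>. P \<sigma> (graft a \<tau>)} \<times> UNIV)"
    unfolding graft_left_def by (rule span_of_lin[OF graft]) (auto intro: assms(6))
  moreover have "divpow X0 X1 b \<otimes>\<^sub>t v \<in> span_of ({\<sigma>. P \<sigma> (graft a \<tau>)} \<times> UNIV)"
    if "deg \<alpha> 1 (graft a \<tau>) \<le> real (sdeg b)" for b and v :: pvec
    using poly[OF that] by (intro span_of_tens span_of_mono[OF _ span_of_divpow_monoX]) auto
  ultimately show ?case unfolding coact_hat_tree_graft Sum_any.expand_set
    by (intro span_of_diff span_of_sum) auto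
next
  case (add \<sigma> \<tau>)
  have "coact_hat_tree \<alpha> (\<sigma> + \<tau>) = coact_hat_tree \<alpha> \<sigma> * coact_hat_tree \<alpha> \<tau>"
    using mhom_coact_hat_tree[of \<alpha>] by (simp add: mhom_def)
  then show ?case using span_of_mult[OF add] assms(8) by fastforce
qed

text \<open>A planted tree is cut down to polynomials of strictly smaller degree, and planting and
  products are monotone in the degree.\<close>

lemma coact_tree_deg_le: "coact_tree \<alpha> i \<tau> \<in> span_of ({\<sigma>. deg \<alpha> i \<sigma> \<le> deg \<alpha> i \<tau>} \<times> UNIV)"
proof (rule coact_tree_left_leg[where P="\<lambda>\<sigma> \<tau>. deg \<alpha> i \<sigma> \<le> deg \<alpha> i \<tau>"])
  fix a \<sigma> \<tau> assume "deg \<alpha> i \<sigma> \<le> deg \<alpha> i \<tau>"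
  then show "deg \<alpha> i (graft a \<sigma>) \<le> deg \<alpha> i (graft a \<tau>)" unfolding deg_graft by simp
next
  fix a b \<tau> assume "real (sdeg b) < deg \<alpha> i (graft a \<tau>)"
  then show "deg \<alpha> i (monoX b) \<le> deg \<alpha> i (graft a \<tau>)" unfolding deg_monoX by simp
qed (simp_all add: deg_add sdeg_def zero_dtree_def del: Tree_eq_0_iff)

text \<open>Here the monotonicity is reversed: the polynomials inserted by
  \<open>coact_hat_tree\<close> have at least the degree \<open>deg \<alpha> 1\<close> of the
  planted tree that they replace.\<close>

lemma coact_hat_tree_deg_ge: "coact_hat_tree \<alpha> \<tau> \<in> span_of ({\<sigma>. deg \<alpha> 1 \<tau> \<le> deg \<alpha> 1 \<sigma>} \<times> UNIV)"
proof (rule coact_hat_tree_left_leg[where P="\<lambda>\<sigma> \<tau>. deg \<alpha> 1 \<tau> \<le> deg \<alpha> 1 \<sigma>"])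
  fix a \<sigma> \<tau> assume "deg \<alpha> 1 \<tau> \<le> deg \<alpha> 1 \<sigma>"
  then show "deg \<alpha> 1 (graft a \<tau>) \<le> deg \<alpha> 1 (graft a \<sigma>)" unfolding deg_graft by simp
next
  fix a b \<tau> assume "deg \<alpha> 1 (graft a \<tau>) \<le> real (sdeg b)"
  then show "deg \<alpha> 1 (graft a \<tau>) \<le> deg \<alpha> 1 (monoX b)" unfolding deg_monoX by simp
qed (simp_all add: deg_add sdeg_def zero_dtree_def del: Tree_eq_0_iff)

subsection \<open>Trees given by a rule\<close>

text \<open>The condition at each node sees the noises and the edge decorations, never the
  polynomial decoration. Trees with at most one noise per node, trees without \<open>Xi1\<close>,
  polynomials and \<open>noise_rule\<close> are all instances, so stability under the coactions is
  shown once.\<close>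

inductive_set rule_trees :: "(nat \<Rightarrow> nat \<Rightarrow> idx multiset \<Rightarrow> bool) \<Rightarrow> dtree set" for \<rho> where
  "\<rho> l m (image_mset fst M) \<Longrightarrow> (\<And>a \<tau>. (a, \<tau>) \<in># M \<Longrightarrow> \<tau> \<in> rule_trees \<rho>) \<Longrightarrow> Tree k l m M \<in> rule_trees \<rho>"

lemma rule_trees_Tree:
  "Tree k l m M \<in> rule_trees \<rho> \<longleftrightarrow>
     \<rho> l m (image_mset fst M) \<and> (\<forall>a \<tau>. (a, \<tau>) \<in># M \<longrightarrow> \<tau> \<in> rule_trees \<rho>)"
  by (auto intro: rule_trees.intros elim: rule_trees.cases)

definition down_closed :: "(nat \<Rightarrow> nat \<Rightarrow> idx multiset \<Rightarrow> bool) \<Rightarrow> bool" where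
  "down_closed \<rho> \<longleftrightarrow> (\<forall>l m A B. \<rho> l m A \<longrightarrow> B \<subseteq># A \<longrightarrow> \<rho> l m B)"

text \<open>Obeying a rule at the root does not pass from factors to their product, so the relation
  compares root edges and noises directly and transports obedience only for the branches. In this
  form it is compatible with products.\<close>

definition cut_of :: "(nat \<Rightarrow> nat \<Rightarrow> idx multiset \<Rightarrow> bool) \<Rightarrow> dtree \<Rightarrow> dtree \<Rightarrow> bool" where
  "cut_of \<rho> \<sigma> \<tau> \<longleftrightarrow> (\<exists>k l m M k' M'. \<sigma> = Tree k' l m M' \<and> \<tau> = Tree k l m M
      \<and> image_mset fst M' \<subseteq># image_mset fst M
      \<and> ((\<forall>a \<tau>. (a, \<tau>) \<in># M \<longrightarrow> \<tau> \<in> rule_trees \<rho>) \<longrightarrow> (\<forall>a \<sigma>. (a, \<sigma>) \<in># M' \<longrightarrow> \<sigma> \<in> rule_trees \<rho>)))"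

lemma cut_of_rule_trees: "down_closed \<rho> \<Longrightarrow> cut_of \<rho> \<sigma> \<tau> \<Longrightarrow> \<tau> \<in> rule_trees \<rho> \<Longrightarrow> \<sigma> \<in> rule_trees \<rho>"
  unfolding cut_of_def down_closed_def by (auto simp: rule_trees_Tree)

lemma cut_of_gen:
  "cut_of \<rho> 0 0" "cut_of \<rho> (monoX k) (monoX k')" "cut_of \<rho> 0 (monoX k')"
  "cut_of \<rho> Xi0 Xi0" "cut_of \<rho> Xi1 Xi1" "cut_of \<rho> (monoX k) (graft a \<tau>)"
  by (auto simp: cut_of_def zero_dtree_def simp del: Tree_eq_0_iff)

lemma cut_of_graft: "down_closed \<rho> \<Longrightarrow> cut_of \<rho> \<sigma> \<tau> \<Longrightarrow> cut_of \<rho> (graft a \<sigma>) (graft a \<tau>)"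
  using cut_of_rule_trees[of \<rho> \<sigma> \<tau>] by (auto simp: cut_of_def)

lemma cut_of_add:
  assumes "cut_of \<rho> \<sigma> \<tau>" and "cut_of \<rho> \<sigma>' \<tau>'"
  shows "cut_of \<rho> (\<sigma> + \<sigma>') (\<tau> + \<tau>')"
proof -
  obtain k l m M k1 M1 where 1: "\<sigma> = Tree k1 l m M1" "\<tau> = Tree k l m M"
      "image_mset fst M1 \<subseteq># image_mset fst M"
      "(\<forall>a \<tau>. (a, \<tau>) \<in># M \<longrightarrow> \<tau> \<in> rule_trees \<rho>) \<longrightarrow> (\<forall>a \<sigma>. (a, \<sigma>) \<in># M1 \<longrightarrow> \<sigma> \<in> rule_trees \<rho>)"
    using assms(1) unfolding cut_of_def by blast
  obtain k' l' m' M' k2 M2 where 2: "\<sigma>' = Tree k2 l' m' M2" "\<tau>' = Tree k' l' m' M'"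
      "image_mset fst M2 \<subseteq># image_mset fst M'"
      "(\<forall>a \<tau>. (a, \<tau>) \<in># M' \<longrightarrow> \<tau> \<in> rule_trees \<rho>) \<longrightarrow> (\<forall>a \<sigma>. (a, \<sigma>) \<in># M2 \<longrightarrow> \<sigma> \<in> rule_trees \<rho>)"
    using assms(2) unfolding cut_of_def by blast
  have "image_mset fst (M1 + M2) \<subseteq># image_mset fst (M + M')"
    using 1(3) 2(3) by (simp add: subset_mset.add_mono)
  moreover have "(\<forall>a \<tau>. (a, \<tau>) \<in># M + M' \<longrightarrow> \<tau> \<in> rule_trees \<rho>) \<longrightarrow>
      (\<forall>a \<sigma>. (a, \<sigma>) \<in># M1 + M2 \<longrightarrow> \<sigma> \<in> rule_trees \<rho>)"
    using 1(4) 2(4) by (metis union_iff)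
  ultimately show ?thesis unfolding cut_of_def 1(1,2) 2(1,2) plus_dtree.simps by blast
qed

lemma coact_tree_rule_trees:
  assumes "down_closed \<rho>" and "\<tau> \<in> rule_trees \<rho>"
  shows "coact_tree \<alpha> i \<tau> \<in> span_of (rule_trees \<rho> \<times> UNIV)"
proof -
  have "coact_tree \<alpha> i \<tau> \<in> span_of ({\<sigma>. cut_of \<rho> \<sigma> \<tau>} \<times> UNIV)"
    by (rule coact_tree_left_leg[where P="cut_of \<rho>"]) (assumption | rule cut_of_gen cut_of_graft[OF assms(1)] cut_of_add)+
  then show ?thesis by (rule span_of_mono[rotated]) (use assms cut_of_rule_trees in blast)
qed

lemma coact_hat_tree_rule_trees:
  assumes "down_closed \<rho>" and "\<tau> \<in> rule_trees \<rho>"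
  shows "coact_hat_tree \<alpha> \<tau> \<in> span_of (rule_trees \<rho> \<times> UNIV)"
proof -
  have "coact_hat_tree \<alpha> \<tau> \<in> span_of ({\<sigma>. cut_of \<rho> \<sigma> \<tau>} \<times> UNIV)"
    by (rule coact_hat_tree_left_leg[where P="cut_of \<rho>"]) (assumption | rule cut_of_gen cut_of_graft[OF assms(1)] cut_of_add)+
  then show ?thesis by (rule span_of_mono[rotated]) (use assms cut_of_rule_trees in blast)
qed

section \<open>Coassociativity and the action of functionals\<close>

lemma embl_conv_lin: "embl u = lin (\<lambda>a. basis (a, 0)) u"
  unfolding embl_def tens_def basis_zero[symmetric] lin_basis ..

lemma embr_conv_lin: "embr v = lin (\<lambda>b. basis (0, b)) v"
  unfolding embr_def tens_def basis_zero[symmetric] lin_basis ..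

lemma lin_embl: "lin f (embl u) = lin (\<lambda>a. f (a, 0)) u"
  by (simp add: embl_conv_lin lin_lin)

lemma lin_embr: "lin f (embr v) = lin (\<lambda>b. f (0, b)) v"
  by (simp add: embr_conv_lin lin_lin)

lemma embr_add: "embr (u + v) = embr u + embr v"
  by (simp add: embr_conv_lin lin_add)

lemma embr_lin: "embr (lin f v) = lin (\<lambda>a. embr (f a)) v"
  by (simp add: embr_conv_lin lin_lin)

lemma embr_sum: "embr (sum g S) = (\<Sum>a\<in>S. embr (g a))"
  by (simp add: embr_conv_lin lin_sum)

lemma embr_uminus: "embr (- v) = - embr v"
  by (simp add: embr_conv_lin lin_uminus)

lemma lin_lin_split: "lin f (lin (\<lambda>(a, b). g a b) v) = lin (\<lambda>(a, b). lin f (g a b)) v"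
  by (simp add: lin_lin case_prod_unfold)

lemma graft_left_lin: "graft_left a (lin f v) = lin (\<lambda>s. graft_left a (f s)) v"
  by (simp add: graft_left_def lin_lin)

lemma graft_left_mult_embr: "graft_left a u * embr v = graft_left a (u * embr v)"
  for u :: "dtree \<times> 'b::comm_monoid_add \<Rightarrow>\<^sub>0 real"
proof -
  have 1: "graft_left a (basis s * embr v) = graft_left a (basis s) * embr v" for s :: "dtree \<times> 'b"
    by (cases s)
      (simp add: embr_conv_lin lin_pointwise_mult[symmetric] graft_left_def lin_lin mult_single case_prod_unfold
         plus_prod_def)
  have u: "u \<in> span_of UNIV" by simp
  show ?thesis using u
    by (induction u rule: span_of_induct)
      (simp_all add: graft_left_def lin_add lin_scale distrib_right 1[unfolded graft_left_def] del: lin_single_coeff)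
qed

text \<open>Triple tensors are nested to the right throughout; this adjoins a unit as their third
  leg.\<close>

definition pad_right :: "(dtree \<times> pmon \<Rightarrow>\<^sub>0 real) \<Rightarrow> (dtree \<times> pmon \<times> pmon \<Rightarrow>\<^sub>0 real)" where
  "pad_right = lin (\<lambda>(\<sigma>, p). basis (\<sigma>, p, 0))"

lemma mhom_pad_right: "mhom (\<lambda>(\<sigma>, p). basis (\<sigma> :: dtree, p :: pmon, 0 :: pmon) :: _ \<Rightarrow>\<^sub>0 real)"
  using basis_zero[where 'a="dtree \<times> pmon \<times> pmon"]
  by (auto simp: mhom_def mult_single zero_prod_def)

lemma pad_right_mult: "pad_right (u * v) = pad_right u * pad_right v"
  unfolding pad_right_def by (rule mhom_lin_mult[OF mhom_pad_right])

lemma pad_right_one: "pad_right 1 = 1"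
  unfolding pad_right_def by (rule mhom_lin_one[OF mhom_pad_right])

lemma pad_right_embl: "pad_right (embl u) = embl u"
  by (simp add: pad_right_def lin_embl) (simp add: embl_conv_lin zero_prod_def)

lemma pad_right_embr: "pad_right (embr v) = embr (embl v)"
  by (simp add: pad_right_def lin_embr) (simp add: embl_conv_lin embr_conv_lin lin_lin)

lemma pad_right_graft_left: "pad_right (graft_left a u) = graft_left a (pad_right u)"
  by (simp add: pad_right_def graft_left_def lin_lin case_prod_unfold)

text \<open>The map \<Delta> \<otimes> Id in the right-nested triple tensor product.\<close>

definition coact_then_coact :: "real \<Rightarrow> nat \<Rightarrow> (dtree \<times> pmon \<Rightarrow>\<^sub>0 real) \<Rightarrow> (dtree \<times> pmon \<times> pmon \<Rightarrow>\<^sub>0 real)" where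
  "coact_then_coact \<alpha> i = lin (\<lambda>(\<sigma>, p). pad_right (coact_tree \<alpha> i \<sigma>) * embr (embr (basis p)))"

text \<open>The map Id \<otimes> \<open>\<Delta>\<^sup>+\<close>.\<close>

definition coact_then_coprod :: "real \<Rightarrow> nat \<Rightarrow> (dtree \<times> pmon \<Rightarrow>\<^sub>0 real) \<Rightarrow> (dtree \<times> pmon \<times> pmon \<Rightarrow>\<^sub>0 real)" where
  "coact_then_coprod \<alpha> i = lin (\<lambda>(\<sigma>, p). embl (basis \<sigma>) * embr (coprod_mon \<alpha> i p))"

lemma mhom_coact_then_coact:
  "mhom (\<lambda>(\<sigma>, p). pad_right (coact_tree \<alpha> i \<sigma>) * embr (embr (basis p)))"
proof -
  have "mhom (\<lambda>s. pad_right (coact_tree \<alpha> i (fst s)) * embr (embr (basis (snd s))))"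
    using mhom_coact_tree[of \<alpha> i]
    by (simp add: mhom_def pad_right_mult pad_right_one embr_one basis_add embr_mult mult_ac
        del: coact_tree.simps)
  then show ?thesis by (simp add: case_prod_unfold)
qed

lemma mhom_coact_then_coprod:
  "mhom (\<lambda>(\<sigma>, p). embl (basis \<sigma>) * embr (coprod_mon \<alpha> i p))"
proof -
  have "mhom (\<lambda>s. embl (basis (fst s)) * embr (coprod_mon \<alpha> i (snd s)))"
    using mhom_coprod_mon[of \<alpha> i]
    by (simp add: mhom_def embl_one embr_one basis_add embr_mult embl_mult mult_ac
        del: coprod_mon.simps)
  then show ?thesis by (simp add: case_prod_unfold)
qed

lemma coact_tree_zero: "coact_tree \<alpha> i 0 = 1" and coprod_mon_zero: "coprod_mon \<alpha> i 0 = 1"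
  using mhom_coact_tree mhom_coprod_mon by (auto simp: mhom_def)

lemma lin_embr_embr_basis: "lin (\<lambda>p. embr (embr (basis p))) v = embr (embr v)"
  by (simp add: embr_conv_lin lin_lin)

lemma lin_embl_basis: "lin (\<lambda>p. embl (basis p)) v = embl v"
  by (simp add: embl_conv_lin)

lemma coact_then_coact_embr: "coact_then_coact \<alpha> i (embr v) = embr (embr v)"
  by (simp add: coact_then_coact_def lin_embr coact_tree_zero pad_right_one lin_embr_embr_basis)

lemma coact_then_coact_embl: "coact_then_coact \<alpha> i (embl (basis \<sigma>)) = pad_right (coact_tree \<alpha> i \<sigma>)"
  by (simp add: coact_then_coact_def lin_embl embr_one)

lemma coact_then_coprod_embr: "coact_then_coprod \<alpha> i (embr v) = embr (lin (coprod_mon \<alpha> i) v)"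
  by (simp add: coact_then_coprod_def lin_embr embl_one embr_lin)

lemma coact_then_coprod_embl: "coact_then_coprod \<alpha> i (embl v) = embl v"
  by (simp add: coact_then_coprod_def lin_embl coprod_mon_zero embr_one lin_embl_basis)

lemma coact_then_coprod_graft_left:
  "coact_then_coprod \<alpha> i (graft_left a w) = graft_left a (coact_then_coprod \<alpha> i w)"
proof -
  have "embl (basis (graft a \<sigma>)) * embr v = graft_left a (embl (basis \<sigma>) * embr v)" for \<sigma> and v :: "pmon \<times> pmon \<Rightarrow>\<^sub>0 real"
    unfolding graft_left_mult_embr[symmetric] by (simp add: embl_conv_lin graft_left_def)
  then show ?thesis
    by (simp add: coact_then_coprod_def graft_left_lin case_prod_unfold)
       (simp add: graft_left_def lin_lin case_prod_unfold)
qed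

lemma IIp_vanish: "deg \<alpha> i (graft a \<tau>) \<le> 0 \<Longrightarrow> IIp \<alpha> i a (basis \<tau>) = 0"
  by (simp add: IIp_basis del: deg.simps)

lemma deg_graft_add: "deg \<alpha> i (graft (a + b) \<tau>) = deg \<alpha> i (graft a \<tau>) - real (sdeg b)"
  unfolding deg_graft by (simp add: sdeg_add)

text \<open>The tensor with unit left leg in which \<Delta>\<open>\<tau>\<close> fills the other
  two, its trees under a positive planted symbol. Both sides of coassociativity produce it.\<close>

definition mixed :: "real \<Rightarrow> nat \<Rightarrow> dtree \<Rightarrow> idx \<Rightarrow> (dtree \<times> pmon \<times> pmon \<Rightarrow>\<^sub>0 real)" where
  "mixed \<alpha> i \<tau> c = lin (\<lambda>(\<sigma>, p). embr (embl (IIp \<alpha> i c (basis \<sigma>))) * embr (embr (basis p))) (coact_tree \<alpha> i \<tau>)"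

lemma coact_then_coact_graft_left:
  "coact_then_coact \<alpha> i (graft_left a (coact_tree \<alpha> i \<tau>)) =
     graft_left a (coact_then_coact \<alpha> i (coact_tree \<alpha> i \<tau>))
     + (\<Sum>k | real (sdeg k) < deg \<alpha> i (graft a \<tau>).
          divpow (embl X0 + embr (embl P0)) (embl X1 + embr (embl P1)) k * mixed \<alpha> i \<tau> (a + k))"
proof -
  let ?Y = "divpow (embl X0 + embr (embl P0)) (embl X1 + embr (embl P1))"
  have s: "pad_right (coact_tree \<alpha> i (graft a \<sigma>)) = graft_left a (pad_right (coact_tree \<alpha> i \<sigma>))
      + (\<Sum>k | real (sdeg k) < deg \<alpha> i (graft a \<tau>). ?Y k * embr (embl (IIp \<alpha> i (a + k) (basis \<sigma>))))"
    if "deg \<alpha> i \<sigma> \<le> deg \<alpha> i \<tau>" for \<sigma>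
  proof -
    have "pad_right (divpow (embl X0 + embr P0) (embl X1 + embr P1) k * embr v) = ?Y k * embr (embl v)" for k v
      unfolding pad_right_mult pad_right_embr
      unfolding pad_right_def divpow_lin[OF mhom_pad_right]
      unfolding pad_right_def[symmetric] by (simp add: pad_right_def lin_add)
         (simp add: pad_right_def[symmetric] pad_right_embl pad_right_embr)
    then have "pad_right (coact_tree \<alpha> i (graft a \<sigma>)) = graft_left a (pad_right (coact_tree \<alpha> i \<sigma>))
      + (\<Sum>k | real (sdeg k) < deg \<alpha> i (graft a \<sigma>). ?Y k * embr (embl (IIp \<alpha> i (a + k) (basis \<sigma>))))"
      unfolding coact_tree_graft pad_right_graft_left[symmetric]
      by (simp add: pad_right_def lin_add lin_sum)
    also have "(\<Sum>k | real (sdeg k) < deg \<alpha> i (graft a \<sigma>). ?Y k * embr (embl (IIp \<alpha> i (a + k) (basis \<sigma>))))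
       = (\<Sum>k | real (sdeg k) < deg \<alpha> i (graft a \<tau>). ?Y k * embr (embl (IIp \<alpha> i (a + k) (basis \<sigma>))))"
    \<comment> \<open>This gives one summation range for all trees on the left leg: at the added
      indices the planted tree has nonpositive degree, where \<open>IIp\<close> is zero.\<close>
    proof (rule sum.mono_neutral_left[OF finite_sdeg_less])
      show "{k. real (sdeg k) < deg \<alpha> i (graft a \<sigma>)} \<subseteq> {k. real (sdeg k) < deg \<alpha> i (graft a \<tau>)}"
        using that unfolding deg_graft by auto
      show "\<forall>k\<in>{k. real (sdeg k) < deg \<alpha> i (graft a \<tau>)} - {k. real (sdeg k) < deg \<alpha> i (graft a \<sigma>)}.
          ?Y k * embr (embl (IIp \<alpha> i (a + k) (basis \<sigma>))) = 0"
      proof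
        fix k assume "k \<in> {k. real (sdeg k) < deg \<alpha> i (graft a \<tau>)} - {k. real (sdeg k) < deg \<alpha> i (graft a \<sigma>)}"
        then have "deg \<alpha> i (graft (a + k) \<sigma>) \<le> 0" unfolding deg_graft_add by auto
        then have "IIp \<alpha> i (a + k) (basis \<sigma>) = 0" by (rule IIp_vanish)
        then show "?Y k * embr (embl (IIp \<alpha> i (a + k) (basis \<sigma>))) = 0" by (simp add: embl_def embr_def)
      qed
    qed
    finally show ?thesis .
  qed
  have "coact_then_coact \<alpha> i (graft_left a (coact_tree \<alpha> i \<tau>))
      = lin (\<lambda>(\<sigma>, p). pad_right (coact_tree \<alpha> i (graft a \<sigma>)) * embr (embr (basis p))) (coact_tree \<alpha> i \<tau>)"
    by (simp add: coact_then_coact_def graft_left_def lin_lin_split)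
  also have "\<dots> = lin (\<lambda>(\<sigma>, p). graft_left a (pad_right (coact_tree \<alpha> i \<sigma>) * embr (embr (basis p)))
        + (\<Sum>k | real (sdeg k) < deg \<alpha> i (graft a \<tau>).
            ?Y k * (embr (embl (IIp \<alpha> i (a + k) (basis \<sigma>))) * embr (embr (basis p))))) (coact_tree \<alpha> i \<tau>)"
  proof (rule lin_eq_on_span[OF coact_tree_deg_le], clarify)
    fix \<sigma> p assume d: "deg \<alpha> i \<sigma> \<le> deg \<alpha> i \<tau>"
    show "pad_right (coact_tree \<alpha> i (graft a \<sigma>)) * embr (embr (basis p))
        = graft_left a (pad_right (coact_tree \<alpha> i \<sigma>) * embr (embr (basis p)))
        + (\<Sum>k | real (sdeg k) < deg \<alpha> i (graft a \<tau>).
            ?Y k * (embr (embl (IIp \<alpha> i (a + k) (basis \<sigma>))) * embr (embr (basis p))))"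
      unfolding s[OF d] distrib_right graft_left_mult_embr sum_distrib_right mult.assoc ..
  qed
  also have "\<dots> = graft_left a (coact_then_coact \<alpha> i (coact_tree \<alpha> i \<tau>))
     + (\<Sum>k | real (sdeg k) < deg \<alpha> i (graft a \<tau>). ?Y k * mixed \<alpha> i \<tau> (a + k))"
    unfolding coact_then_coact_def graft_left_lin mixed_def case_prod_unfold lin_pointwise_add lin_pointwise_sum lin_pointwise_mult ..
  finally show ?thesis .
qed

lemma coact_then_coprod_IIp:
  assumes "real (sdeg k) < deg \<alpha> i (graft a \<tau>)"
  shows "coact_then_coprod \<alpha> i (embr (IIp \<alpha> i (a + k) (basis \<tau>))) =
     (\<Sum>b | real (sdeg b) < deg \<alpha> i (graft a \<tau>) - real (sdeg k).
        divpow (- embr (embr P0)) (- embr (embr P1)) b * mixed \<alpha> i \<tau> (a + (k + b)))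
     + embr (embr (IIp \<alpha> i (a + k) (basis \<tau>)))"
proof -
  have p: "IIp \<alpha> i (a + k) (basis \<tau>) = basis (0, {#(a + k, \<tau>)#})"
    using assms by (simp add: IIp_basis deg_graft_add del: deg.simps)
  have t: "embr (lin (\<lambda>(\<sigma>, p). embl (IIp \<alpha> i (a + k + b) (basis \<sigma>)) * (divpow (embr (- P0)) (embr (- P1)) b * embr (basis p)))
             (coact_tree \<alpha> i \<tau>))
      = divpow (- embr (embr P0)) (- embr (embr P1)) b * mixed \<alpha> i \<tau> (a + (k + b))" for b
    unfolding mixed_def lin_pointwise_mult[symmetric] embr_lin case_prod_unfold embr_mult divpow_embr embr_uminus add.assoc
    by (simp only: mult_ac)
  have "coact_then_coprod \<alpha> i (embr (IIp \<alpha> i (a + k) (basis \<tau>))) = embr (coprod_mon \<alpha> i (0, {#(a + k, \<tau>)#}))"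
    unfolding coact_then_coprod_embr p lin_basis ..
  also have "\<dots> = (\<Sum>b | real (sdeg b) < deg \<alpha> i (graft (a + k) \<tau>).
        divpow (- embr (embr P0)) (- embr (embr P1)) b * mixed \<alpha> i \<tau> (a + (k + b)))
     + embr (embr (IIp \<alpha> i (a + k) (basis \<tau>)))"
    unfolding coprod_mon_graft embr_add embr_sum t ..
  finally show ?thesis unfolding deg_graft_add .
qed

text \<open>The content is the planted case. On the coproduct side the outer sum carries powers of X
  in all three legs and the inner sum powers of -X in the third; their nested sum cancels the third
  leg and leaves the sum of the coaction side.\<close>

lemma coassociativity:
  "coact_then_coact \<alpha> i (coact_tree \<alpha> i \<tau>) = coact_then_coprod \<alpha> i (coact_tree \<alpha> i \<tau>)"
proof (induction \<tau> rule: dtree_full_induct)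
  case zero
  show ?case unfolding coact_tree_zero coact_then_coact_def coact_then_coprod_def
    by (simp only: mhom_lin_one[OF mhom_coact_then_coact] mhom_lin_one[OF mhom_coact_then_coprod])
next
  case time
  have "coact_then_coact \<alpha> i (embl X0 + embr P0) = embl X0 + embr (embl P0) + embr (embr P0)"
    unfolding coact_then_coact_def lin_add
    unfolding coact_then_coact_def[symmetric] coact_then_coact_embr coact_then_coact_embl coact_tree_gen
    by (simp add: pad_right_def lin_add) (simp add: pad_right_def[symmetric] pad_right_embl pad_right_embr)
  moreover have "coact_then_coprod \<alpha> i (embl X0 + embr P0) = embl X0 + embr (embl P0) + embr (embr P0)"
    unfolding coact_then_coprod_def lin_add
    unfolding coact_then_coprod_def[symmetric] coact_then_coprod_embr coact_then_coprod_embl lin_basis coprod_mon_gen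
    by (simp add: embr_add add.assoc)
  ultimately show ?case unfolding coact_tree_gen by simp
next
  case space
  have "coact_then_coact \<alpha> i (embl X1 + embr P1) = embl X1 + embr (embl P1) + embr (embr P1)"
    unfolding coact_then_coact_def lin_add
    unfolding coact_then_coact_def[symmetric] coact_then_coact_embr coact_then_coact_embl coact_tree_gen
    by (simp add: pad_right_def lin_add) (simp add: pad_right_def[symmetric] pad_right_embl pad_right_embr)
  moreover have "coact_then_coprod \<alpha> i (embl X1 + embr P1) = embl X1 + embr (embl P1) + embr (embr P1)"
    unfolding coact_then_coprod_def lin_add
    unfolding coact_then_coprod_def[symmetric] coact_then_coprod_embr coact_then_coprod_embl lin_basis coprod_mon_gen
    by (simp add: embr_add add.assoc)
  ultimately show ?case unfolding coact_tree_gen by simp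
next
  case noise0
  show ?case unfolding coact_tree_gen coact_then_coact_embl coact_then_coprod_embl pad_right_embl ..
next
  case noise1
  show ?case unfolding coact_tree_gen coact_then_coact_embl coact_then_coprod_embl pad_right_embl ..
next
  case (graft a \<tau>)
  define D where "D = deg \<alpha> i (graft a \<tau>)"
  let ?S = "divpow (embl X0 + embr (embl P0) + embr (embr P0)) (embl X1 + embr (embl P1) + embr (embr P1))"
  let ?Y = "divpow (embl X0 + embr P0) (embl X1 + embr P1)"
  have l: "coact_then_coact \<alpha> i (?Y k * embr v) = ?S k * embr (embr v)" for k v
  proof -
    have "coact_then_coact \<alpha> i (?Y k) = ?S k"
      unfolding coact_then_coact_def divpow_lin[OF mhom_coact_then_coact] lin_add
      unfolding coact_then_coact_def[symmetric] coact_then_coact_embr coact_then_coact_embl coact_tree_gen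
      by (simp add: pad_right_def lin_add) (simp add: pad_right_def[symmetric] pad_right_embl pad_right_embr)
    moreover have "coact_then_coact \<alpha> i (?Y k * embr v) = coact_then_coact \<alpha> i (?Y k) * coact_then_coact \<alpha> i (embr v)"
      unfolding coact_then_coact_def by (rule mhom_lin_mult[OF mhom_coact_then_coact])
    ultimately show ?thesis by (simp add: coact_then_coact_embr)
  qed
  have r: "coact_then_coprod \<alpha> i (?Y k * embr v) = ?S k * coact_then_coprod \<alpha> i (embr v)" for k v
  proof -
    have "coact_then_coprod \<alpha> i (?Y k) = ?S k"
      unfolding coact_then_coprod_def divpow_lin[OF mhom_coact_then_coprod] lin_add
      unfolding coact_then_coprod_def[symmetric] coact_then_coprod_embr coact_then_coprod_embl lin_basis coprod_mon_gen
      by (simp add: embr_add add.assoc)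
    moreover have "coact_then_coprod \<alpha> i (?Y k * embr v) = coact_then_coprod \<alpha> i (?Y k) * coact_then_coprod \<alpha> i (embr v)"
      unfolding coact_then_coprod_def by (rule mhom_lin_mult[OF mhom_coact_then_coprod])
    ultimately show ?thesis by simp
  qed
  have "coact_then_coact \<alpha> i (coact_tree \<alpha> i (graft a \<tau>))
      = coact_then_coact \<alpha> i (graft_left a (coact_tree \<alpha> i \<tau>))
       + (\<Sum>k | real (sdeg k) < D. ?S k * embr (embr (IIp \<alpha> i (a + k) (basis \<tau>))))"
    unfolding coact_tree_graft D_def[symmetric] l[symmetric]
    by (simp add: coact_then_coact_def lin_add lin_sum del: deg.simps)
  also have "\<dots> = graft_left a (coact_then_coact \<alpha> i (coact_tree \<alpha> i \<tau>))
     + (\<Sum>k | real (sdeg k) < D. divpow (embl X0 + embr (embl P0)) (embl X1 + embr (embl P1)) k * mixed \<alpha> i \<tau> (a + k))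
     + (\<Sum>k | real (sdeg k) < D. ?S k * embr (embr (IIp \<alpha> i (a + k) (basis \<tau>))))"
    unfolding coact_then_coact_graft_left D_def[symmetric] ..
  finally have L: "coact_then_coact \<alpha> i (coact_tree \<alpha> i (graft a \<tau>)) = \<dots>" .
  have "coact_then_coprod \<alpha> i (coact_tree \<alpha> i (graft a \<tau>))
      = graft_left a (coact_then_coprod \<alpha> i (coact_tree \<alpha> i \<tau>))
       + (\<Sum>k | real (sdeg k) < D. ?S k * coact_then_coprod \<alpha> i (embr (IIp \<alpha> i (a + k) (basis \<tau>))))"
    unfolding coact_tree_graft D_def[symmetric] r[symmetric] coact_then_coprod_graft_left[symmetric]
    by (simp add: coact_then_coprod_def lin_add lin_sum del: deg.simps)
  also have "(\<Sum>k | real (sdeg k) < D. ?S k * coact_then_coprod \<alpha> i (embr (IIp \<alpha> i (a + k) (basis \<tau>))))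
     = (\<Sum>k | real (sdeg k) < D. ?S k * (\<Sum>b | real (sdeg b) < D - real (sdeg k).
          divpow (- embr (embr P0)) (- embr (embr P1)) b * mixed \<alpha> i \<tau> (a + (k + b))))
      + (\<Sum>k | real (sdeg k) < D. ?S k * embr (embr (IIp \<alpha> i (a + k) (basis \<tau>))))"
    unfolding sum.distrib[symmetric]
  proof (rule sum.cong[OF refl], clarify)
    fix k0 k1 assume "real (sdeg (k0, k1)) < D"
    then show "?S (k0, k1) * coact_then_coprod \<alpha> i (embr (IIp \<alpha> i (a + (k0, k1)) (basis \<tau>)))
      = ?S (k0, k1) * (\<Sum>b | real (sdeg b) < D - real (sdeg (k0, k1)).
          divpow (- embr (embr P0)) (- embr (embr P1)) b * mixed \<alpha> i \<tau> (a + ((k0, k1) + b)))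
       + ?S (k0, k1) * embr (embr (IIp \<alpha> i (a + (k0, k1)) (basis \<tau>)))"
      unfolding D_def by (simp only: coact_then_coprod_IIp distrib_left)
  qed
  \<comment> \<open>The cancellation of the third leg: the arguments of the two divided powers add
    up to X in the first two legs.\<close>
  also have "(\<Sum>k | real (sdeg k) < D. ?S k * (\<Sum>b | real (sdeg b) < D - real (sdeg k).
          divpow (- embr (embr P0)) (- embr (embr P1)) b * mixed \<alpha> i \<tau> (a + (k + b))))
     = (\<Sum>k | real (sdeg k) < D. divpow (embl X0 + embr (embl P0)) (embl X1 + embr (embl P1)) k * mixed \<alpha> i \<tau> (a + k))"
    unfolding sum_divpow_nested[where G="\<lambda>k. mixed \<alpha> i \<tau> (a + k)"] by simp
  finally show ?case unfolding L graft.IH by (simp only: add.assoc)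
next
  case (add \<sigma> \<tau>)
  have c: "coact_tree \<alpha> i (\<sigma> + \<tau>) = coact_tree \<alpha> i \<sigma> * coact_tree \<alpha> i \<tau>"
    using mhom_coact_tree[of \<alpha> i] by (simp add: mhom_def del: coact_tree.simps)
  show ?case using add unfolding c coact_then_coact_def coact_then_coprod_def
    unfolding mhom_lin_mult[OF mhom_coact_then_coact] mhom_lin_mult[OF mhom_coact_then_coprod] by simp
qed

subsection \<open>Functionals on the right leg\<close>

definition eval_right :: "('b \<Rightarrow> real) \<Rightarrow> (dtree \<times> 'b \<Rightarrow>\<^sub>0 real) \<Rightarrow> tvec" where
  "eval_right g = lin (\<lambda>(\<sigma>, p). scale (g p) (basis \<sigma>))"

text \<open>Arbitrary functionals are allowed, since the inverse of a character is at first known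
  only through its convolution identities.\<close>

definition act :: "real \<Rightarrow> nat \<Rightarrow> (pmon \<Rightarrow> real) \<Rightarrow> tvec \<Rightarrow> tvec" where
  "act \<alpha> i g = lin (\<lambda>\<tau>. eval_right g (coact_tree \<alpha> i \<tau>))"

definition convolve :: "real \<Rightarrow> nat \<Rightarrow> (pmon \<Rightarrow> real) \<Rightarrow> (pmon \<Rightarrow> real) \<Rightarrow> pmon \<Rightarrow> real" where
  "convolve \<alpha> i g h p = lin_real (\<lambda>(q, r). g q * h r) (coprod_mon \<alpha> i p)"

definition counit :: "pmon \<Rightarrow> real" where
  "counit p = (if p = 0 then 1 else 0)"

lemma mhom_eval_right: "mhom g \<Longrightarrow> mhom (\<lambda>(\<sigma>, p). scale (g p) (basis (\<sigma> :: dtree)))"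
  by (auto simp: mhom_def zero_prod_def basis_add simp del: lin_single_coeff plus_dtree.simps)
     (auto simp: mult_single mult.commute)

lemma eval_right_tens: "eval_right g (embl u * embr v) = scale (lin_real g v) u"
proof -
  have "eval_right g (u \<otimes>\<^sub>t v) = lin (\<lambda>\<sigma>. scale (lin_real g v) (basis \<sigma>)) u"
    unfolding eval_right_def lin_tens by (simp add: lin_scale_fixed del: lin_single_coeff)
  then show ?thesis by (simp add: tens_conv[symmetric] lin_pointwise_scale lin_id del: lin_single_coeff)
qed

lemma eval_right_embl: "eval_right g (embl u) = scale (g 0) u"
  using eval_right_tens[of g u 1] lin_real_basis[of g 0] by (simp add: embr_one del: lin_real_basis)

lemma eval_right_graft_left: "eval_right g (graft_left a w) = II a (eval_right g w)"
  by (simp add: eval_right_def graft_left_def II_def lin_lin case_prod_unfold lin_scale del: lin_single_coeff)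

lemma eval_right_add: "eval_right g (u + v) = eval_right g u + eval_right g v"
  by (simp add: eval_right_def lin_add)

lemma eval_right_sum: "eval_right g (sum f S) = (\<Sum>s\<in>S. eval_right g (f s))"
  by (simp add: eval_right_def lin_sum)

lemma act_basis [simp]: "act \<alpha> i g (basis \<tau>) = eval_right g (coact_tree \<alpha> i \<tau>)"
  by (simp add: act_def)

lemma act_linear:
  "act \<alpha> i g 0 = 0" "act \<alpha> i g (u + v) = act \<alpha> i g u + act \<alpha> i g v"
  "act \<alpha> i g (scale c v) = scale c (act \<alpha> i g v)" "act \<alpha> i g (u - v) = act \<alpha> i g u - act \<alpha> i g v"
  "act \<alpha> i g (sum f S) = (\<Sum>s\<in>S. act \<alpha> i g (f s))"
  by (simp_all add: act_def lin_add lin_scale lin_diff lin_sum)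

lemma mhom_act_basis: "mhom g \<Longrightarrow> mhom (\<lambda>\<tau>. eval_right g (coact_tree \<alpha> i \<tau>))"
  unfolding eval_right_def by (rule mhom_compose_lin[OF mhom_eval_right mhom_coact_tree])

lemma act_mult: "mhom g \<Longrightarrow> act \<alpha> i g (u * v) = act \<alpha> i g u * act \<alpha> i g v"
  unfolding act_def by (rule mhom_lin_mult[OF mhom_act_basis])

lemma act_one: "mhom g \<Longrightarrow> act \<alpha> i g 1 = 1"
  unfolding act_def by (rule mhom_lin_one[OF mhom_act_basis])

lemma act_graft_raw:
  "act \<alpha> i g (basis (graft a \<tau>)) = II a (act \<alpha> i g (basis \<tau>))
     + (\<Sum>(b, c) | real (sdeg (b + c)) < deg \<alpha> i (graft a \<tau>).
          scale (lin_real g (divpow P0 P1 c * IIp \<alpha> i (a + b + c) (basis \<tau>))) (divpow X0 X1 b))"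
  unfolding act_basis coact_tree_graft_raw eval_right_add eval_right_graft_left eval_right_sum case_prod_unfold
    eval_right_tens ..

text \<open>For a character the polynomial factors of the two legs recombine into the action on
  \<open>X^k/k!\<close>; for general \<open>g\<close> only \<open>act_graft_raw\<close>
  holds.\<close>

lemma act_graft:
  assumes g: "mhom g"
  shows "act \<alpha> i g (basis (graft a \<tau>)) = II a (act \<alpha> i g (basis \<tau>))
     + (\<Sum>k | real (sdeg k) < deg \<alpha> i (graft a \<tau>).
          scale (lin_real g (IIp \<alpha> i (a + k) (basis \<tau>))) (act \<alpha> i g (divpow X0 X1 k)))"
proof -
  have "eval_right g (divpow (embl X0 + embr P0) (embl X1 + embr P1) k * embr v)
     = scale (lin_real g v) (act \<alpha> i g (divpow X0 X1 k))" for k v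
  proof -
    have "eval_right g (divpow (embl X0 + embr P0) (embl X1 + embr P1) k * embr v)
      = eval_right g (divpow (embl X0 + embr P0) (embl X1 + embr P1) k) * eval_right g (embl 1 * embr v)"
      unfolding embl_one mult_1_left eval_right_def by (rule mhom_lin_mult[OF mhom_eval_right[OF g]])
    also have "eval_right g (divpow (embl X0 + embr P0) (embl X1 + embr P1) k) = act \<alpha> i g (divpow X0 X1 k)"
      unfolding act_def divpow_lin[OF mhom_act_basis[OF g]] lin_basis coact_tree_gen
      unfolding eval_right_def divpow_lin[OF mhom_eval_right[OF g]] ..
    finally show ?thesis by (simp add: eval_right_tens mult.commute)
  qed
  then show ?thesis
    unfolding act_basis coact_tree_graft eval_right_add eval_right_graft_left eval_right_sum by simp
qed

text \<open>Coassociativity tested against a pair of functionals on the two right legs.\<close>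

lemma act_act: "act \<alpha> i g (act \<alpha> i h v) = act \<alpha> i (convolve \<alpha> i g h) v"
proof -
  \<comment> \<open>The evaluation Id \<otimes> g \<otimes> h on the triple tensor product.\<close>
  define e where "e = lin (\<lambda>(\<sigma>, q, r). scale (g q * h r) (basis (\<sigma> :: dtree)))"
  have 1: "e (pad_right u * embr (embr (basis p))) = scale (h p) (eval_right g u)" for u p
  proof -
    have u: "u \<in> span_of UNIV" by simp
    show ?thesis using u
    proof (induction u rule: span_of_induct)
      case (step c s u)
      obtain \<sigma> q where s: "s = (\<sigma>, q)" by (cases s)
      have "pad_right (basis s) * embr (embr (basis p)) = basis (\<sigma>, q, p)"
        by (simp add: pad_right_def s embr_conv_lin mult_single)
      then have "e (pad_right (basis s) * embr (embr (basis p))) = scale (h p) (eval_right g (basis s))"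
        by (simp add: e_def eval_right_def s mult.commute)
      then show ?case using step.IH
        by (simp add: pad_right_def eval_right_def e_def lin_add lin_scale distrib_right scale_add_right
            mult.commute[of c] del: lin_single_coeff lin_basis)
    qed (simp add: pad_right_def eval_right_def e_def)
  qed
  have 2: "e (embl (basis \<sigma>) * embr w) = scale (lin_real (\<lambda>(q, r). g q * h r) w) (basis \<sigma>)" for \<sigma> w
    unfolding e_def tens_conv[symmetric] lin_tens
    by (simp add: case_prod_unfold lin_scale_fixed del: lin_single_coeff)
  have "act \<alpha> i g (eval_right h (coact_tree \<alpha> i \<tau>)) = eval_right (convolve \<alpha> i g h) (coact_tree \<alpha> i \<tau>)" for \<tau>
  proof -
    have "act \<alpha> i g (eval_right h (coact_tree \<alpha> i \<tau>)) = e (coact_then_coact \<alpha> i (coact_tree \<alpha> i \<tau>))"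
      unfolding act_def eval_right_def[of h] coact_then_coact_def
      by (simp add: lin_lin_split lin_scale 1[unfolded e_def] e_def del: lin_single_coeff coact_tree.simps)
    also have "\<dots> = e (coact_then_coprod \<alpha> i (coact_tree \<alpha> i \<tau>))" unfolding coassociativity ..
    also have "\<dots> = eval_right (convolve \<alpha> i g h) (coact_tree \<alpha> i \<tau>)"
      unfolding coact_then_coprod_def eval_right_def convolve_def 2[symmetric] e_def
      by (simp add: lin_lin_split del: coact_tree.simps coprod_mon.simps)
    finally show ?thesis .
  qed
  then show ?thesis
    unfolding act_def[of \<alpha> i h] act_def[of \<alpha> i "convolve \<alpha> i g h"]
    by (simp add: act_def lin_lin del: coact_tree.simps)
qed

lemma mhom_counit: "mhom counit"
  unfolding mhom_def counit_def by (auto simp: zero_prod_def)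

lemma act_counit: "act \<alpha> i counit v = v"
proof -
  have "act \<alpha> i counit (basis \<tau>) = basis \<tau>" for \<tau>
  proof (induction \<tau> rule: dtree_full_induct)
    case zero
    show ?case using act_one[OF mhom_counit] by simp
  next
    case time
    show ?case unfolding act_basis coact_tree_gen eval_right_add eval_right_embl
      using eval_right_tens[of counit 1 P0] by (simp add: embl_one counit_def zero_prod_def)
  next
    case space
    show ?case unfolding act_basis coact_tree_gen eval_right_add eval_right_embl
      using eval_right_tens[of counit 1 P1] by (simp add: embl_one counit_def zero_prod_def)
  next
    case noise0
    show ?case unfolding act_basis coact_tree_gen eval_right_embl by (simp add: counit_def)
  next
    case noise1
    show ?case unfolding act_basis coact_tree_gen eval_right_embl by (simp add: counit_def)
  next
    case (graft a \<tau>)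
    have "lin_real counit (IIp \<alpha> i b (basis \<tau>)) = 0" for b
      by (simp add: IIp_basis counit_def zero_prod_def)
    then show ?case unfolding act_graft[OF mhom_counit] graft.IH by (simp add: II_def)
  next
    case (add \<sigma> \<tau>)
    then show ?case unfolding basis_add act_mult[OF mhom_counit] by simp
  qed
  then have "act \<alpha> i counit v = lin basis v" unfolding act_def by (simp del: coact_tree.simps)
  then show ?thesis by (simp add: lin_id)
qed

declare coact_tree.simps [simp del] coprod_mon.simps [simp del] coact_hat_tree.simps [simp del]
  deg.simps [simp del] lin_single_coeff [simp del] One_nat_def [simp del]

section \<open>Preparation maps and models\<close>

lemma trees_Tree:
  "Tree k l m M \<in> trees \<longleftrightarrow> l + m \<le> 1 \<and> (\<forall>a \<tau>. (a, \<tau>) \<in># M \<longrightarrow> \<tau> \<in> trees)"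
  by (auto intro: trees.intros elim: trees.cases)

lemma trees_eq_rule_trees: "trees = rule_trees (\<lambda>l m A. l + m \<le> 1)" (is "_ = ?T")
proof -
  have "\<tau> \<in> trees \<longleftrightarrow> \<tau> \<in> ?T" for \<tau>
  proof (induction \<tau> rule: measure_induct_rule[of size])
    case (less \<tau>)
    obtain k l m M where \<tau>: "\<tau> = Tree k l m M" by (cases \<tau>)
    have "\<sigma> \<in> trees \<longleftrightarrow> \<sigma> \<in> ?T" if "(a, \<sigma>) \<in># M" for a \<sigma>
      by (rule less) (use that \<tau> in \<open>auto dest!: multi_member_split\<close>)
    then show ?case unfolding \<tau> trees_Tree rule_trees_Tree by blast
  qed
  then show ?thesis by blast
qed

text \<open>The product leaves \<open>trees\<close>, but not the larger set in which the root may carry several noises.\<close>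

definition wide_trees :: "dtree set" where
  "wide_trees = {\<tau>. \<exists>k l m M. \<tau> = Tree k l m M \<and> (\<forall>a \<sigma>. (a, \<sigma>) \<in># M \<longrightarrow> \<sigma> \<in> trees)}"

lemma wide_trees_Tree: "Tree k l m M \<in> wide_trees \<longleftrightarrow> (\<forall>a \<sigma>. (a, \<sigma>) \<in># M \<longrightarrow> \<sigma> \<in> trees)"
  by (simp add: wide_trees_def)

lemma trees_subset_wide: "trees \<subseteq> wide_trees"
proof
  fix \<tau> assume "\<tau> \<in> trees"
  then show "\<tau> \<in> wide_trees" by (cases \<tau>) (auto simp: trees_Tree wide_trees_Tree)
qed

lemma wide_trees_add: "\<sigma> \<in> wide_trees \<Longrightarrow> \<tau> \<in> wide_trees \<Longrightarrow> \<sigma> + \<tau> \<in> wide_trees"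
  by (cases \<sigma>; cases \<tau>) (auto simp: wide_trees_Tree)

lemma wide_trees_gen: "0 \<in> wide_trees" "monoX k \<in> wide_trees" "Xi0 \<in> wide_trees" "Xi1 \<in> wide_trees"
  "graft a \<tau> \<in> wide_trees \<longleftrightarrow> \<tau> \<in> trees"
  by (auto simp: wide_trees_Tree zero_dtree_def)

lemma trees_child: "Tree k l m M \<in> trees \<Longrightarrow> (a, \<sigma>) \<in># M \<Longrightarrow> \<sigma> \<in> trees"
  unfolding trees_Tree by blast

lemma wide_trees_child: "Tree k l m M \<in> wide_trees \<Longrightarrow> (a, \<sigma>) \<in># M \<Longrightarrow> \<sigma> \<in> trees"
  unfolding wide_trees_Tree by blast

lemma span_of_Times:
  "v \<in> span_of (S \<times> UNIV) \<Longrightarrow> v \<in> span_of (UNIV \<times> S') \<Longrightarrow> v \<in> span_of (S \<times> S')"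
  by (auto simp: span_of_def)

lemma Tplus_zero: "(k, {#}) \<in> Tplus \<alpha> i" and Tplus_add: "p \<in> Tplus \<alpha> i \<Longrightarrow> q \<in> Tplus \<alpha> i \<Longrightarrow> p + q \<in> Tplus \<alpha> i"
  by (auto simp: Tplus_def split: prod.splits)

lemma IIp_span_Tplus: "\<tau> \<in> trees \<Longrightarrow> IIp \<alpha> i a (basis \<tau>) \<in> span_of (Tplus \<alpha> i)"
  by (auto simp: IIp_basis Tplus_def)

lemma span_of_graft_left: "w \<in> span_of (S \<times> S') \<Longrightarrow> (\<And>\<sigma>. \<sigma> \<in> S \<Longrightarrow> graft a \<sigma> \<in> S'') \<Longrightarrow> graft_left a w \<in> span_of (S'' \<times> S')"
  unfolding graft_left_def by (rule span_of_lin) auto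

lemma coact_tree_add: "coact_tree \<alpha> i (\<sigma> + \<tau>) = coact_tree \<alpha> i \<sigma> * coact_tree \<alpha> i \<tau>"
  using mhom_coact_tree by (simp add: mhom_def)

lemma coact_tree_wide_step:
  assumes c: "\<And>a \<sigma>. (a, \<sigma>) \<in># M \<Longrightarrow> \<sigma> \<in> trees \<and> coact_tree \<alpha> i \<sigma> \<in> span_of (trees \<times> Tplus \<alpha> i)"
  shows "coact_tree \<alpha> i (Tree k l m M) \<in> span_of (wide_trees \<times> Tplus \<alpha> i)"
proof -
  have one: "(1 :: pvec) \<in> span_of (Tplus \<alpha> i)" "(1 :: tvec) \<in> span_of wide_trees"
    by (simp_all add: zero_prod_def Tplus_zero wide_trees_gen)
  show ?thesis
  proof (rule dtree_gen_induct[where P="\<lambda>\<tau>. coact_tree \<alpha> i \<tau> \<in> span_of (wide_trees \<times> Tplus \<alpha> i)"])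
    show "coact_tree \<alpha> i 0 \<in> span_of (wide_trees \<times> Tplus \<alpha> i)"
      by (simp add: coact_tree_zero zero_prod_def wide_trees_gen Tplus_zero)
    show "coact_tree \<alpha> i (monoX (1, 0)) \<in> span_of (wide_trees \<times> Tplus \<alpha> i)"
      "coact_tree \<alpha> i (monoX (0, 1)) \<in> span_of (wide_trees \<times> Tplus \<alpha> i)"
      unfolding coact_tree_gen embl_def embr_def
      by (intro span_of_add span_of_tens one; simp add: wide_trees_gen Tplus_zero)+
    show "coact_tree \<alpha> i Xi0 \<in> span_of (wide_trees \<times> Tplus \<alpha> i)"
      "coact_tree \<alpha> i Xi1 \<in> span_of (wide_trees \<times> Tplus \<alpha> i)"
      unfolding coact_tree_gen embl_def
      by (intro span_of_tens one; simp add: wide_trees_gen)+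
    fix a \<sigma> assume "(a, \<sigma>) \<in># M"
    from c[OF this] have \<sigma>: "\<sigma> \<in> trees" "coact_tree \<alpha> i \<sigma> \<in> span_of (trees \<times> Tplus \<alpha> i)" by auto
    have X: "divpow X0 X1 b \<in> span_of wide_trees" for b
      by (rule span_of_mono[OF _ span_of_divpow_monoX]) (simp add: wide_trees_gen)
    have P: "divpow P0 P1 b * IIp \<alpha> i c (basis \<sigma>) \<in> span_of (Tplus \<alpha> i)" for b c
      unfolding divpow_Xp[symmetric]
      by (rule span_of_mult[OF span_of_scale IIp_span_Tplus[OF \<sigma>(1)]])
         (auto simp: Tplus_zero intro!: Tplus_add)
    show "coact_tree \<alpha> i (graft a \<sigma>) \<in> span_of (wide_trees \<times> Tplus \<alpha> i)"
      unfolding coact_tree_graft_raw embl_def embr_def tens_mult mult_1_left mult_1_right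
      by (intro span_of_add span_of_sum span_of_graft_left[OF \<sigma>(2)])
         (auto simp: wide_trees_gen intro!: span_of_tens X P)
  next
    fix \<sigma> \<tau> assume "coact_tree \<alpha> i \<sigma> \<in> span_of (wide_trees \<times> Tplus \<alpha> i)"
      and "coact_tree \<alpha> i \<tau> \<in> span_of (wide_trees \<times> Tplus \<alpha> i)"
    then show "coact_tree \<alpha> i (\<sigma> + \<tau>) \<in> span_of (wide_trees \<times> Tplus \<alpha> i)"
      unfolding coact_tree_add
    proof (rule span_of_mult)
      fix s t assume "s \<in> wide_trees \<times> Tplus \<alpha> i" "t \<in> wide_trees \<times> Tplus \<alpha> i"
      then show "s + t \<in> wide_trees \<times> Tplus \<alpha> i"
        by (simp add: mem_Times_iff wide_trees_add Tplus_add)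
    qed
  qed
qed

text \<open>Building the coaction up by products controls the right leg but may collect several
  noises on the left; the rule argument repairs the left leg, and the two supports are
  intersected.\<close>

lemma coact_tree_trees:
  assumes "\<tau> \<in> trees"
  shows "coact_tree \<alpha> i \<tau> \<in> span_of (trees \<times> Tplus \<alpha> i)"
  using assms
proof (induction \<tau> rule: trees.induct)
  case (1 l m M k)
  have t: "Tree k l m M \<in> trees" using 1 by (auto simp: trees_Tree)
  have "coact_tree \<alpha> i (Tree k l m M) \<in> span_of (wide_trees \<times> Tplus \<alpha> i)"
    by (rule coact_tree_wide_step) (use 1 in auto)
  then have "coact_tree \<alpha> i (Tree k l m M) \<in> span_of (UNIV \<times> Tplus \<alpha> i)"
    by (rule span_of_mono[rotated]) auto
  moreover have "coact_tree \<alpha> i (Tree k l m M) \<in> span_of (trees \<times> UNIV)"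
    unfolding trees_eq_rule_trees
    by (rule coact_tree_rule_trees) (use t in \<open>auto simp: down_closed_def trees_eq_rule_trees\<close>)
  ultimately show ?case by (rule span_of_Times[rotated])
qed

lemma coact_tree_wide:
  assumes "\<tau> \<in> wide_trees"
  shows "coact_tree \<alpha> i \<tau> \<in> span_of (wide_trees \<times> Tplus \<alpha> i)"
proof (cases \<tau>)
  case (Tree k l m M)
  show ?thesis unfolding Tree
    by (rule coact_tree_wide_step) (use assms Tree coact_tree_trees wide_trees_Tree in blast)
qed

lemma eval_right_span: "w \<in> span_of (S \<times> S') \<Longrightarrow> eval_right g w \<in> span_of S"
  unfolding eval_right_def by (rule span_of_lin) (auto intro: span_of_scale)

lemma act_trees: "v \<in> span_of trees \<Longrightarrow> act \<alpha> i g v \<in> span_of trees"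
  unfolding act_def by (rule span_of_lin) (auto intro: eval_right_span coact_tree_trees)

lemma act_wide: "v \<in> span_of wide_trees \<Longrightarrow> act \<alpha> i g v \<in> span_of wide_trees"
  unfolding act_def by (rule span_of_lin) (auto intro: eval_right_span coact_tree_wide)

lemma act_rule_trees:
  "down_closed \<rho> \<Longrightarrow> v \<in> span_of (rule_trees \<rho>) \<Longrightarrow> act \<alpha> i g v \<in> span_of (rule_trees \<rho>)"
  unfolding act_def by (rule span_of_lin) (auto intro: eval_right_span coact_tree_rule_trees)

text \<open>Antipode identities are available on \<open>Tplus\<close> only; this turns an equality
  of functionals there into an equality of actions.\<close>

lemma act_cong_Tplus:
  assumes "v \<in> span_of wide_trees" and "\<And>p. p \<in> Tplus \<alpha> i \<Longrightarrow> g p = h p"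
  shows "act \<alpha> i g v = act \<alpha> i h v"
  unfolding act_def
proof (rule lin_eq_on_span[OF assms(1)])
  fix \<tau> assume "\<tau> \<in> wide_trees"
  from coact_tree_wide[OF this]
  show "eval_right g (coact_tree \<alpha> i \<tau>) = eval_right h (coact_tree \<alpha> i \<tau>)"
    unfolding eval_right_def by (rule lin_eq_on_span) (auto simp: assms(2))
qed

lemma span_wide_mult: "u \<in> span_of wide_trees \<Longrightarrow> v \<in> span_of wide_trees \<Longrightarrow> u * v \<in> span_of wide_trees"
  by (rule span_of_mult) (auto intro: wide_trees_add)

lemma span_trees_wide: "v \<in> span_of trees \<Longrightarrow> v \<in> span_of wide_trees"
  by (rule span_of_mono[OF trees_subset_wide])

text \<open>The order is the one behind \<open>PiHat_dom_trees\<close>: a branch is smaller than the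
  tree, and \<open>R\<close> either keeps the branch or lowers its number of noises.\<close>

lemma preparation_map_induct:
  assumes P: "preparation_map \<alpha> R" and "\<tau> \<in> trees"
    and step: "\<And>k l m M. Tree k l m M \<in> trees \<Longrightarrow>
      (\<And>a t s. (a, t) \<in># M \<Longrightarrow> s \<in> Poly_Mapping.keys (R t) \<Longrightarrow> Q s) \<Longrightarrow> Q (Tree k l m M)"
  shows "Q \<tau>"
  using assms(2)
proof (induction "(noises \<tau>, size \<tau>)" arbitrary: \<tau> rule: wf_induct[OF wf_lex_prod[OF wf_less_than wf_less_than]])
  case (1 \<tau>)
  obtain k l m M where \<tau>: "\<tau> = Tree k l m M" by (cases \<tau>)
  have sub: "Q s" if at: "(a, t) \<in># M" and s: "s \<in> Poly_Mapping.keys (R t)" for a t s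
  proof -
    have tT: "t \<in> trees" using 1(2) at unfolding \<tau> by (rule trees_child)
    have sT: "s \<in> trees" using P tT s unfolding preparation_map_def span_of_def by blast
    have n: "noises t \<le> noises \<tau>" using at unfolding \<tau> by (auto dest!: multi_member_split)
    have sz: "size t < size \<tau>" using at unfolding \<tau> by (auto dest!: multi_member_split)
    have "s = t \<or> s \<in> Poly_Mapping.keys (R t - basis t)"
      using s by (auto simp: in_keys_iff lookup_minus lookup_single)
    then have "s = t \<or> noises s < noises t" using P tT unfolding preparation_map_def by blast
    then have "((noises s, size s), (noises \<tau>, size \<tau>)) \<in> less_than <*lex*> less_than" using n sz by auto
    then show ?thesis using 1(1) sT by blast
  qed
  show ?case unfolding \<tau> by (rule step) (use 1(2) sub \<tau> in auto)
qed

text \<open>The model without recentering; the models \<open>PiHat\<close> arise from it by the action of \<open>fchar\<close>.\<close>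

function (domintros) bare ::
  "(dtree \<Rightarrow> tvec) \<Rightarrow> (real \<times> real \<Rightarrow> real) \<Rightarrow> (real \<times> real \<Rightarrow> real) \<Rightarrow>
   (real \<times> real \<Rightarrow> real) \<Rightarrow> dtree \<Rightarrow> (real \<times> real \<Rightarrow> real)" where
  "bare R K \<xi> \<eta> (Tree k l m M) =
     (\<lambda>y. mpow y k * \<xi> y ^ l * \<eta> y ^ m *
       (\<Prod>(a, \<tau>)\<in>#M. convD K a (lin_fun (\<lambda>\<sigma>. bare R K \<xi> \<eta> \<sigma>) (R \<tau>)) y))"
  by pat_completeness auto

lemma bare_dom_trees:
  assumes "preparation_map \<alpha> R" and "\<tau> \<in> trees"
  shows "bare_dom (R, K, \<xi>, \<eta>, \<tau>)"
  using assms by (rule preparation_map_induct) (rule bare.domintros, auto)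

lemma mhom_fchar: "mhom (fchar \<alpha> i R K \<xi> \<eta> x)"
  unfolding mhom_def
  by (auto simp: zero_prod_def mpow_def power_add)

locale model =
  fixes \<alpha> :: real and K \<xi> \<eta> :: "real \<times> real \<Rightarrow> real" and R :: "dtree \<Rightarrow> tvec"
  assumes K: "truncated_heat_kernel K" and \<xi>: "smooth \<xi>" and \<eta>: "smooth \<eta>"
    and prep: "preparation_map \<alpha> R"
begin

abbreviation "Pih i x \<equiv> PiHat \<alpha> i R K \<xi> \<eta> x"
abbreviation "f i x \<equiv> fchar \<alpha> i R K \<xi> \<eta> x"
abbreviation "bar \<equiv> bare R K \<xi> \<eta>"

lemma R_trees: "\<tau> \<in> trees \<Longrightarrow> R \<tau> \<in> span_of trees"
  using prep by (auto simp: preparation_map_def)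

lemma lin_R_trees: "v \<in> span_of trees \<Longrightarrow> lin R v \<in> span_of trees"
  by (rule span_of_lin) (auto intro: R_trees)

text \<open>The assumed commutation of \<open>R\<close> with the coaction, evaluated by
  \<open>g\<close> on the right leg.\<close>

lemma act_R:
  assumes "i \<in> {0, 1}" and "v \<in> span_of trees"
  shows "act \<alpha> i g (lin R v) = lin R (act \<alpha> i g v)"
proof -
  have "act \<alpha> i g (R \<tau>) = lin R (eval_right g (coact_tree \<alpha> i \<tau>))" if "\<tau> \<in> trees" for \<tau>
  proof -
    have "coact \<alpha> i (R \<tau>) = lin (\<lambda>(\<sigma>, p). R \<sigma> \<otimes>\<^sub>t basis p) (coact_tree \<alpha> i \<tau>)"
      using prep assms(1) that unfolding preparation_map_def by metis
    then have "eval_right g (coact \<alpha> i (R \<tau>)) = eval_right g (lin (\<lambda>(\<sigma>, p). R \<sigma> \<otimes>\<^sub>t basis p) (coact_tree \<alpha> i \<tau>))"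
      by simp
    moreover have "eval_right g (R \<sigma> \<otimes>\<^sub>t basis p) = scale (g p) (R \<sigma>)" for \<sigma> p
      unfolding tens_conv eval_right_tens by simp
    ultimately show ?thesis
      by (simp add: act_def coact_def eval_right_def lin_lin lin_lin_split lin_scale case_prod_unfold)
  qed
  then show ?thesis
    unfolding act_def lin_lin by (intro lin_eq_on_span[OF assms(2)]) (simp add: act_def lin_lin)
qed

section \<open>The bare and the recentered models\<close>

lemma bar_Tree:
  assumes "Tree k l m M \<in> wide_trees"
  shows "bar (Tree k l m M) = (\<lambda>y. mpow y k * \<xi> y ^ l * \<eta> y ^ m *
       (\<Prod>(a, \<tau>)\<in>#M. convD K a (lin_fun bar (R \<tau>)) y))"
proof -
  have "bare_dom (R, K, \<xi>, \<eta>, s)" if "(a, t) \<in># M" "s \<in> Poly_Mapping.keys (R t)" for a t s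
    using R_trees[OF wide_trees_child[OF assms that(1)]] that(2)
    by (intro bare_dom_trees[OF prep]) (auto simp: span_of_def)
  then show ?thesis by (intro bare.psimps bare.domintros) auto
qed

lemma Pih_Tree:
  assumes "Tree k l m M \<in> wide_trees"
  shows "Pih i x (Tree k l m M) = (\<lambda>y. mpow (y - x) k * \<xi> y ^ l * \<eta> y ^ m *
       (\<Prod>(a, \<tau>)\<in>#M. convD K a (PiR \<alpha> i R K \<xi> \<eta> x \<tau>) y
          - (\<Sum>b | real (sdeg b) < deg \<alpha> i (graft a \<tau>).
               mpow (y - x) b / mfact b * convD K (a + b) (PiR \<alpha> i R K \<xi> \<eta> x \<tau>) x)))"
proof -
  have "PiHat_dom (\<alpha>, i, R, K, \<xi>, \<eta>, x, s)" if "(a, t) \<in># M" "s \<in> Poly_Mapping.keys (R t)" for a t s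
    using R_trees[OF wide_trees_child[OF assms that(1)]] that(2)
    by (intro PiHat_dom_trees[OF prep]) (auto simp: span_of_def)
  then show ?thesis unfolding PiR_def by (intro PiHat.psimps PiHat.domintros) auto
qed

lemma mpow_add: "mpow y (k + k') = mpow y k * mpow y k'"
  by (simp add: mpow_def power_add)

lemma bar_add:
  assumes "\<sigma> \<in> wide_trees" and "\<tau> \<in> wide_trees"
  shows "bar (\<sigma> + \<tau>) z = bar \<sigma> z * bar \<tau> z"
proof -
  obtain k l m M k' l' m' M' where "\<sigma> = Tree k l m M" "\<tau> = Tree k' l' m' M'"
    by (cases \<sigma>, cases \<tau>)
  then show ?thesis using assms wide_trees_add[OF assms]
    by (simp add: bar_Tree mpow_add power_add mult_ac)
qed

lemma Pih_add:
  assumes "\<sigma> \<in> wide_trees" and "\<tau> \<in> wide_trees"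
  shows "Pih i x (\<sigma> + \<tau>) z = Pih i x \<sigma> z * Pih i x \<tau> z"
proof -
  obtain k l m M k' l' m' M' where "\<sigma> = Tree k l m M" "\<tau> = Tree k' l' m' M'"
    by (cases \<sigma>, cases \<tau>)
  then show ?thesis using assms wide_trees_add[OF assms]
    by (simp add: Pih_Tree mpow_add power_add mult_ac)
qed

lemma lin_bar_mult:
  "u \<in> span_of wide_trees \<Longrightarrow> v \<in> span_of wide_trees \<Longrightarrow>
     lin_fun bar (u * v) z = lin_fun bar u z * lin_fun bar v z"
  unfolding lin_fun_def by (rule lin_real_mult_span) (auto intro: bar_add)

lemma lin_Pih_mult:
  "u \<in> span_of wide_trees \<Longrightarrow> v \<in> span_of wide_trees \<Longrightarrow>
     lin_fun (Pih i x) (u * v) z = lin_fun (Pih i x) u z * lin_fun (Pih i x) v z"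
  unfolding lin_fun_def by (rule lin_real_mult_span) (auto intro: Pih_add)

lemma span_wide_power: "u \<in> span_of wide_trees \<Longrightarrow> u ^ n \<in> span_of wide_trees"
  by (induction n) (simp_all add: wide_trees_gen span_wide_mult)

lemma bar_gen: "bar 0 = (\<lambda>y. 1)" "bar (monoX k) = (\<lambda>y. mpow y k)" "bar Xi0 = \<xi>" "bar Xi1 = \<eta>"
  by (simp_all add: bar_Tree wide_trees_gen mpow_def zero_dtree_def wide_trees_Tree del: Tree_eq_0_iff)

lemma bar_graft: "\<tau> \<in> trees \<Longrightarrow> bar (graft a \<tau>) = convD K a (lin_fun bar (R \<tau>))"
  by (simp add: bar_Tree wide_trees_gen mpow_def)

lemma Pih_gen: "Pih i x 0 = (\<lambda>y. 1)" "Pih i x (monoX k) = (\<lambda>y. mpow (y - x) k)"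
    "Pih i x Xi0 = \<xi>" "Pih i x Xi1 = \<eta>"
  by (simp_all add: Pih_Tree wide_trees_gen mpow_def zero_dtree_def wide_trees_Tree del: Tree_eq_0_iff)

lemma Pih_graft:
  "\<tau> \<in> trees \<Longrightarrow> Pih i x (graft a \<tau>) = (\<lambda>y. convD K a (PiR \<alpha> i R K \<xi> \<eta> x \<tau>) y
          - (\<Sum>b | real (sdeg b) < deg \<alpha> i (graft a \<tau>).
               mpow (y - x) b / mfact b * convD K (a + b) (PiR \<alpha> i R K \<xi> \<eta> x \<tau>) x))"
  by (simp add: Pih_Tree wide_trees_gen mpow_def)

lemma lin_bar_one: "lin_fun bar 1 z = 1"
  unfolding basis_zero[symmetric] lin_fun_basis by (simp add: bar_gen)

lemma lin_bar_power: "u \<in> span_of wide_trees \<Longrightarrow> lin_fun bar (u ^ n) z = lin_fun bar u z ^ n"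
  by (induction n) (simp_all add: lin_bar_one lin_bar_mult span_wide_power)

lemma smooth_lin_fun:
  assumes "\<And>s. s \<in> Poly_Mapping.keys v \<Longrightarrow> smooth (F s)"
  shows "smooth (lin_fun F v)"
  unfolding lin_fun_def lin_real_def by (intro smooth_sum smooth_cmult assms)

lemma smooth_bar: "\<tau> \<in> trees \<Longrightarrow> smooth (bar \<tau>)"
proof (erule preparation_map_induct[OF prep])
  fix k l m M assume T: "Tree k l m M \<in> trees"
    and IH: "\<And>a t s. (a, t) \<in># M \<Longrightarrow> s \<in> Poly_Mapping.keys (R t) \<Longrightarrow> smooth (bar s)"
  have "smooth (\<lambda>y. \<Prod>(a, \<tau>)\<in>#M. convD K a (lin_fun bar (R \<tau>)) y)"
    unfolding case_prod_unfold
    by (rule smooth_prod_mset, rule smooth_convD[OF K], rule smooth_lin_fun)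
       (metis IH prod.collapse)
  moreover have "smooth (\<lambda>y. mpow y k)" using smooth_mpow[of 0 k] by simp
  ultimately show "smooth (bar (Tree k l m M))"
    unfolding bar_Tree[OF subsetD[OF trees_subset_wide T]]
    by (intro smooth_mult smooth_power \<xi> \<eta>)
qed

lemma smooth_lin_bar: "v \<in> span_of trees \<Longrightarrow> smooth (lin_fun bar v)"
  by (rule smooth_lin_fun) (auto simp: span_of_def intro: smooth_bar)

lemma convD_lin_fun:
  assumes "\<And>s. s \<in> S \<Longrightarrow> smooth (F s)" and "v \<in> span_of S"
  shows "convD K a (lin_fun F v) z = lin_real (\<lambda>s. convD K a (F s) z) v"
proof -
  have "convD K a (\<lambda>z. \<Sum>s\<in>Poly_Mapping.keys v. Poly_Mapping.lookup v s * F s z)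
     = (\<lambda>z. \<Sum>s\<in>Poly_Mapping.keys v. Poly_Mapping.lookup v s * convD K a (F s) z)"
    by (rule convD_sum[OF K]) (use assms in \<open>auto simp: span_of_def\<close>)
  then show ?thesis by (simp add: lin_fun_def lin_real_def)
qed

lemma lin_bar_II:
  assumes "v \<in> span_of trees"
  shows "lin_fun bar (II a v) = convD K a (lin_fun bar (lin R v))"
proof
  fix z
  have "lin_fun bar (II a v) z = lin_real (\<lambda>s. convD K a (lin_fun bar (R s)) z) v"
  proof -
    have "lin_fun bar (II a v) z = lin_real (\<lambda>s. bar (graft a s) z) v"
      unfolding II_def lin_fun_lin lin_fun_basis by (simp add: lin_fun_def)
    also have "\<dots> = lin_real (\<lambda>s. convD K a (lin_fun bar (R s)) z) v"
      by (rule lin_real_eq_on_span[OF assms]) (simp add: bar_graft)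
    finally show ?thesis .
  qed
  also have "\<dots> = convD K a (lin_fun bar (lin R v)) z"
    unfolding lin_fun_lin
    by (rule convD_lin_fun[symmetric, OF _ assms]) (auto intro: smooth_lin_bar R_trees)
  finally show "lin_fun bar (II a v) z = convD K a (lin_fun bar (lin R v)) z" .
qed

lemma act_divpow:
  assumes "mhom g"
  shows "act \<alpha> i g (divpow X0 X1 k) = divpow (X0 + scale (g ((1, 0), {#})) 1) (X1 + scale (g ((0, 1), {#})) 1) k"
proof -
  have g: "g 0 = 1" using assms by (simp add: mhom_def)
  show ?thesis
    unfolding act_def divpow_lin[OF mhom_act_basis[OF assms]] lin_basis coact_tree_gen eval_right_add
      eval_right_embl g
    using eval_right_tens[of g 1 P0] eval_right_tens[of g 1 P1] by (simp add: embl_one)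
qed

lemma fchar_gen: "f i x ((1, 0), {#}) = - fst x" "f i x ((0, 1), {#}) = - snd x"
  by (simp_all add: mpow_def)

lemma lin_bar_act_divpow: "lin_fun bar (act \<alpha> i (f i x) (divpow X0 X1 k)) z = mpow (z - x) k / mfact k"
proof -
  have w: "X0 + scale c 1 \<in> span_of wide_trees" "X1 + scale c 1 \<in> span_of wide_trees" for c
    by (intro span_of_add span_of_scale; simp add: wide_trees_gen)+
  show ?thesis
    unfolding act_divpow[OF mhom_fchar] fchar_gen
    unfolding divpow_def
    by (simp add: lin_fun_scale lin_bar_mult lin_bar_power span_wide_power w lin_fun_add bar_gen lin_bar_one)
      (simp add: mpow_def)
qed

lemma fchar_IIp:
  "lin_real (f i x) (IIp \<alpha> i a (basis \<tau>)) =
     (if 0 < deg \<alpha> i (graft a \<tau>) then - convD K a (PiR \<alpha> i R K \<xi> \<eta> x \<tau>) x else 0)"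
  by (simp add: IIp_basis mpow_def)

text \<open>The comparison with the bare model passes from the trees of \<open>R \<tau>\<close> to
  \<open>\<tau>\<close> because the action commutes with \<open>R\<close>.\<close>

lemma PiR_eq_bar:
  assumes i: "i \<in> {0, 1}" and \<tau>: "\<tau> \<in> trees"
    and "\<And>s. s \<in> Poly_Mapping.keys (R \<tau>) \<Longrightarrow> Pih i x s = lin_fun bar (act \<alpha> i (f i x) (basis s))"
  shows "PiR \<alpha> i R K \<xi> \<eta> x \<tau> = lin_fun bar (lin R (act \<alpha> i (f i x) (basis \<tau>)))"
proof -
  have "PiR \<alpha> i R K \<xi> \<eta> x \<tau> = lin_fun (\<lambda>s. lin_fun bar (act \<alpha> i (f i x) (basis s))) (R \<tau>)"
    unfolding PiR_def by (rule lin_fun_cong) (auto simp: assms(3))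
  also have "\<dots> = lin_fun bar (act \<alpha> i (f i x) (R \<tau>))"
    by (simp add: lin_fun_lin act_def)
  also have "\<dots> = lin_fun bar (lin R (act \<alpha> i (f i x) (basis \<tau>)))"
    using act_R[OF i, of "basis \<tau>"] \<tau> by simp
  finally show ?thesis .
qed

text \<open>The polynomial part of the action on a planted tree is precisely the Taylor polynomial
  subtracted in \<open>PiHat\<close>: \<open>fchar\<close> supplies the negative Taylor coefficients
  on \<open>IIp\<close>, and it shifts the coordinates by -x. The outer induction follows
  \<open>R\<close>, the inner one the generators.\<close>

lemma Pih_eq_bar:
  assumes i: "i \<in> {0, 1}" and "\<tau> \<in> trees"
  shows "Pih i x \<tau> = lin_fun bar (act \<alpha> i (f i x) (basis \<tau>))"
  using assms(2)
proof (rule preparation_map_induct[OF prep])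
  fix k l m M assume T: "Tree k l m M \<in> trees"
    and IH: "\<And>a t s. (a, t) \<in># M \<Longrightarrow> s \<in> Poly_Mapping.keys (R t) \<Longrightarrow>
       Pih i x s = lin_fun bar (act \<alpha> i (f i x) (basis s))"
  let ?P = "\<lambda>\<sigma>. \<sigma> \<in> wide_trees \<and> Pih i x \<sigma> = lin_fun bar (act \<alpha> i (f i x) (basis \<sigma>))"
  have X: "lin_fun bar (act \<alpha> i (f i x) (divpow X0 X1 k)) = (\<lambda>z. mpow (z - x) k / mfact k)" for k
    using lin_bar_act_divpow by blast
  have f0: "f i x 0 = 1" using mhom_fchar[of \<alpha> i] by (simp add: mhom_def)
  have "?P (Tree k l m M)"
  proof (rule dtree_gen_induct[where P="?P"])
    show "?P 0" unfolding basis_zero act_one[OF mhom_fchar]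
      unfolding basis_zero[symmetric] lin_fun_basis by (simp add: wide_trees_gen bar_gen Pih_gen)
    have "divpow X0 X1 (1, 0) = X0" "divpow X0 X1 (0, 1) = X1"
      by (simp_all add: divpow_def mfact_def)
    then show "?P (monoX (1, 0))" "?P (monoX (0, 1))"
      using X[of "(1, 0)"] X[of "(0, 1)"] by (simp_all add: wide_trees_gen Pih_gen mfact_def)
    show "?P Xi0" "?P Xi1"
      by (simp_all add: wide_trees_gen coact_tree_gen eval_right_embl f0 Pih_gen bar_gen)
    fix a \<sigma> assume a: "(a, \<sigma>) \<in># M"
    have \<sigma>: "\<sigma> \<in> trees" using T a by (rule trees_child)
    have PR: "PiR \<alpha> i R K \<xi> \<eta> x \<sigma> = lin_fun bar (lin R (act \<alpha> i (f i x) (basis \<sigma>)))"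
      by (rule PiR_eq_bar[OF i \<sigma> IH[OF a]])
    have "Pih i x (graft a \<sigma>) z = lin_fun bar (act \<alpha> i (f i x) (basis (graft a \<sigma>))) z" for z
    proof -
      have II: "lin_fun bar (II a (act \<alpha> i (f i x) (basis \<sigma>))) z = convD K a (PiR \<alpha> i R K \<xi> \<eta> x \<sigma>) z"
        unfolding PR by (subst lin_bar_II) (simp_all add: act_trees \<sigma> del: act_basis)
      have "(\<Sum>k | real (sdeg k) < deg \<alpha> i (graft a \<sigma>).
          lin_real (f i x) (IIp \<alpha> i (a + k) (basis \<sigma>)) * (mpow (z - x) k / mfact k))
         = - (\<Sum>b | real (sdeg b) < deg \<alpha> i (graft a \<sigma>).
               mpow (z - x) b / mfact b * convD K (a + b) (PiR \<alpha> i R K \<xi> \<eta> x \<sigma>) x)"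
        unfolding sum_negf[symmetric]
        by (rule sum.cong) (auto simp: fchar_IIp deg_graft_add)
      then show ?thesis
        unfolding act_graft[OF mhom_fchar] lin_fun_add lin_fun_sum lin_fun_scale X II
        by (simp add: Pih_graft \<sigma>)
    qed
    then show "?P (graft a \<sigma>)" using \<sigma> by (simp add: wide_trees_gen fun_eq_iff del: act_basis)
  next
    fix \<sigma> \<tau> assume "?P \<sigma>" "?P \<tau>"
    then show "?P (\<sigma> + \<tau>)"
      unfolding basis_add act_mult[OF mhom_fchar]
      by (auto simp: fun_eq_iff Pih_add lin_bar_mult act_wide wide_trees_add simp del: act_basis)
  qed
  then show "Pih i x (Tree k l m M) = lin_fun bar (act \<alpha> i (f i x) (basis (Tree k l m M)))" by blast
qed

lemma lin_Pih_eq_bar: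
  assumes "i \<in> {0, 1}" and "v \<in> span_of trees"
  shows "lin_fun (Pih i x) v = lin_fun bar (act \<alpha> i (f i x) v)"
proof -
  have "lin_fun (Pih i x) v = lin_fun (\<lambda>s. lin_fun bar (act \<alpha> i (f i x) (basis s))) v"
    by (rule lin_fun_eq_on_span[OF assms(2)]) (simp only: Pih_eq_bar[OF assms(1)])
  then show ?thesis by (simp add: lin_fun_lin act_def)
qed

lemma lin_PiR: "lin_fun (PiR \<alpha> i R K \<xi> \<eta> x) v = lin_fun (Pih i x) (lin R v)"
  unfolding lin_fun_lin by (simp add: PiR_def[abs_def])

lemma smooth_Pih: "i \<in> {0, 1} \<Longrightarrow> \<tau> \<in> trees \<Longrightarrow> smooth (Pih i x \<tau>)"
  unfolding Pih_eq_bar by (rule smooth_lin_bar) (simp add: act_trees del: act_basis)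

lemma smooth_PiR: "i \<in> {0, 1} \<Longrightarrow> \<tau> \<in> trees \<Longrightarrow> smooth (PiR \<alpha> i R K \<xi> \<eta> x \<tau>)"
  unfolding PiR_def using R_trees[of \<tau>] by (intro smooth_lin_fun smooth_Pih) (auto simp: span_of_def)

end

section \<open>Comparison of the two recenterings\<close>

definition act_hat :: "real \<Rightarrow> (pmon \<Rightarrow> real) \<Rightarrow> tvec \<Rightarrow> tvec" where
  "act_hat \<alpha> g = lin (\<lambda>\<tau>. eval_right g (coact_hat_tree \<alpha> \<tau>))"

lemma act_hat_basis [simp]: "act_hat \<alpha> g (basis \<tau>) = eval_right g (coact_hat_tree \<alpha> \<tau>)"
  by (simp add: act_hat_def)

lemma act_hat_linear:
  "act_hat \<alpha> g 0 = 0" "act_hat \<alpha> g (u + v) = act_hat \<alpha> g u + act_hat \<alpha> g v"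
  "act_hat \<alpha> g (scale c v) = scale c (act_hat \<alpha> g v)"
  by (simp_all add: act_hat_def lin_add lin_scale)

lemma mhom_act_hat_basis: "mhom g \<Longrightarrow> mhom (\<lambda>\<tau>. eval_right g (coact_hat_tree \<alpha> \<tau>))"
  unfolding eval_right_def by (rule mhom_compose_lin[OF mhom_eval_right mhom_coact_hat_tree])

lemma act_hat_mult: "mhom g \<Longrightarrow> act_hat \<alpha> g (u * v) = act_hat \<alpha> g u * act_hat \<alpha> g v"
  unfolding act_hat_def by (rule mhom_lin_mult[OF mhom_act_hat_basis])

lemma act_hat_one: "mhom g \<Longrightarrow> act_hat \<alpha> g 1 = 1"
  unfolding act_hat_def by (rule mhom_lin_one[OF mhom_act_hat_basis])

lemma lin_real_eval_right:
  "lin_real h (eval_right g w) = lin_real (\<lambda>(\<sigma>, p). g p * h \<sigma>) w"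
  by (simp add: eval_right_def lin_real_lin case_prod_unfold lin_real_scale)

text \<open>The bound \<open>D\<close> on the degrees of the left leg makes the sum over
  \<open>b\<close> explicitly finite, since \<open>IIp\<close> vanishes beyond it. It is left free
  so that sums can share one range.\<close>

lemma act_hat_graft:
  assumes g: "mhom g"
    and D: "\<And>\<sigma> p. (\<sigma>, p) \<in> Poly_Mapping.keys (coact_hat_tree \<alpha> \<tau>) \<Longrightarrow> deg \<alpha> 0 (graft a \<sigma>) \<le> D"
  shows "act_hat \<alpha> g (basis (graft a \<tau>)) = II a (act_hat \<alpha> g (basis \<tau>))
    - (\<Sum>b | real (sdeg b) < D.
         if deg \<alpha> 1 (graft a \<tau>) \<le> real (sdeg b)
         then scale (lin_real (\<lambda>\<sigma>. lin_real g (IIp \<alpha> 0 (a + b) (basis \<sigma>))) (act_hat \<alpha> g (basis \<tau>)))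
                (divpow X0 X1 b)
         else 0)"
proof -
  define t where "t b = lin (\<lambda>(\<sigma>, p). IIp \<alpha> 0 (a + b) (basis \<sigma>) * basis p) (coact_hat_tree \<alpha> \<tau>)" for b
  have t0: "t b = 0" if "\<not> real (sdeg b) < D" for b
  proof -
    have "t b = lin (\<lambda>_. 0) (coact_hat_tree \<alpha> \<tau>)"
      unfolding t_def
    proof (rule lin_cong[OF refl], clarify)
      fix \<sigma> q r assume "(\<sigma>, q, r) \<in> Poly_Mapping.keys (coact_hat_tree \<alpha> \<tau>)"
      from D[OF this] have "deg \<alpha> 0 (graft (a + b) \<sigma>) \<le> 0" using that unfolding deg_graft_add by simp
      then show "IIp \<alpha> 0 (a + b) (basis \<sigma>) * basis (q, r) = 0" by (simp add: IIp_vanish)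
    qed
    then show ?thesis by (simp add: lin_def)
  qed
  have lt: "lin_real g (t b)
      = lin_real (\<lambda>\<sigma>. lin_real g (IIp \<alpha> 0 (a + b) (basis \<sigma>))) (act_hat \<alpha> g (basis \<tau>))" for b
    unfolding act_hat_basis lin_real_eval_right t_def lin_real_lin case_prod_unfold
    by (simp add: mhom_lin_real_mult[OF g] mult.commute)
  have "{b. (if deg \<alpha> 1 (graft a \<tau>) \<le> real (sdeg b) then divpow X0 X1 b \<otimes>\<^sub>t t b else 0) \<noteq> 0}
      \<subseteq> {b. real (sdeg b) < D}"
    by (rule subsetI, rule ccontr) (simp add: t0 split: if_splits)
  then have "coact_hat_tree \<alpha> (graft a \<tau>) = graft_left a (coact_hat_tree \<alpha> \<tau>)
     - (\<Sum>b | real (sdeg b) < D. if deg \<alpha> 1 (graft a \<tau>) \<le> real (sdeg b) then divpow X0 X1 b \<otimes>\<^sub>t t b else 0)"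
    unfolding coact_hat_tree_graft t_def[symmetric]
    by (subst Sum_any.expand_superset[OF finite_sdeg_less[of D]]) simp_all
  then have A: "act_hat \<alpha> g (basis (graft a \<tau>)) = II a (act_hat \<alpha> g (basis \<tau>))
     - (\<Sum>b | real (sdeg b) < D. eval_right g
         (if deg \<alpha> 1 (graft a \<tau>) \<le> real (sdeg b) then divpow X0 X1 b \<otimes>\<^sub>t t b else 0))"
    by (simp add: eval_right_graft_left[symmetric] eval_right_sum[symmetric])
       (simp add: eval_right_def lin_diff)
  have e: "eval_right g (if deg \<alpha> 1 (graft a \<tau>) \<le> real (sdeg b) then divpow X0 X1 b \<otimes>\<^sub>t t b else 0)
     = (if deg \<alpha> 1 (graft a \<tau>) \<le> real (sdeg b) then scale (lin_real g (t b)) (divpow X0 X1 b) else 0)" for b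
    by (simp add: tens_conv eval_right_tens) (simp add: eval_right_def)
  show ?thesis unfolding A e lt ..
qed

lemma act_hat_rule_trees:
  "down_closed \<rho> \<Longrightarrow> v \<in> span_of (rule_trees \<rho>) \<Longrightarrow> act_hat \<alpha> g v \<in> span_of (rule_trees \<rho>)"
  unfolding act_hat_def by (rule span_of_lin) (auto intro: eval_right_span coact_hat_tree_rule_trees)

lemma act_hat_trees: "v \<in> span_of trees \<Longrightarrow> act_hat \<alpha> g v \<in> span_of trees"
  unfolding trees_eq_rule_trees by (rule act_hat_rule_trees) (auto simp: down_closed_def)

lemma deg_1_le_deg_0: "deg \<alpha> 1 \<tau> \<le> deg \<alpha> 0 \<tau>"
proof (induction \<tau> rule: dtree_full_induct)
  case (graft a \<tau>)
  then show ?case unfolding deg_graft by simp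
next
  case (add \<sigma> \<tau>)
  then show ?case unfolding deg_add by simp
qed (simp_all add: deg.simps zero_dtree_def del: Tree_eq_0_iff)

context model
begin

lemma convD_PiR_lin:
  assumes i: "i \<in> {0, 1}" and v: "v \<in> span_of trees"
  shows "lin_real (\<lambda>s. convD K a (PiR \<alpha> i R K \<xi> \<eta> x s) z) v
    = convD K a (lin_fun (Pih i x) (lin R v)) z"
  unfolding lin_PiR[symmetric] by (rule convD_lin_fun[symmetric, OF smooth_PiR[OF i] v])

text \<open>
  The degree \<open>deg 0\<close> exceeds \<open>deg 1\<close> on trees with \<open>\<Xi>\<^sub>1\<close>, so the recentering by \<open>f 0\<close> subtracts more
  monomials than the one by \<open>f 1\<close>; \<open>act_hat\<close> puts the surplus back.
\<close>

lemma act_act_hat_basis: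
  assumes "\<tau> \<in> trees"
  shows "act \<alpha> 0 (f 0 x) (act_hat \<alpha> (f 0 x) (basis \<tau>)) = act \<alpha> 1 (f 1 x) (basis \<tau>)"
  using assms
proof (induction \<tau> rule: trees.induct)
  case (1 l m M k)
  have f0: "f i x 0 = 1" for i using mhom_fchar[of \<alpha> i] by (simp add: mhom_def)
  let ?P = "\<lambda>\<tau>. act \<alpha> 0 (f 0 x) (act_hat \<alpha> (f 0 x) (basis \<tau>)) = act \<alpha> 1 (f 1 x) (basis \<tau>)"
  have X: "act \<alpha> 0 (f 0 x) (divpow X0 X1 k) = act \<alpha> 1 (f 1 x) (divpow X0 X1 k)" for k
    unfolding act_divpow[OF mhom_fchar] fchar_gen ..
  have h: "act_hat \<alpha> (f 0 x) (basis (Tree k l m {#})) = basis (Tree k l m {#})" for k l m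
    by (simp add: coact_hat_tree_gen eval_right_embl f0)
  show ?case
  proof (rule dtree_gen_induct[where P="?P"])
    show "?P 0" by (simp only: basis_zero act_hat_one[OF mhom_fchar] act_one[OF mhom_fchar])
    have "divpow X0 X1 (1, 0) = X0" "divpow X0 X1 (0, 1) = X1"
      by (simp_all add: divpow_def mfact_def)
    then show "?P (monoX (1, 0))" "?P (monoX (0, 1))"
      using X[of "(1, 0)"] X[of "(0, 1)"] unfolding h by simp_all
    show "?P Xi0" "?P Xi1"
      unfolding h by (simp_all add: coact_tree_gen eval_right_embl f0)
    fix a \<sigma> assume a: "(a, \<sigma>) \<in># M"
    have \<sigma>: "\<sigma> \<in> trees" and IH: "?P \<sigma>" using 1 a by blast+
    define v where "v = act_hat \<alpha> (f 0 x) (basis \<sigma>)"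
    have v: "v \<in> span_of trees" unfolding v_def by (rule act_hat_trees) (simp add: \<sigma>)
    have v_IH: "act \<alpha> 0 (f 0 x) v = act \<alpha> 1 (f 1 x) (basis \<sigma>)" unfolding v_def by (rule IH)
    define d where "d = deg \<alpha> 1 (graft a \<sigma>)"
    define ds where "ds = (\<lambda>(s, p). deg \<alpha> 0 (graft a s)) ` Poly_Mapping.keys (coact_hat_tree \<alpha> \<sigma>)"
    define D where "D = Max (insert d ds)"
    have fin: "finite (insert d ds)" by (simp add: ds_def)
    have dD: "d \<le> D" unfolding D_def by (rule Max_ge[OF fin]) simp
    have D: "deg \<alpha> 0 (graft a s) \<le> D" if "(s, p) \<in> Poly_Mapping.keys (coact_hat_tree \<alpha> \<sigma>)" for s p
      unfolding D_def using that by (intro Max_ge[OF fin]) (force simp: ds_def)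
    \<comment> \<open>The upper bound justifies the cutoff \<open>D\<close>. The lower bound ensures
      that below \<open>d\<close> no tree of \<open>v\<close> is annihilated by \<open>IIp\<close>;
      it holds because \<open>coact_hat_tree\<close> does not lower \<open>deg \<alpha> 1\<close>,
      which is at most \<open>deg \<alpha> 0\<close>.\<close>
    have vD: "v \<in> span_of {s. deg \<alpha> 0 (graft a s) \<le> D \<and> d \<le> deg \<alpha> 0 (graft a s)}"
    proof -
      have key: "deg \<alpha> 0 (graft a s) \<le> D \<and> d \<le> deg \<alpha> 0 (graft a s)"
        if s: "(s, p) \<in> Poly_Mapping.keys (coact_hat_tree \<alpha> \<sigma>)" for s p
      proof
        show "deg \<alpha> 0 (graft a s) \<le> D" by (rule D[OF s])
        have "deg \<alpha> 1 \<sigma> \<le> deg \<alpha> 1 s" using coact_hat_tree_deg_ge[of \<alpha> \<sigma>] s by (auto simp: span_of_def)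
        then show "d \<le> deg \<alpha> 0 (graft a s)"
          using deg_1_le_deg_0[of \<alpha> s] unfolding d_def deg_graft by simp
      qed
      have "coact_hat_tree \<alpha> \<sigma> \<in> span_of ({s. deg \<alpha> 0 (graft a s) \<le> D \<and> d \<le> deg \<alpha> 0 (graft a s)} \<times> UNIV)"
        using key by (auto simp: span_of_def)
      then show ?thesis unfolding v_def act_hat_basis by (rule eval_right_span)
    qed
    define h where "h k s = lin_real (f 0 x) (IIp \<alpha> 0 (a + k) (basis s))" for k s
    define Z where "Z k = act \<alpha> 0 (f 0 x) (divpow X0 X1 k)" for k
    have "act \<alpha> 0 (f 0 x) (II a v) = lin (\<lambda>s. act \<alpha> 0 (f 0 x) (basis (graft a s))) v"
      by (simp add: II_def act_def lin_lin)
    also have "\<dots> = lin (\<lambda>s. II a (act \<alpha> 0 (f 0 x) (basis s)) + (\<Sum>k | real (sdeg k) < D. scale (h k s) (Z k))) v"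
    proof (rule lin_eq_on_span[OF vD], clarify)
      fix s assume s: "deg \<alpha> 0 (graft a s) \<le> D"
      have "(\<Sum>k | real (sdeg k) < deg \<alpha> 0 (graft a s). scale (h k s) (Z k))
         = (\<Sum>k | real (sdeg k) < D. scale (h k s) (Z k))"
      proof (rule sum.mono_neutral_left[OF finite_sdeg_less])
        show "\<forall>k\<in>{k. real (sdeg k) < D} - {k. real (sdeg k) < deg \<alpha> 0 (graft a s)}. scale (h k s) (Z k) = 0"
          by (auto simp: h_def fchar_IIp deg_graft_add)
      qed (use s in auto)
      then show "act \<alpha> 0 (f 0 x) (basis (graft a s))
          = II a (act \<alpha> 0 (f 0 x) (basis s)) + (\<Sum>k | real (sdeg k) < D. scale (h k s) (Z k))"
        unfolding act_graft[OF mhom_fchar] h_def[symmetric] Z_def[symmetric] by simp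
    qed
    also have "\<dots> = II a (act \<alpha> 0 (f 0 x) v) + (\<Sum>k | real (sdeg k) < D. scale (lin_real (h k) v) (Z k))"
      by (simp add: lin_pointwise_add lin_pointwise_sum lin_scale_fixed) (simp add: II_def act_def lin_lin)
    finally have AII: "act \<alpha> 0 (f 0 x) (II a v) = \<dots>" .
    \<comment> \<open>Below \<open>d\<close> the Taylor coefficients of both recenterings agree:
      linearity of the convolution collects the trees of \<open>v\<close>, and the induction
      hypothesis together with commutation with \<open>R\<close> identifies the function being
      convolved.\<close>
    have hk: "lin_real (h k) v = - convD K (a + k) (PiR \<alpha> 1 R K \<xi> \<eta> x \<sigma>) x" if k: "real (sdeg k) < d" for k
    proof -
      have "lin_real (h k) v = lin_real (\<lambda>s. - convD K (a + k) (PiR \<alpha> 0 R K \<xi> \<eta> x s) x) v"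
        by (rule lin_real_eq_on_span[OF vD]) (use k in \<open>auto simp: h_def fchar_IIp deg_graft_add\<close>)
      also have "\<dots> = - lin_real (\<lambda>s. convD K (a + k) (PiR \<alpha> 0 R K \<xi> \<eta> x s) x) v"
        by (simp add: lin_real_def sum_negf)
      also have "\<dots> = - convD K (a + k) (lin_fun (Pih 0 x) (lin R v)) x"
        by (simp add: convD_PiR_lin v)
      also have "lin_fun (Pih 0 x) (lin R v) = lin_fun bar (act \<alpha> 0 (f 0 x) (lin R v))"
        by (rule lin_Pih_eq_bar) (simp_all add: lin_R_trees v)
      also have "act \<alpha> 0 (f 0 x) (lin R v) = lin R (act \<alpha> 1 (f 1 x) (basis \<sigma>))"
        by (simp add: act_R v v_IH del: act_basis)
      also have "\<dots> = act \<alpha> 1 (f 1 x) (R \<sigma>)"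
        using act_R[of 1 "basis \<sigma>"] \<sigma> by simp
      also have "lin_fun bar \<dots> = PiR \<alpha> 1 R K \<xi> \<eta> x \<sigma>"
        using lin_Pih_eq_bar[of 1 "R \<sigma>" x] R_trees[OF \<sigma>] by (simp add: PiR_def)
      finally show ?thesis .
    qed
    have hat: "act_hat \<alpha> (f 0 x) (basis (graft a \<sigma>)) = II a (act_hat \<alpha> (f 0 x) (basis \<sigma>))
      - (\<Sum>b | real (sdeg b) < D. if deg \<alpha> 1 (graft a \<sigma>) \<le> real (sdeg b)
         then scale (lin_real (\<lambda>s. lin_real (f 0 x) (IIp \<alpha> 0 (a + b) (basis s))) (act_hat \<alpha> (f 0 x) (basis \<sigma>)))
                (divpow X0 X1 b)
         else 0)"
      by (rule act_hat_graft[OF mhom_fchar D])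
    have "act \<alpha> 0 (f 0 x) (act_hat \<alpha> (f 0 x) (basis (graft a \<sigma>)))
      = II a (act \<alpha> 0 (f 0 x) v) + (\<Sum>k | real (sdeg k) < D. scale (lin_real (h k) v) (Z k))
       - (\<Sum>k | real (sdeg k) < D. if d \<le> real (sdeg k) then scale (lin_real (h k) v) (Z k) else 0)"
      unfolding hat v_def[symmetric] h_def[symmetric] d_def[symmetric] act_linear AII
      by (simp add: Z_def if_distrib act_linear cong: if_cong)
    \<comment> \<open>The orders from \<open>d\<close> up to \<open>D\<close>, which index 0
      subtracts in excess, cancel against the sum coming from \<open>act_hat\<close>.\<close>
    also have "\<dots> = II a (act \<alpha> 0 (f 0 x) v)
       + (\<Sum>k | real (sdeg k) < D. if d \<le> real (sdeg k) then 0 else scale (lin_real (h k) v) (Z k))"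
      unfolding add_diff_eq[symmetric] sum_subtractf[symmetric]
      by (intro arg_cong2[of _ _ _ _ "(+)"] sum.cong) auto
    also have "(\<Sum>k | real (sdeg k) < D. if d \<le> real (sdeg k) then 0 else scale (lin_real (h k) v) (Z k))
      = (\<Sum>k | real (sdeg k) < d. if d \<le> real (sdeg k) then 0 else scale (lin_real (h k) v) (Z k))"
      by (rule sum.mono_neutral_right[OF finite_sdeg_less]) (use dD in auto)
    also have "\<dots> = (\<Sum>k | real (sdeg k) < d.
        scale (lin_real (f 1 x) (IIp \<alpha> 1 (a + k) (basis \<sigma>))) (act \<alpha> 1 (f 1 x) (divpow X0 X1 k)))"
      by (rule sum.cong) (auto simp: hk Z_def X fchar_IIp deg_graft_add d_def)
    also have "II a (act \<alpha> 0 (f 0 x) v) = II a (act \<alpha> 1 (f 1 x) (basis \<sigma>))"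
      by (simp only: v_IH)
    finally show "?P (graft a \<sigma>)" unfolding act_graft[OF mhom_fchar[of \<alpha> 1]] d_def .
  next
    fix \<sigma> \<tau> assume "?P \<sigma>" "?P \<tau>"
    then show "?P (\<sigma> + \<tau>)"
      by (simp only: basis_add act_hat_mult[OF mhom_fchar] act_mult[OF mhom_fchar])
  qed
qed

lemma act_act_hat:
  assumes "v \<in> span_of trees"
  shows "act \<alpha> 0 (f 0 x) (act_hat \<alpha> (f 0 x) v) = act \<alpha> 1 (f 1 x) v"
  using assms
  by (induction v rule: span_of_induct) (simp_all add: act_hat_linear act_linear act_act_hat_basis del: act_basis act_hat_basis)

end

locale model_antipode = model +
  fixes A :: "pmon \<Rightarrow> pvec"
  assumes antipode: "is_antipode \<alpha> 0 A"
begin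

text \<open>The functional f \<circ> A, a two-sided convolution inverse of \<open>f 0 y\<close> on
  \<open>Tplus\<close>.\<close>

definition f_inv :: "real \<times> real \<Rightarrow> pmon \<Rightarrow> real" where
  "f_inv y p = lin_real (f 0 y) (A p)"

abbreviation "Gam y x \<equiv> Gamma \<alpha> 0 A R K \<xi> \<eta> y x"

text \<open>Each antipode identity, evaluated by the character \<open>f 0 y\<close>, says that one
  of the two convolution products is the counit on \<open>Tplus\<close>, where the right legs of
  \<open>wide_trees\<close> lie.\<close>

lemma act_f_inv:
  assumes "v \<in> span_of wide_trees"
  shows "act \<alpha> 0 (f 0 y) (act \<alpha> 0 (f_inv y) v) = v" and "act \<alpha> 0 (f_inv y) (act \<alpha> 0 (f 0 y) v) = v"
proof -
  have e: "lin_real (f 0 y) (if p = 0 then 1 else 0) = counit p" for p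
    by (simp add: counit_def mhom_lin_real_one mhom_fchar)
  have "convolve \<alpha> 0 (f 0 y) (f_inv y) p = counit p" if "p \<in> Tplus \<alpha> 0" for p
  proof -
    have "lin (\<lambda>(q, r). basis q * A r) (coprod_mon \<alpha> 0 p) = (if p = 0 then 1 else 0)"
      using antipode that by (auto simp: is_antipode_def)
    from arg_cong[OF this, of "lin_real (f 0 y)"] show ?thesis
      unfolding e by (simp add: lin_real_lin case_prod_unfold convolve_def f_inv_def mhom_lin_real_mult mhom_fchar)
  qed
  then show "act \<alpha> 0 (f 0 y) (act \<alpha> 0 (f_inv y) v) = v"
    unfolding act_act using act_cong_Tplus[OF assms] act_counit by metis
  have "convolve \<alpha> 0 (f_inv y) (f 0 y) p = counit p" if "p \<in> Tplus \<alpha> 0" for p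
  proof -
    have "lin (\<lambda>(q, r). A q * basis r) (coprod_mon \<alpha> 0 p) = (if p = 0 then 1 else 0)"
      using antipode that by (auto simp: is_antipode_def)
    from arg_cong[OF this, of "lin_real (f 0 y)"] show ?thesis
      unfolding e by (simp add: lin_real_lin case_prod_unfold convolve_def f_inv_def mhom_lin_real_mult mhom_fchar)
  qed
  then show "act \<alpha> 0 (f_inv y) (act \<alpha> 0 (f 0 y) v) = v"
    unfolding act_act using act_cong_Tplus[OF assms] act_counit by metis
qed

lemma Gam_eq_act: "Gam y x v = act \<alpha> 0 (convolve \<alpha> 0 (f_inv y) (f 0 x)) v"
proof -
  have "gammachar \<alpha> 0 A R K \<xi> \<eta> y x = convolve \<alpha> 0 (f_inv y) (f 0 x)"
    by (simp add: fun_eq_iff gammachar_def convolve_def f_inv_def)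
  then show ?thesis
    by (simp add: Gamma_def coact_def act_def eval_right_def lin_lin)
qed

lemma Gam_eq: "Gam y x v = act \<alpha> 0 (f_inv y) (act \<alpha> 0 (f 0 x) v)"
  unfolding Gam_eq_act act_act ..

lemma act_Gam: "v \<in> span_of wide_trees \<Longrightarrow> act \<alpha> 0 (f 0 y) (Gam y x v) = act \<alpha> 0 (f 0 x) v"
  unfolding Gam_eq by (rule act_f_inv) (rule act_wide)

lemma Gam_wide: "v \<in> span_of wide_trees \<Longrightarrow> Gam y x v \<in> span_of wide_trees"
  unfolding Gam_eq_act by (rule act_wide)

text \<open>Multiplicativity is obtained by cancellation: after the multiplicative and invertible
  action of \<open>f 0 y\<close>, \<open>Gam y x\<close> becomes the multiplicative action of
  \<open>f 0 x\<close>.\<close>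

lemma Gam_mult:
  assumes u: "u \<in> span_of wide_trees" and v: "v \<in> span_of wide_trees"
  shows "Gam y x (u * v) = Gam y x u * Gam y x v"
proof -
  have "Gam y x (u * v) = act \<alpha> 0 (f_inv y) (act \<alpha> 0 (f 0 y) (Gam y x u) * act \<alpha> 0 (f 0 y) (Gam y x v))"
    by (simp add: Gam_eq act_mult[OF mhom_fchar] act_f_inv act_wide u v)
  also have "\<dots> = Gam y x u * Gam y x v"
    unfolding act_mult[OF mhom_fchar, symmetric] by (rule act_f_inv) (intro span_wide_mult Gam_wide u v)
  finally show ?thesis .
qed

text \<open>This is \<open>G\<close> of the overview.\<close>

definition Gt :: "real \<times> real \<Rightarrow> real \<times> real \<Rightarrow> tvec \<Rightarrow> tvec" where
  "Gt y x v = Gam y x (act_hat \<alpha> (f 0 x) v)"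

lemma Gt_linear:
  "Gt y x 0 = 0" "Gt y x (u + v) = Gt y x u + Gt y x v" "Gt y x (scale c v) = scale c (Gt y x v)"
  by (simp_all add: Gt_def Gam_eq act_hat_linear act_linear)

lemma dGamma_eq: "dGamma \<alpha> A R K \<xi> \<eta> y x v = Q0 (Gt y x (DXi v))"
  unfolding dGamma_def Gt_def coact_hat_def act_hat_def eval_right_def Gam_eq_act
  by (simp add: lin_lin case_prod_unfold act_def lin_scale)

lemma Gt_rule_trees:
  "down_closed \<rho> \<Longrightarrow> v \<in> span_of (rule_trees \<rho>) \<Longrightarrow> Gt y x v \<in> span_of (rule_trees \<rho>)"
  unfolding Gt_def Gam_eq by (intro act_rule_trees act_hat_rule_trees)

lemma Gt_trees: "v \<in> span_of trees \<Longrightarrow> Gt y x v \<in> span_of trees"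
  unfolding Gt_def Gam_eq by (intro act_trees act_hat_trees)

lemma Gt_mult:
  "u \<in> span_of trees \<Longrightarrow> v \<in> span_of trees \<Longrightarrow> Gt y x (u * v) = Gt y x u * Gt y x v"
  by (simp add: Gt_def act_hat_mult[OF mhom_fchar] Gam_mult act_hat_trees span_trees_wide)

text \<open>Acting by \<open>f 0 y\<close> turns \<open>Gam y x\<close> into the action of
  \<open>f 0 x\<close>, and the latter after \<open>act_hat\<close> is the action with index
  1.\<close>

lemma lin_Pih_Gt:
  assumes v: "v \<in> span_of trees"
  shows "lin_fun (Pih 0 y) (Gt y x v) = lin_fun (Pih 1 x) v"
proof -
  have "lin_fun (Pih 0 y) (Gt y x v) = lin_fun bar (act \<alpha> 0 (f 0 y) (Gt y x v))"
    by (rule lin_Pih_eq_bar) (simp_all add: Gt_trees v)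
  also have "act \<alpha> 0 (f 0 y) (Gt y x v) = act \<alpha> 1 (f 1 x) v"
    unfolding Gt_def by (simp add: act_Gam act_hat_trees span_trees_wide v act_act_hat)
  also have "lin_fun bar \<dots> = lin_fun (Pih 1 x) v"
    by (rule lin_Pih_eq_bar[symmetric]) (simp_all add: v)
  finally show ?thesis .
qed

text \<open>\<open>act_hat\<close> is conjugated by the invertible action of \<open>f 0 x\<close>:
  the composite is the action with index 1, which commutes with \<open>R\<close>, hence so does
  \<open>act_hat\<close>.\<close>

lemma lin_R_Gt:
  assumes v: "v \<in> span_of trees"
  shows "lin R (Gt y x v) = Gt y x (lin R v)"
proof -
  have "lin R (act_hat \<alpha> (f 0 x) v) = act \<alpha> 0 (f_inv x) (act \<alpha> 0 (f 0 x) (lin R (act_hat \<alpha> (f 0 x) v)))"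
    by (simp add: act_f_inv span_trees_wide lin_R_trees act_hat_trees v)
  also have "act \<alpha> 0 (f 0 x) (lin R (act_hat \<alpha> (f 0 x) v)) = act \<alpha> 0 (f 0 x) (act_hat \<alpha> (f 0 x) (lin R v))"
    by (simp add: act_R act_hat_trees v act_act_hat lin_R_trees)
  also have "act \<alpha> 0 (f_inv x) \<dots> = act_hat \<alpha> (f 0 x) (lin R v)"
    by (simp add: act_f_inv span_trees_wide lin_R_trees act_hat_trees v)
  finally show ?thesis
    by (simp add: Gt_def Gam_eq_act act_R[symmetric] act_hat_trees v)
qed

text \<open>Either coaction commutes with planting up to polynomials, and polynomials are stable
  under the action. No formula for the error is recorded because \<open>Q1\<close> annihilates
  it.\<close>

lemma Gt_II: "\<exists>w\<in>span_of (range monoX). Gt y x (II a v) = II a (Gt y x v) + w"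
proof -
  let ?X = "span_of (range monoX)"
  have act: "\<exists>w\<in>?X. act \<alpha> 0 g (II a v) = II a (act \<alpha> 0 g v) + w" for g v
  proof -
    have "v \<in> span_of UNIV" by simp
    then show ?thesis
    proof (induction v rule: span_of_induct)
      case zero
      then show ?case by (intro bexI[of _ 0]) (simp_all add: II_def act_linear)
    next
      case (step c \<tau> v)
      then obtain w where w: "w \<in> ?X" "act \<alpha> 0 g (II a v) = II a (act \<alpha> 0 g v) + w" by blast
      define w' where "w' = (\<Sum>(b, c) | real (sdeg (b + c)) < deg \<alpha> 0 (graft a \<tau>).
          scale (lin_real g (divpow P0 P1 c * IIp \<alpha> 0 (a + b + c) (basis \<tau>))) (divpow X0 X1 b))"
      have w': "w' \<in> ?X" unfolding w'_def
        by (rule span_of_sum) (auto intro!: span_of_scale span_of_mono[OF _ span_of_divpow_monoX])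
      have "act \<alpha> 0 g (II a (basis \<tau>)) = II a (act \<alpha> 0 g (basis \<tau>)) + w'"
        unfolding w'_def act_graft_raw[symmetric] by (simp add: II_def)
      then have "act \<alpha> 0 g (II a (scale c (basis \<tau>) + v))
          = II a (act \<alpha> 0 g (scale c (basis \<tau>) + v)) + (scale c w' + w)"
        using w(2) by (simp add: II_def lin_add lin_scale act_linear scale_add_right del: lin_basis act_basis)
      then show ?case using w(1) w' by (blast intro: span_of_add span_of_scale)
    qed
  qed
  have hat: "\<exists>w\<in>?X. act_hat \<alpha> (f 0 x) (II a v) = II a (act_hat \<alpha> (f 0 x) v) + w"
  proof -
    have "v \<in> span_of UNIV" by simp
    then show ?thesis
    proof (induction v rule: span_of_induct)
      case zero
      then show ?case by (intro bexI[of _ 0]) (simp_all add: II_def act_hat_linear)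
    next
      case (step c \<tau> v)
      then obtain w where w: "w \<in> ?X" "act_hat \<alpha> (f 0 x) (II a v) = II a (act_hat \<alpha> (f 0 x) v) + w" by blast
      define w' where "w' = act_hat \<alpha> (f 0 x) (basis (graft a \<tau>)) - II a (act_hat \<alpha> (f 0 x) (basis \<tau>))"
      define ds where "ds = (\<lambda>(s, p). deg \<alpha> 0 (graft a s)) ` Poly_Mapping.keys (coact_hat_tree \<alpha> \<tau>)"
      have bound: "deg \<alpha> 0 (graft a s) \<le> Max ds" if "(s, p) \<in> Poly_Mapping.keys (coact_hat_tree \<alpha> \<tau>)" for s p
        using that by (intro Max_ge) (force simp: ds_def)+
      have w': "w' \<in> ?X"
      proof -
        let ?S = "\<Sum>b | real (sdeg b) < Max ds. if deg \<alpha> 1 (graft a \<tau>) \<le> real (sdeg b)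
          then scale (lin_real (\<lambda>\<sigma>. lin_real (f 0 x) (IIp \<alpha> 0 (a + b) (basis \<sigma>))) (act_hat \<alpha> (f 0 x) (basis \<tau>)))
                 (divpow X0 X1 b) else 0"
        have "act_hat \<alpha> (f 0 x) (basis (graft a \<tau>)) = II a (act_hat \<alpha> (f 0 x) (basis \<tau>)) - ?S"
          by (rule act_hat_graft[OF mhom_fchar bound])
        then have eq: "w' = 0 - ?S" unfolding w'_def by (simp del: act_hat_basis)
        show ?thesis unfolding eq
          by (rule span_of_diff[OF span_of_zero span_of_sum])
             (auto intro!: span_of_scale span_of_mono[OF _ span_of_divpow_monoX])
      qed
      have "act_hat \<alpha> (f 0 x) (II a (basis \<tau>)) = II a (act_hat \<alpha> (f 0 x) (basis \<tau>)) + w'"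
        unfolding w'_def by (simp add: II_def)
      then have "act_hat \<alpha> (f 0 x) (II a (scale c (basis \<tau>) + v))
          = II a (act_hat \<alpha> (f 0 x) (scale c (basis \<tau>) + v)) + (scale c w' + w)"
        using w(2) by (simp add: II_def lin_add lin_scale act_hat_linear scale_add_right del: lin_basis act_hat_basis)
      then show ?case using w(1) w' by (blast intro: span_of_add span_of_scale)
    qed
  qed
  have poly: "act \<alpha> 0 g w \<in> ?X" if "w \<in> ?X" for g w
  proof -
    \<comment> \<open>Polynomials form a rule set, with neither noises nor edges allowed, so the
      general stability applies.\<close>
    have "range monoX = rule_trees (\<lambda>l m A. l = 0 \<and> m = 0 \<and> A = {#})"
      by (auto elim!: rule_trees.cases intro!: rule_trees.intros)
    then show ?thesis using that by (simp add: act_rule_trees down_closed_def)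
  qed
  obtain w where w: "w \<in> ?X" "act_hat \<alpha> (f 0 x) (II a v) = II a (act_hat \<alpha> (f 0 x) v) + w"
    using hat by blast
  obtain w' where w': "w' \<in> ?X" "Gam y x (II a (act_hat \<alpha> (f 0 x) v)) = II a (Gt y x v) + w'"
    unfolding Gt_def Gam_eq_act using act by blast
  have "Gt y x (II a v) = II a (Gt y x v) + (w' + Gam y x w)"
    unfolding Gt_def[of y x "II a v"] w(2) using w'(2) by (simp add: Gam_eq_act act_linear)
  then show ?thesis using w(1) w'(1) poly unfolding Gam_eq_act by (blast intro: span_of_add)
qed

end

section \<open>The derivation on trees\<close>

lemma DXi_tree_gen:
  "DXi_tree 0 = 0" "DXi_tree (monoX k) = 0" "DXi_tree Xi0 = basis Xi1" "DXi_tree Xi1 = 0"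
  "DXi_tree (graft a \<tau>) = II a (DXi_tree \<tau>)"
  by (simp_all add: zero_dtree_def One_nat_def del: Tree_eq_0_iff)
     (simp add: zero_dtree_def[symmetric] basis_zero del: Tree_eq_0_iff)

lemma DXi_tree_add: "DXi_tree (\<sigma> + \<tau>) = DXi_tree \<sigma> * basis \<tau> + basis \<sigma> * DXi_tree \<tau>"
proof -
  obtain k l m M where s: "\<sigma> = Tree k l m M" by (cases \<sigma>)
  obtain k' l' m' M' where t: "\<tau> = Tree k' l' m' M'" by (cases \<tau>)
  \<comment> \<open>For \<open>l = 0\<close> the truncated \<open>l - 1\<close> would give the wrong
    tree, but its coefficient is then 0.\<close>
  have noise: "scale (real l) (basis (Tree (k + k') (l + l' - 1) (m + m' + 1) (M + M')))
      = scale (real l) (basis (Tree k (l - 1) (m + 1) M)) * basis \<tau>"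
    by (cases l) (simp_all add: t mult_single add_ac)
  have noise': "scale (real l') (basis (Tree (k + k') (l + l' - 1) (m + m' + 1) (M + M')))
      = basis \<sigma> * scale (real l') (basis (Tree k' (l' - 1) (m' + 1) M'))"
    by (cases l') (simp_all add: s mult_single add_ac)
  have left: "(\<Sum>(a, \<rho>)\<in>#M. basis (Tree (k + k') (l + l') (m + m') (M + M' - {#(a, \<rho>)#})) * II a (DXi_tree \<rho>))
     = (\<Sum>(a, \<rho>)\<in>#M. basis (Tree k l m (M - {#(a, \<rho>)#})) * II a (DXi_tree \<rho>)) * basis \<tau>"
    unfolding sum_mset_distrib_right
  proof (rule arg_cong[of _ _ sum_mset], rule image_mset_cong, clarify)
    fix a \<rho> assume "(a, \<rho>) \<in># M"
    then have "M + M' - {#(a, \<rho>)#} = M - {#(a, \<rho>)#} + M'" by simp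
    then have "basis (Tree (k + k') (l + l') (m + m') (M + M' - {#(a, \<rho>)#}))
       = basis (Tree k l m (M - {#(a, \<rho>)#})) * basis \<tau>" by (simp add: t mult_single)
    then show "basis (Tree (k + k') (l + l') (m + m') (M + M' - {#(a, \<rho>)#})) * II a (DXi_tree \<rho>)
       = basis (Tree k l m (M - {#(a, \<rho>)#})) * II a (DXi_tree \<rho>) * basis \<tau>" by (simp add: mult_ac)
  qed
  have right: "(\<Sum>(a, \<rho>)\<in>#M'. basis (Tree (k + k') (l + l') (m + m') (M + M' - {#(a, \<rho>)#})) * II a (DXi_tree \<rho>))
     = basis \<sigma> * (\<Sum>(a, \<rho>)\<in>#M'. basis (Tree k' l' m' (M' - {#(a, \<rho>)#})) * II a (DXi_tree \<rho>))"
    unfolding sum_mset_distrib_left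
  proof (rule arg_cong[of _ _ sum_mset], rule image_mset_cong, clarify)
    fix a \<rho> assume "(a, \<rho>) \<in># M'"
    then have "M + M' - {#(a, \<rho>)#} = M + (M' - {#(a, \<rho>)#})" by simp
    then have "basis (Tree (k + k') (l + l') (m + m') (M + M' - {#(a, \<rho>)#}))
       = basis \<sigma> * basis (Tree k' l' m' (M' - {#(a, \<rho>)#}))" by (simp add: s mult_single)
    then show "basis (Tree (k + k') (l + l') (m + m') (M + M' - {#(a, \<rho>)#})) * II a (DXi_tree \<rho>)
       = basis \<sigma> * (basis (Tree k' l' m' (M' - {#(a, \<rho>)#})) * II a (DXi_tree \<rho>))" by (simp add: mult_ac)
  qed
  have "DXi_tree (\<sigma> + \<tau>) = scale (real l) (basis (Tree (k + k') (l + l' - 1) (m + m' + 1) (M + M')))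
      + scale (real l') (basis (Tree (k + k') (l + l' - 1) (m + m' + 1) (M + M')))
      + ((\<Sum>(a, \<rho>)\<in>#M. basis (Tree (k + k') (l + l') (m + m') (M + M' - {#(a, \<rho>)#})) * II a (DXi_tree \<rho>))
       + (\<Sum>(a, \<rho>)\<in>#M'. basis (Tree (k + k') (l + l') (m + m') (M + M' - {#(a, \<rho>)#})) * II a (DXi_tree \<rho>)))"
    by (simp add: s t scale_add_left)
  also have "\<dots> = DXi_tree \<sigma> * basis \<tau> + basis \<sigma> * DXi_tree \<tau>"
    unfolding noise noise' left right by (simp add: s t distrib_left distrib_right add_ac)
  finally show ?thesis .
qed

declare DXi_tree.simps [simp del]

lemma DXi_basis [simp]: "DXi (basis \<tau>) = DXi_tree \<tau>"
  by (simp add: DXi_def)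

lemma DXi_linear:
  "DXi 0 = 0" "DXi (u + v) = DXi u + DXi v" "DXi (scale c v) = scale c (DXi v)"
  by (simp_all add: DXi_def lin_add lin_scale)

lemma DXi_mult: "DXi (u * v) = DXi u * v + u * DXi v"
proof -
  have 1: "DXi (basis \<sigma> * v) = DXi_tree \<sigma> * v + basis \<sigma> * DXi v" for \<sigma>
  proof -
    have "v \<in> span_of UNIV" by simp
    then show ?thesis
      by (induction v rule: span_of_induct)
        (simp_all add: DXi_linear distrib_left basis_add[symmetric] DXi_tree_add scale_add_right add_ac mult.commute)
  qed
  have "u \<in> span_of UNIV" by simp
  then show ?thesis
    by (induction u rule: span_of_induct)
      (simp_all add: DXi_linear distrib_left distrib_right 1 scale_add_right add_ac)
qed

lemma DXi_II: "DXi (II a v) = II a (DXi v)"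
  by (simp add: DXi_def II_def lin_lin) (simp add: DXi_tree_gen[unfolded II_def])

lemma II_basis [simp]: "II a (basis \<tau>) = basis (graft a \<tau>)"
  by (simp add: II_def)

lemma span_of_II: "v \<in> span_of S \<Longrightarrow> (\<And>\<sigma>. \<sigma> \<in> S \<Longrightarrow> graft a \<sigma> \<in> S') \<Longrightarrow> II a v \<in> span_of S'"
  unfolding II_def by (rule span_of_lin) auto

text \<open>The derivation changes one noise and no edge decoration, so a rule survives if it
  tolerates replacing a \<open>Xi0\<close> by a \<open>Xi1\<close> at a node.\<close>

lemma DXi_tree_rule_trees:
  assumes \<rho>: "\<And>l m A. \<rho> (Suc l) m A \<Longrightarrow> \<rho> l (Suc m) A" and "\<tau> \<in> rule_trees \<rho>"
  shows "DXi_tree \<tau> \<in> span_of (rule_trees \<rho>)"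
  using assms(2)
proof (induction \<tau> rule: rule_trees.induct)
  case (1 l m M k)
  have T: "basis (Tree k l m (M - {#(a, \<sigma>)#})) * II a (DXi_tree \<sigma>) \<in> span_of (rule_trees \<rho>)"
    if a: "(a, \<sigma>) \<in># M" for a \<sigma>
  proof (rule span_of_mult)
    have s: "DXi_tree \<sigma> \<in> span_of (rule_trees \<rho>)" using 1 a by blast
    show "basis (Tree k l m (M - {#(a, \<sigma>)#})) \<in> span_of {Tree k l m (M - {#(a, \<sigma>)#})}" by simp
    show "II a (DXi_tree \<sigma>) \<in> span_of (graft a ` rule_trees \<rho>)" by (rule span_of_II[OF s]) simp
    fix s t assume "s \<in> {Tree k l m (M - {#(a, \<sigma>)#})}" "t \<in> graft a ` rule_trees \<rho>"
    then obtain \<sigma>' where st: "\<sigma>' \<in> rule_trees \<rho>" "s + t = Tree k l m (add_mset (a, \<sigma>') (M - {#(a, \<sigma>)#}))"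
      by auto
    have "image_mset fst (add_mset (a, \<sigma>') (M - {#(a, \<sigma>)#})) = image_mset fst M"
      using a by (auto dest!: multi_member_split)
    then show "s + t \<in> rule_trees \<rho>"
      unfolding st(2) rule_trees_Tree using 1 st(1) by (metis (no_types, lifting) Pair_inject in_diffD insert_iff set_mset_add_mset_insert)
  qed
  have "scale (real l) (basis (Tree k (l - 1) (m + 1) M)) \<in> span_of (rule_trees \<rho>)"
  proof (cases l)
    case (Suc l')
    have "Tree k l' (m + 1) M \<in> rule_trees \<rho>" unfolding rule_trees_Tree using 1 \<rho>[of l' m] Suc by (auto simp flip: Suc_eq_plus1)
    then show ?thesis by (intro span_of_scale) (simp add: Suc)
  qed simp
  moreover have "sum_mset (image_mset (\<lambda>(a, \<tau>). basis (Tree k l m (M - {#(a, \<tau>)#})) * II a (DXi_tree \<tau>)) N)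
      \<in> span_of (rule_trees \<rho>)" if "N \<subseteq># M" for N
    using that
  proof (induction N)
    case (add x N)
    have "x \<in># M" "N \<subseteq># M"
      using mset_subset_eqD[OF add.prems, of x] subset_mset.order_trans[OF _ add.prems, of N] by simp_all
    then show ?case using T add.IH by (cases x) (auto intro: span_of_add)
  qed simp
  ultimately show ?case unfolding DXi_tree.simps by (intro span_of_add) auto
qed

text \<open>Both noises have the same degree for index 1; hence differentiating does not move the
  Taylor cutoffs of that model.\<close>

lemma DXi_tree_deg: "DXi_tree \<tau> \<in> span_of {\<sigma>. deg \<alpha> 1 \<sigma> = deg \<alpha> 1 \<tau>}"
proof (induction \<tau> rule: dtree_full_induct)
  case (graft a \<tau>)
  show ?case unfolding DXi_tree_gen by (rule span_of_II[OF graft]) (simp add: deg_graft)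
next
  case (add \<sigma> \<tau>)
  show ?case unfolding DXi_tree_add
    by (intro span_of_add span_of_mult[OF add(1), of _ "{\<tau>}"] span_of_mult[OF _ add(2), of _ "{\<sigma>}"])
       (auto simp: deg_add)
qed (simp_all add: DXi_tree_gen deg.simps)

lemma DXi_trees: "v \<in> span_of trees \<Longrightarrow> DXi v \<in> span_of trees"
  unfolding DXi_def trees_eq_rule_trees by (rule span_of_lin) (auto intro: DXi_tree_rule_trees)

section \<open>The Malliavin derivative of the model\<close>

text \<open>
  Perturbing the noise by \<open>\<epsilon> \<eta>\<close> turns all quantities into polynomials in \<open>\<epsilon>\<close>, so that no interchange of limits
  is needed.
\<close>

definition expands :: "(real \<Rightarrow> real \<times> real \<Rightarrow> real) \<Rightarrow> (real \<times> real \<Rightarrow> real) \<Rightarrow> bool" where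
  "expands G B \<longleftrightarrow> (\<exists>p :: real \<times> real \<Rightarrow> real poly. \<exists>n.
     (\<forall>\<epsilon> z. G \<epsilon> z = poly (p z) \<epsilon>) \<and> (\<forall>z. degree (p z) \<le> n) \<and>
     (\<forall>j. smooth (\<lambda>z. coeff (p z) j)) \<and> (\<forall>z. coeff (p z) 1 = B z))"

lemma expands_deriv:
  assumes "expands G B"
  shows "deriv (\<lambda>\<epsilon>. G \<epsilon> z) 0 = B z"
proof -
  obtain p where p: "\<And>\<epsilon> z. G \<epsilon> z = poly (p z) \<epsilon>" "\<And>z. coeff (p z) 1 = B z"
    using assms unfolding expands_def by blast
  have "((\<lambda>\<epsilon>. poly (p z) \<epsilon>) has_real_derivative poly (pderiv (p z)) 0) (at 0)" by (rule poly_DERIV)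
  then have "deriv (\<lambda>\<epsilon>. poly (p z) \<epsilon>) 0 = poly (pderiv (p z)) 0" by (rule DERIV_imp_deriv)
  then show ?thesis using p(2)[of z] by (simp add: p(1) poly_0_coeff_0 coeff_pderiv One_nat_def)
qed

lemma smooth_if: "smooth f \<Longrightarrow> smooth g \<Longrightarrow> smooth (\<lambda>z. if P then f z else g z)"
  by (cases P) simp_all

lemma expands_const: "smooth c \<Longrightarrow> expands (\<lambda>\<epsilon>. c) (\<lambda>z. 0)"
  unfolding expands_def
  by (intro exI[of _ "\<lambda>z. [:c z:]"] exI[of _ 0])
     (auto simp: coeff_pCons' intro!: smooth_const smooth_if)

lemma expands_affine: "smooth a \<Longrightarrow> smooth b \<Longrightarrow> expands (\<lambda>\<epsilon> z. a z + \<epsilon> * b z) b"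
  unfolding expands_def
  by (intro exI[of _ "\<lambda>z. [:a z, b z:]"] exI[of _ 1])
     (auto simp: coeff_pCons' intro!: smooth_const smooth_if)

lemma expands_add_cmult:
  assumes "expands G B" and "expands H C"
  shows "expands (\<lambda>\<epsilon> z. c * G \<epsilon> z + H \<epsilon> z) (\<lambda>z. c * B z + C z)"
proof -
  obtain p n where p: "\<And>\<epsilon> z. G \<epsilon> z = poly (p z) \<epsilon>" "\<And>z. degree (p z) \<le> n"
      "\<And>j. smooth (\<lambda>z. coeff (p z) j)" "\<And>z. coeff (p z) 1 = B z"
    using assms(1) unfolding expands_def by blast
  obtain q m where q: "\<And>\<epsilon> z. H \<epsilon> z = poly (q z) \<epsilon>" "\<And>z. degree (q z) \<le> m"
      "\<And>j. smooth (\<lambda>z. coeff (q z) j)" "\<And>z. coeff (q z) 1 = C z"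
    using assms(2) unfolding expands_def by blast
  show ?thesis unfolding expands_def
  proof (intro exI[of _ "\<lambda>z. smult c (p z) + q z"] exI[of _ "max n m"] conjI allI)
    show "degree (smult c (p z) + q z) \<le> max n m" for z
      using p(2)[of z] q(2)[of z] by (intro degree_add_le) (auto intro: order_trans[OF degree_smult_le])
  qed (auto simp: p q intro!: smooth_add smooth_cmult)
qed

lemma expands_mult:
  assumes "expands G B" and "expands H C"
  shows "expands (\<lambda>\<epsilon> z. G \<epsilon> z * H \<epsilon> z) (\<lambda>z. B z * H 0 z + G 0 z * C z)"
proof -
  obtain p n where p: "\<And>\<epsilon> z. G \<epsilon> z = poly (p z) \<epsilon>" "\<And>z. degree (p z) \<le> n"
      "\<And>j. smooth (\<lambda>z. coeff (p z) j)" "\<And>z. coeff (p z) 1 = B z"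
    using assms(1) unfolding expands_def by blast
  obtain q m where q: "\<And>\<epsilon> z. H \<epsilon> z = poly (q z) \<epsilon>" "\<And>z. degree (q z) \<le> m"
      "\<And>j. smooth (\<lambda>z. coeff (q z) j)" "\<And>z. coeff (q z) 1 = C z"
    using assms(2) unfolding expands_def by blast
  show ?thesis unfolding expands_def
  proof (intro exI[of _ "\<lambda>z. p z * q z"] exI[of _ "n + m"] conjI allI)
    show "degree (p z * q z) \<le> n + m" for z
      using p(2)[of z] q(2)[of z] degree_mult_le[of "p z" "q z"] by linarith
    show "smooth (\<lambda>z. coeff (p z * q z) j)" for j
      unfolding coeff_mult by (intro smooth_sum smooth_mult p q)
    show "coeff (p z * q z) 1 = B z * H 0 z + G 0 z * C z" for z
      using p(4)[of z] q(4)[of z] by (simp add: coeff_mult One_nat_def p(1) q(1) poly_0_coeff_0)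
  qed (auto simp: p q)
qed

text \<open>Needed for the Taylor coefficients, which depend on the noise but are evaluated at the
  fixed base point.\<close>

lemma expands_freeze: "expands G B \<Longrightarrow> expands (\<lambda>\<epsilon> z. G \<epsilon> x) (\<lambda>z. B x)"
  unfolding expands_def
proof (elim exE conjE)
  fix p :: "real \<times> real \<Rightarrow> real poly" and n
  assume "\<forall>\<epsilon> z. G \<epsilon> z = poly (p z) \<epsilon>" "\<forall>z. degree (p z) \<le> n" "\<forall>z. coeff (p z) 1 = B z"
  then show "\<exists>p n. (\<forall>\<epsilon> z. G \<epsilon> x = poly (p z) \<epsilon>) \<and> (\<forall>z :: real \<times> real. degree (p z) \<le> n) \<and>
     (\<forall>j. smooth (\<lambda>z. coeff (p z) j)) \<and> (\<forall>z. coeff (p z) 1 = B x)"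
    by (intro exI[of _ "\<lambda>z. p x"] exI[of _ n] conjI allI) (blast intro: smooth_const)+
qed

lemma expands_sum:
  assumes "\<And>s. s \<in> S \<Longrightarrow> expands (G s) (B s)"
  shows "expands (\<lambda>\<epsilon> z. \<Sum>s\<in>S. c s * G s \<epsilon> z) (\<lambda>z. \<Sum>s\<in>S. c s * B s z)"
  using assms
proof (induction S rule: infinite_finite_induct)
  case (insert s S)
  then show ?case using expands_add_cmult[of "G s" "B s" _ _ "c s"] by simp
qed (simp_all add: expands_const smooth_const)

lemma expands_lin_fun:
  assumes "\<And>s. s \<in> Poly_Mapping.keys v \<Longrightarrow> expands (\<lambda>\<epsilon>. G \<epsilon> s) (B s)"
  shows "expands (\<lambda>\<epsilon>. lin_fun (G \<epsilon>) v) (lin_fun B v)"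
  unfolding lin_fun_def lin_real_def by (rule expands_sum[OF assms])

text \<open>The degree bound, uniform in z, writes \<open>G\<close> as one finite sum of powers of
  the parameter with smooth coefficients, and \<open>convD\<close> acts coefficientwise.\<close>

lemma expands_convD:
  assumes K: "truncated_heat_kernel K" and "expands G B"
  shows "expands (\<lambda>\<epsilon>. convD K a (G \<epsilon>)) (convD K a B)"
proof -
  obtain p n where p: "\<And>\<epsilon> z. G \<epsilon> z = poly (p z) \<epsilon>" "\<And>z. degree (p z) \<le> n"
      "\<And>j. smooth (\<lambda>z. coeff (p z) j)" "\<And>z. coeff (p z) 1 = B z"
    using assms(2) unfolding expands_def by blast
  define c where "c j = convD K a (\<lambda>z. coeff (p z) j)" for j
  \<comment> \<open>The range reaches \<open>Suc n\<close>, so that the coefficient of order 1 is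
    present even when \<open>n = 0\<close>.\<close>
  define q where "q z = (\<Sum>j\<le>Suc n. monom (c j z) j)" for z
  have cq: "coeff (q z) j = (if j \<le> Suc n then c j z else 0)" for z j
    by (simp add: q_def coeff_sum)
  have G: "G \<epsilon> = (\<lambda>z. \<Sum>j\<le>Suc n. \<epsilon> ^ j * coeff (p z) j)" for \<epsilon>
  proof
    fix z
    have "G \<epsilon> z = (\<Sum>j\<le>degree (p z). coeff (p z) j * \<epsilon> ^ j)" by (simp add: p(1) poly_altdef)
    also have "\<dots> = (\<Sum>j\<le>Suc n. coeff (p z) j * \<epsilon> ^ j)"
      using p(2)[of z] by (intro sum.mono_neutral_left) (auto simp: coeff_eq_0)
    finally show "G \<epsilon> z = (\<Sum>j\<le>Suc n. \<epsilon> ^ j * coeff (p z) j)" by (simp add: mult.commute)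
  qed
  show ?thesis unfolding expands_def
  proof (intro exI[of _ q] exI[of _ "Suc n"] conjI allI)
    show "convD K a (G \<epsilon>) z = poly (q z) \<epsilon>" for \<epsilon> z
    proof -
      have "convD K a (G \<epsilon>) = (\<lambda>y. \<Sum>j\<le>Suc n. \<epsilon> ^ j * convD K a (\<lambda>z. coeff (p z) j) y)"
        unfolding G by (rule convD_sum[OF K]) (simp_all add: p(3))
      then show ?thesis by (simp add: q_def c_def poly_sum poly_monom mult.commute)
    qed
    show "degree (q z) \<le> Suc n" for z by (rule degree_le) (simp add: cq)
    show "smooth (\<lambda>z. coeff (q z) j)" for j
      by (cases "j \<le> Suc n") (simp_all add: cq smooth_const, simp add: c_def smooth_convD[OF K p(3)])
    show "coeff (q z) 1 = convD K a B z" for z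
      using p(4) by (simp add: cq c_def One_nat_def)
  qed
qed

section \<open>Differentiating the recentered model in the noise\<close>

lemma trees0_subset_trees: "trees0 \<subseteq> trees"
proof
  fix \<tau> assume "\<tau> \<in> trees0"
  then show "\<tau> \<in> trees"
    by (induction \<tau> rule: trees0.induct) (intro trees.intros; fastforce)+
qed

lemma trees0_child:
  assumes "Tree k l m M \<in> trees0" and "(a, \<sigma>) \<in># M"
  shows "\<sigma> \<in> trees0"
  using assms(1)
proof (cases rule: trees0.cases)
  case 1
  then show ?thesis using assms(2) by blast
next
  case (2 N \<rho>)
  then consider "(a, \<sigma>) = ((0, 2), \<rho>)" | "(a, \<sigma>) \<in># N" using assms(2) by auto
  then show ?thesis using 2 by cases blast+
next
  case 3
  then show ?thesis using assms(2) by simp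
qed

lemma trees0_noise1: "Tree k l m M \<in> trees0 \<Longrightarrow> m = 0"
  by (cases rule: trees0.cases) auto

context model
begin

lemma R_trees0: "\<tau> \<in> trees0 \<Longrightarrow> R \<tau> \<in> span_of trees0"
  using prep by (auto simp: preparation_map_def)

lemma lin_R_DXi:
  assumes "v \<in> span_of trees0"
  shows "lin R (DXi v) = DXi (lin R v)"
  using assms
proof (induction v rule: span_of_induct)
  case (step c \<tau> v)
  have "lin R (DXi (basis \<tau>)) = DXi (R \<tau>)" using prep step.hyps(1) unfolding preparation_map_def by blast
  then show ?case using step.IH by (simp add: DXi_linear lin_add lin_scale)
qed (simp add: DXi_linear)

lemma lin_Pih_II:
  assumes "v \<in> span_of trees"
  shows "lin_fun (Pih i x) (II a v) z = lin_real (\<lambda>s. Pih i x (graft a s) z) v"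
  by (simp add: II_def lin_fun_lin) (simp add: lin_fun_def)

text \<open>When all planted trees have the same degree they share one cutoff, and the Taylor
  subtraction extends from trees to linear combinations.\<close>

lemma lin_Pih_II_deg:
  assumes i: "i \<in> {0, 1}" and v: "v \<in> span_of trees" and d: "v \<in> span_of {s. deg \<alpha> i (graft a s) = d}"
  shows "lin_fun (Pih i x) (II a v) z = convD K a (lin_fun (Pih i x) (lin R v)) z
     - (\<Sum>b | real (sdeg b) < d. mpow (z - x) b / mfact b * convD K (a + b) (lin_fun (Pih i x) (lin R v)) x)"
proof -
  let ?p = "\<lambda>s. PiR \<alpha> i R K \<xi> \<eta> x s"
  have v': "v \<in> span_of {s \<in> trees. deg \<alpha> i (graft a s) = d}" using v d by (auto simp: span_of_def)
  have "lin_fun (Pih i x) (II a v) z = lin_real (\<lambda>s. convD K a (?p s) z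
     - (\<Sum>b | real (sdeg b) < d. mpow (z - x) b / mfact b * convD K (a + b) (?p s) x)) v"
    unfolding lin_Pih_II[OF v] by (rule lin_real_eq_on_span[OF v']) (auto simp: Pih_graft)
  also have "\<dots> = lin_real (\<lambda>s. convD K a (?p s) z) v
     - (\<Sum>b | real (sdeg b) < d. mpow (z - x) b / mfact b * lin_real (\<lambda>s. convD K (a + b) (?p s) x) v)"
  proof -
    have 1: "lin_real (\<lambda>s. g s - h s) v = lin_real g v - lin_real h v" for g h
      by (simp add: lin_real_def right_diff_distrib sum_subtractf)
    have 2: "lin_real (\<lambda>s. \<Sum>b\<in>B. w b * h b s) v = (\<Sum>b\<in>B. w b * lin_real (h b) v)" for B :: "idx set" and w h
      unfolding lin_real_def sum_distrib_left
      by (subst sum.swap) (intro sum.cong refl, simp add: mult.left_commute)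
    show ?thesis unfolding 1 2 ..
  qed
  finally show ?thesis unfolding convD_PiR_lin[OF i v] .
qed

text \<open>The noise is affine in the parameter, and expansions are stable under products,
  convolution and freezing. The outer induction follows \<open>R\<close>, which does not depend on
  the noise.\<close>

lemma expands_Pih:
  assumes "\<tau> \<in> trees0"
  shows "expands (\<lambda>\<epsilon>. PiHat \<alpha> 1 R K (\<lambda>z. \<xi> z + \<epsilon> * \<eta> z) \<eta> x \<tau>) (lin_fun (Pih 1 x) (DXi_tree \<tau>))"
proof -
  let ?Pe = "\<lambda>\<epsilon>. PiHat \<alpha> 1 R K (\<lambda>z. \<xi> z + \<epsilon> * \<eta> z) \<eta> x"
  have me: "model \<alpha> K (\<lambda>z. \<xi> z + \<epsilon> * \<eta> z) \<eta> R" for \<epsilon>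
    by unfold_locales (intro K \<xi> \<eta> prep smooth_add smooth_cmult)+
  have "\<tau> \<in> trees0 \<longrightarrow> expands (\<lambda>\<epsilon>. ?Pe \<epsilon> \<tau>) (lin_fun (Pih 1 x) (DXi_tree \<tau>))"
  proof (rule preparation_map_induct[OF prep subsetD[OF trees0_subset_trees assms]], rule impI)
    fix k l m M assume T: "Tree k l m M \<in> trees0"
      and IH: "\<And>a t s. (a, t) \<in># M \<Longrightarrow> s \<in> Poly_Mapping.keys (R t) \<Longrightarrow>
        s \<in> trees0 \<longrightarrow> expands (\<lambda>\<epsilon>. ?Pe \<epsilon> s) (lin_fun (Pih 1 x) (DXi_tree s))"
    let ?P = "\<lambda>\<sigma>. \<sigma> \<in> wide_trees \<and> DXi_tree \<sigma> \<in> span_of wide_trees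
      \<and> expands (\<lambda>\<epsilon>. ?Pe \<epsilon> \<sigma>) (lin_fun (Pih 1 x) (DXi_tree \<sigma>))"
    have "?P (Tree k l m M)"
    proof (rule dtree_gen_induct[where P="?P"])
      show "?P 0" "?P (monoX (1, 0))" "?P (monoX (0, 1))"
        unfolding model.Pih_gen[OF me] DXi_tree_gen
        by (simp_all add: wide_trees_gen expands_const smooth_const smooth_mpow)
      show "?P Xi0" unfolding model.Pih_gen[OF me] DXi_tree_gen
        by (simp add: wide_trees_gen Pih_gen expands_affine \<xi> \<eta>)
      show "?P Xi1" if "m > 0" using that trees0_noise1[OF T] by simp
      fix a \<sigma> assume a: "(a, \<sigma>) \<in># M"
      have \<sigma>: "\<sigma> \<in> trees0" by (rule trees0_child[OF T a])
      then have \<sigma>T: "\<sigma> \<in> trees" using trees0_subset_trees by blast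
      have D: "DXi_tree \<sigma> \<in> span_of trees" using DXi_trees[of "basis \<sigma>"] \<sigma>T by simp
      define B where "B = lin_fun (Pih 1 x) (lin R (DXi_tree \<sigma>))"
      define d where "d = deg \<alpha> 1 (graft a \<sigma>)"
      define Pr where "Pr \<epsilon> = PiR \<alpha> 1 R K (\<lambda>z. \<xi> z + \<epsilon> * \<eta> z) \<eta> x \<sigma>" for \<epsilon>
      have "expands (\<lambda>\<epsilon>. lin_fun (?Pe \<epsilon>) (R \<sigma>)) (lin_fun (\<lambda>s. lin_fun (Pih 1 x) (DXi_tree s)) (R \<sigma>))"
        by (rule expands_lin_fun) (use IH[OF a] R_trees0[OF \<sigma>] in \<open>auto simp: span_of_def\<close>)
      \<comment> \<open>The derivative passes through \<open>R\<close> because \<open>R\<close>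
        commutes with the derivation on \<open>trees0\<close>.\<close>
      moreover have "lin_fun (\<lambda>s. lin_fun (Pih 1 x) (DXi_tree s)) (R \<sigma>) = B"
        using lin_R_DXi[of "basis \<sigma>"] \<sigma> unfolding B_def lin_fun_lin[symmetric] by (simp add: DXi_def)
      ultimately have Pr: "expands Pr B" by (simp add: Pr_def[abs_def] PiR_def)
      \<comment> \<open>Differentiated and original branch have equal degree, so both sides are
        truncated at the same order \<open>d\<close>.\<close>
      have dd: "DXi_tree \<sigma> \<in> span_of {s. deg \<alpha> 1 (graft a s) = d}"
        by (rule span_of_mono[OF _ DXi_tree_deg[of \<sigma> \<alpha>]]) (auto simp: d_def deg_graft)
      have "expands (\<lambda>\<epsilon> z. (-1) * (\<Sum>b | real (sdeg b) < d. 1 * (mpow (z - x) b / mfact b * convD K (a + b) (Pr \<epsilon>) x))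
             + convD K a (Pr \<epsilon>) z)
         (\<lambda>z. (-1) * (\<Sum>b | real (sdeg b) < d. 1 * (mpow (z - x) b / mfact b * convD K (a + b) B x)) + convD K a B z)"
      proof (intro expands_add_cmult expands_sum expands_convD[OF K Pr])
        fix b
        have s: "smooth (\<lambda>z. mpow (z - x) b / mfact b)"
          using smooth_cmult[OF smooth_mpow, of "1 / mfact b" x b] by simp
        show "expands (\<lambda>\<epsilon> z. mpow (z - x) b / mfact b * convD K (a + b) (Pr \<epsilon>) x)
            (\<lambda>z. mpow (z - x) b / mfact b * convD K (a + b) B x)"
          using expands_mult[OF expands_const[OF s] expands_freeze[OF expands_convD[OF K Pr], of "a + b" x]] by simp
      qed
      moreover have "?Pe \<epsilon> (graft a \<sigma>) = (\<lambda>z. (-1) * (\<Sum>b | real (sdeg b) < d. 1 * (mpow (z - x) b / mfact b * convD K (a + b) (Pr \<epsilon>) x))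
             + convD K a (Pr \<epsilon>) z)" for \<epsilon>
        unfolding model.Pih_graft[OF me \<sigma>T] Pr_def d_def by simp
      moreover have "lin_fun (Pih 1 x) (DXi_tree (graft a \<sigma>))
         = (\<lambda>z. (-1) * (\<Sum>b | real (sdeg b) < d. 1 * (mpow (z - x) b / mfact b * convD K (a + b) B x)) + convD K a B z)"
        unfolding DXi_tree_gen B_def by (rule ext) (subst lin_Pih_II_deg[OF _ D dd], simp_all)
      moreover have "DXi_tree (graft a \<sigma>) \<in> span_of wide_trees"
        unfolding DXi_tree_gen by (rule span_of_II[OF D]) (simp add: wide_trees_gen)
      ultimately show "?P (graft a \<sigma>)" by (simp add: wide_trees_gen \<sigma>T)
    next
      fix \<sigma> \<tau> assume s: "?P \<sigma>" and t: "?P \<tau>"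
      have "?Pe \<epsilon> (\<sigma> + \<tau>) = (\<lambda>z. ?Pe \<epsilon> \<sigma> z * ?Pe \<epsilon> \<tau> z)" for \<epsilon>
        using s t by (intro ext model.Pih_add[OF me]) auto
      moreover have "lin_fun (Pih 1 x) (DXi_tree (\<sigma> + \<tau>)) =
          (\<lambda>z. lin_fun (Pih 1 x) (DXi_tree \<sigma>) z * ?Pe 0 \<tau> z + ?Pe 0 \<sigma> z * lin_fun (Pih 1 x) (DXi_tree \<tau>) z)"
        using s t by (intro ext) (simp add: DXi_tree_add lin_fun_add lin_Pih_mult)
      ultimately have "expands (\<lambda>\<epsilon>. ?Pe \<epsilon> (\<sigma> + \<tau>)) (lin_fun (Pih 1 x) (DXi_tree (\<sigma> + \<tau>)))"
        using expands_mult[of "\<lambda>\<epsilon>. ?Pe \<epsilon> \<sigma>" _ "\<lambda>\<epsilon>. ?Pe \<epsilon> \<tau>"] s t by simp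
      then show "?P (\<sigma> + \<tau>)"
        using s t by (simp add: wide_trees_add DXi_tree_add span_of_add span_wide_mult)
    qed
    then show "expands (\<lambda>\<epsilon>. ?Pe \<epsilon> (Tree k l m M)) (lin_fun (Pih 1 x) (DXi_tree (Tree k l m M)))" by blast
  qed
  then show ?thesis using assms by blast
qed

lemma malliavin_lin_Pih:
  assumes "v \<in> span_of trees0"
  shows "malliavin \<xi> \<eta> (\<lambda>\<zeta>. lin_fun (PiHat \<alpha> 1 R K \<zeta> \<eta> x) v) z = lin_fun (Pih 1 x) (DXi v) z"
proof -
  have "expands (\<lambda>\<epsilon>. lin_fun (PiHat \<alpha> 1 R K (\<lambda>z. \<xi> z + \<epsilon> * \<eta> z) \<eta> x) v)
      (lin_fun (\<lambda>s. lin_fun (Pih 1 x) (DXi_tree s)) v)"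
    using assms by (intro expands_lin_fun expands_Pih) (auto simp: span_of_def)
  from expands_deriv[OF this] show ?thesis
    by (simp add: malliavin_def DXi_def lin_fun_lin)
qed

end

section \<open>The remainder of the linearised model\<close>

text \<open>
  The rule generating \<open>trees0\<close>, with either noise allowed at the leaves: unlike \<open>trees0\<close>, the trees
  obeying it are stable under the derivation, and their degrees are bounded from below.
\<close>

definition noise_rule :: "nat \<Rightarrow> nat \<Rightarrow> idx multiset \<Rightarrow> bool" where
  "noise_rule l m A \<longleftrightarrow> l + m = 1 \<and> A = {#} \<or> l + m = 0 \<and> set_mset A \<subseteq> {0, (0, 2)} \<and> count A (0, 2) \<le> 1"

lemma down_closed_noise_rule: "down_closed noise_rule"
  unfolding down_closed_def
proof (intro allI impI)
  fix l m and A B :: "idx multiset" assume A: "noise_rule l m A" and B: "B \<subseteq># A"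
  have "set_mset B \<subseteq> set_mset A" "count B (0, 2) \<le> count A (0, 2)" "A = {#} \<Longrightarrow> B = {#}"
    using B by (auto dest: set_mset_mono mset_subset_eq_count)
  then show "noise_rule l m B" using A unfolding noise_rule_def by fastforce
qed

lemma trees0_subset_noise_rule: "trees0 \<subseteq> rule_trees noise_rule"
proof
  fix \<tau> assume "\<tau> \<in> trees0"
  then show "\<tau> \<in> rule_trees noise_rule"
  proof (induction \<tau> rule: trees0.induct)
    case (1 M k)
    have zero: "x = 0" if "x \<in># image_mset fst M" for x using that 1 by auto
    have "(0, 2) \<noteq> (0 :: idx)" by (simp add: zero_prod_def)
    then have "count (image_mset fst M) (0, 2) = 0" using zero unfolding count_eq_zero_iff by blast
    then show ?case using 1 unfolding rule_trees_Tree noise_rule_def by auto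
  next
    case (2 M \<sigma> k)
    have zero: "x = 0" if "x \<in># image_mset fst M" for x using that 2 by auto
    have "(0, 2) \<noteq> (0 :: idx)" by (simp add: zero_prod_def)
    then have "count (image_mset fst M) (0, 2) = 0" using zero unfolding count_eq_zero_iff by blast
    then show ?case using 2 unfolding rule_trees_Tree noise_rule_def by auto
  next
    case (3 k)
    show ?case unfolding rule_trees_Tree noise_rule_def by simp
  qed
qed

text \<open>Planting with decoration 0 adds 2 to the degree: each branch contributes at least 0, and
  one containing \<open>Xi1\<close> at least -1/2 + 2 = 3/2.\<close>

lemma planted_sum_bound:
  assumes "\<And>a \<tau>. (a, \<tau>) \<in># N \<Longrightarrow> a = 0 \<and> - 2 \<le> deg \<alpha> 0 \<tau> \<and> (noises1 \<tau> \<noteq> 0 \<longrightarrow> - 1/2 \<le> deg \<alpha> 0 \<tau>)"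
  shows "0 \<le> (\<Sum>(a, \<tau>)\<in>#N. deg \<alpha> 0 \<tau> + 2 - real (sdeg a))
    \<and> ((\<Sum>(a, \<tau>)\<in>#N. noises1 \<tau>) \<noteq> 0 \<longrightarrow> 3/2 \<le> (\<Sum>(a, \<tau>)\<in>#N. deg \<alpha> 0 \<tau> + 2 - real (sdeg a)))"
  using assms
proof (induction N)
  case (add x N)
  obtain a \<tau> where x: "x = (a, \<tau>)" by (cases x)
  have IH: "0 \<le> (\<Sum>(a, \<tau>)\<in>#N. deg \<alpha> 0 \<tau> + 2 - real (sdeg a))
    \<and> ((\<Sum>(a, \<tau>)\<in>#N. noises1 \<tau>) \<noteq> 0 \<longrightarrow> 3/2 \<le> (\<Sum>(a, \<tau>)\<in>#N. deg \<alpha> 0 \<tau> + 2 - real (sdeg a)))"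
    by (rule add.IH, rule add.prems) simp
  have "a = 0" "- 2 \<le> deg \<alpha> 0 \<tau>" "noises1 \<tau> \<noteq> 0 \<longrightarrow> - 1/2 \<le> deg \<alpha> 0 \<tau>"
    using add.prems[of a \<tau>] x by auto
  then show ?case using IH by (auto simp: x sdeg_def)
qed simp

text \<open>A leaf \<open>Xi1\<close> has degree at least -2 + 3/2 = -1/2. An edge
  \<open>(0, 2)\<close> passes on the degree of its branch unchanged, occurs at most once per node,
  and its siblings are nonnegative. If \<open>Xi1\<close> sits in a sibling, this contributes 3/2,
  which against the worst value -2 again gives -1/2.\<close>

lemma noise_rule_deg_bound:
  assumes \<alpha>: "- 2 \<le> \<alpha>" and "\<tau> \<in> rule_trees noise_rule"
  shows "- 2 \<le> deg \<alpha> 0 \<tau> \<and> (noises1 \<tau> \<noteq> 0 \<longrightarrow> - 1/2 \<le> deg \<alpha> 0 \<tau>)"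
  using assms(2)
proof (induction \<tau> rule: rule_trees.induct)
  case (1 l m M k)
  let ?s = "\<lambda>N. \<Sum>(a, \<tau>)\<in>#N. deg \<alpha> 0 \<tau> + 2 - real (sdeg a)"
  let ?n = "\<lambda>N. \<Sum>(a, \<tau>)\<in>#N. noises1 \<tau>"
  consider (noise) "l + m = 1" "M = {#}" | (edges) "l = 0" "m = 0"
      "set_mset (image_mset fst M) \<subseteq> {0, (0, 2)}" "count (image_mset fst M) (0, 2) \<le> 1"
    using 1(1) unfolding noise_rule_def by auto
  then show ?case
  proof cases
    case noise
    then consider "l = 1" "m = 0" | "l = 0" "m = 1" by linarith
    then show ?thesis using \<alpha> noise by cases (simp_all add: deg.simps)
  next
    case edges
    have b: "- 2 \<le> deg \<alpha> 0 \<tau> \<and> (noises1 \<tau> \<noteq> 0 \<longrightarrow> - 1/2 \<le> deg \<alpha> 0 \<tau>)" if "(a, \<tau>) \<in># M" for a \<tau>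
      using 1 that by blast
    have "- 2 \<le> ?s M \<and> (?n M \<noteq> 0 \<longrightarrow> - 1/2 \<le> ?s M)"
    proof (cases "(0, 2) \<in># image_mset fst M")
      case True
      then obtain \<sigma> where \<sigma>: "((0, 2), \<sigma>) \<in># M" by auto
      then obtain N where N: "M = add_mset ((0, 2), \<sigma>) N" by (blast dest: multi_member_split)
      then have "count (image_mset fst N) (0, 2) = 0" using edges(4) by simp
      then have no: "(0, 2) \<notin># image_mset fst N" unfolding count_eq_zero_iff .
      have "0 \<le> ?s N \<and> (?n N \<noteq> 0 \<longrightarrow> 3/2 \<le> ?s N)"
      proof (rule planted_sum_bound)
        fix a \<tau> assume a: "(a, \<tau>) \<in># N"
        then have "a \<in># image_mset fst N" "a \<in># image_mset fst M" by (force simp: N)+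
        then have "a \<noteq> (0, 2)" "a \<in> {0, (0, 2)}" using no edges(3) by blast+
        then show "a = 0 \<and> - 2 \<le> deg \<alpha> 0 \<tau> \<and> (noises1 \<tau> \<noteq> 0 \<longrightarrow> - 1/2 \<le> deg \<alpha> 0 \<tau>)"
          using b[of a \<tau>] a N by auto
      qed
      then show ?thesis using b[OF \<sigma>] by (auto simp: N sdeg_def)
    next
      case False
      have "0 \<le> ?s M \<and> (?n M \<noteq> 0 \<longrightarrow> 3/2 \<le> ?s M)"
      proof (rule planted_sum_bound)
        fix a \<tau> assume a: "(a, \<tau>) \<in># M"
        then have "a \<in># image_mset fst M" by force
        then have "a \<noteq> (0, 2)" "a \<in> {0, (0, 2)}" using False edges(3) by blast+
        then show "a = 0 \<and> - 2 \<le> deg \<alpha> 0 \<tau> \<and> (noises1 \<tau> \<noteq> 0 \<longrightarrow> - 1/2 \<le> deg \<alpha> 0 \<tau>)"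
          using b[OF a] by auto
      qed
      then show ?thesis by auto
    qed
    moreover have "0 \<le> real (sdeg k)" by simp
    ultimately show ?thesis using edges(1,2) by (auto simp: deg.simps)
  qed
qed

section \<open>Splitting off the trees that contain \<open>Xi1\<close>\<close>

lemma noises1_add: "noises1 (\<sigma> + \<tau>) = noises1 \<sigma> + noises1 \<tau>"
  by (cases \<sigma>; cases \<tau>) simp

lemma noises1_child: "noises1 (Tree k l m M) = 0 \<Longrightarrow> (a, \<sigma>) \<in># M \<Longrightarrow> noises1 \<sigma> = 0"
  by (auto dest!: multi_member_split)

lemma noises1_eq_0_iff: "noises1 \<tau> = 0 \<longleftrightarrow> \<tau> \<in> rule_trees (\<lambda>l m A. m = 0)"
proof (induction \<tau> rule: measure_induct_rule[of size])
  case (less \<tau>)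
  obtain k l m M where \<tau>: "\<tau> = Tree k l m M" by (cases \<tau>)
  have IH: "noises1 \<sigma> = 0 \<longleftrightarrow> \<sigma> \<in> rule_trees (\<lambda>l m A. m = 0)" if "(a, \<sigma>) \<in># M" for a \<sigma>
    by (rule less) (use that \<tau> in \<open>auto dest!: multi_member_split\<close>)
  have "noises1 \<tau> = 0 \<longleftrightarrow> m = 0 \<and> (\<forall>a \<sigma>. (a, \<sigma>) \<in># M \<longrightarrow> noises1 \<sigma> = 0)"
    unfolding \<tau> by fastforce
  then show ?case unfolding \<tau> rule_trees_Tree using IH by metis
qed

lemma trees0_noises1: "\<tau> \<in> trees0 \<Longrightarrow> noises1 \<tau> = 0"
  unfolding noises1_eq_0_iff
proof (induction \<tau> rule: trees0.induct)
  case (2 M \<sigma> k)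
  then show ?case unfolding rule_trees_Tree by auto
qed (auto simp: rule_trees_Tree)

lemma deg_noises1: "noises1 \<tau> = 0 \<Longrightarrow> deg \<alpha> 0 \<tau> = deg \<alpha> 1 \<tau>"
proof (induction \<tau> rule: dtree_full_induct)
  case (graft a \<tau>)
  then show ?case unfolding deg_graft by simp
next
  case (add \<sigma> \<tau>)
  then show ?case unfolding deg_add noises1_add by simp
qed (simp_all add: deg.simps zero_dtree_def del: Tree_eq_0_iff)

definition Q1 :: "tvec \<Rightarrow> tvec" where
  "Q1 = lin (\<lambda>\<tau>. if noises1 \<tau> = 0 then 0 else basis \<tau>)"

lemma Q0_add_Q1: "Q0 v + Q1 v = v"
proof -
  have "Q0 v + Q1 v = lin basis v"
    unfolding Q0_def Q1_def lin_pointwise_add[symmetric] by (rule lin_cong) auto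
  then show ?thesis by (simp add: lin_id)
qed

lemma Q_linear:
  "Q0 0 = 0" "Q0 (u + v) = Q0 u + Q0 v" "Q0 (scale c v) = scale c (Q0 v)"
  "Q1 0 = 0" "Q1 (u + v) = Q1 u + Q1 v" "Q1 (scale c v) = scale c (Q1 v)"
  by (simp_all add: Q0_def Q1_def lin_add lin_scale)

lemma Q0_span: "Q0 v \<in> span_of {\<tau>. noises1 \<tau> = 0}"
  unfolding Q0_def by (rule span_of_lin[of v UNIV]) auto

lemma Q0_span_mono: "v \<in> span_of S \<Longrightarrow> Q0 v \<in> span_of S"
  unfolding Q0_def by (rule span_of_lin) auto

lemma Q1_span: "v \<in> span_of S \<Longrightarrow> Q1 v \<in> span_of {\<tau> \<in> S. noises1 \<tau> \<noteq> 0}"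
  unfolding Q1_def by (rule span_of_lin) auto

lemma Q1_span_mono: "v \<in> span_of S \<Longrightarrow> Q1 v \<in> span_of S"
  unfolding Q1_def by (rule span_of_lin) auto

lemma Q1_zero: "v \<in> span_of {\<tau>. noises1 \<tau> = 0} \<Longrightarrow> Q1 v = 0"
proof -
  assume "v \<in> span_of {\<tau>. noises1 \<tau> = 0}"
  then have "Q1 v = lin (\<lambda>_. 0) v" unfolding Q1_def by (rule lin_eq_on_span) auto
  then show ?thesis by (simp add: lin_def)
qed

text \<open>A factor free of \<open>Xi1\<close> does not affect whether a product contains
  it.\<close>

lemma Q1_mult:
  assumes v: "v \<in> span_of {\<tau>. noises1 \<tau> = 0}"
  shows "Q1 (u * v) = Q1 u * v"
proof -
  have 1: "Q1 (basis \<sigma> * v) = Q1 (basis \<sigma>) * v" for \<sigma>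
    using v
    by (induction v rule: span_of_induct)
      (simp_all add: Q_linear distrib_left, simp add: Q1_def basis_add[symmetric] noises1_add)
  have "u \<in> span_of UNIV" by simp
  then show ?thesis
    by (induction u rule: span_of_induct) (simp_all add: Q_linear distrib_right 1)
qed

lemma Q1_II: "Q1 (II a v) = II a (Q1 v)"
  unfolding Q1_def II_def lin_lin by (rule lin_cong) auto

locale recentered_model = model_antipode +
  assumes R_Q0: "\<forall>\<sigma>\<in>trees. lin R (Q0 (basis \<sigma>)) = Q0 (R \<sigma>)" and \<alpha>: "- 2 \<le> \<alpha>"
begin

lemma lin_R_Q0: "v \<in> span_of trees \<Longrightarrow> lin R (Q0 v) = Q0 (lin R v)"
proof (induction v rule: span_of_induct)
  case (step c \<tau> v)
  have "lin R (Q0 (basis \<tau>)) = Q0 (R \<tau>)" using R_Q0 step.hyps(1) by blast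
  then show ?case using step.IH by (simp add: Q_linear lin_add lin_scale)
qed (simp add: Q_linear)

lemma R_noises1: "\<tau> \<in> trees \<Longrightarrow> noises1 \<tau> = 0 \<Longrightarrow> R \<tau> \<in> span_of {\<sigma>. noises1 \<sigma> = 0}"
  using lin_R_Q0[of "basis \<tau>"] Q0_span[of "R \<tau>"] by (simp add: Q0_def)

text \<open>The two degrees differ only on \<open>Xi1\<close>, so the Taylor cutoffs agree; and
  \<open>R\<close> creates no \<open>Xi1\<close>, because it commutes with
  \<open>Q0\<close>.\<close>

lemma Pih_noises1:
  assumes "\<tau> \<in> trees"
  shows "noises1 \<tau> = 0 \<longrightarrow> Pih 0 x \<tau> = Pih 1 x \<tau>"
  using assms
proof (rule preparation_map_induct[OF prep], intro impI)
  fix k l m M assume T: "Tree k l m M \<in> trees" and n: "noises1 (Tree k l m M) = 0"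
    and IH: "\<And>a t s. (a, t) \<in># M \<Longrightarrow> s \<in> Poly_Mapping.keys (R t) \<Longrightarrow> noises1 s = 0 \<longrightarrow> Pih 0 x s = Pih 1 x s"
  have W: "Tree k l m M \<in> wide_trees" using T trees_subset_wide by blast
  have PR: "PiR \<alpha> 0 R K \<xi> \<eta> x \<sigma> = PiR \<alpha> 1 R K \<xi> \<eta> x \<sigma>" and d: "deg \<alpha> 0 (graft a \<sigma>) = deg \<alpha> 1 (graft a \<sigma>)"
    if a: "(a, \<sigma>) \<in># M" for a \<sigma>
  proof -
    have \<sigma>: "\<sigma> \<in> trees" "noises1 \<sigma> = 0" using trees_child[OF T a] noises1_child[OF n a] by auto
    show "PiR \<alpha> 0 R K \<xi> \<eta> x \<sigma> = PiR \<alpha> 1 R K \<xi> \<eta> x \<sigma>"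
      unfolding PiR_def
      by (rule lin_fun_cong[OF refl]) (use IH[OF a] R_noises1[OF \<sigma>] in \<open>auto simp: span_of_def\<close>)
    show "deg \<alpha> 0 (graft a \<sigma>) = deg \<alpha> 1 (graft a \<sigma>)" unfolding deg_graft deg_noises1[OF \<sigma>(2)] ..
  qed
  show "Pih 0 x (Tree k l m M) = Pih 1 x (Tree k l m M)"
    unfolding Pih_Tree[OF W]
    by (intro ext arg_cong2[of _ _ _ _ "(*)"] arg_cong[of _ _ prod_mset] image_mset_cong refl)
       (auto simp: PR d simp del: split_paired_All)
qed

text \<open>Evaluation is built in at \<open>y\<close>, the base point, where recentered planted
  trees of positive degree vanish. On \<open>trees0\<close> this is the hatted remainder at
  \<open>y\<close>, see \<open>Fdiff_hat_eq\<close>.\<close>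

definition remainder :: "real \<times> real \<Rightarrow> real \<times> real \<Rightarrow> tvec \<Rightarrow> real" where
  "remainder x y v = lin_fun (Pih 0 y) (Q1 (Gt y x (DXi v))) y"

lemma remainder_linear:
  "remainder x y 0 = 0" "remainder x y (u + v) = remainder x y u + remainder x y v"
  "remainder x y (scale c v) = c * remainder x y v"
  by (simp_all add: remainder_def DXi_linear Gt_linear Q_linear lin_fun_add lin_fun_scale)

text \<open>Splitting the vector by \<open>Q0\<close> and \<open>Q1\<close>, the \<open>Q0\<close>
  part is free of \<open>Xi1\<close>, where both indices give the same model, and cancels.\<close>

lemma remainder_eq:
  assumes v: "v \<in> span_of trees"
  shows "lin_fun (Pih 1 x) (DXi v) y - lin_fun (Pih 1 y) (Q0 (Gt y x (DXi v))) y = remainder x y v"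
proof -
  let ?w = "Gt y x (DXi v)"
  have w: "?w \<in> span_of trees" by (intro Gt_trees DXi_trees v)
  have "lin_fun (Pih 1 x) (DXi v) y = lin_fun (Pih 0 y) (Q0 ?w + Q1 ?w) y"
    unfolding Q0_add_Q1 by (simp add: lin_Pih_Gt DXi_trees v)
  moreover have "Q0 ?w \<in> span_of {\<tau> \<in> trees. noises1 \<tau> = 0}"
    using Q0_span[of ?w] Q0_span_mono[OF w] by (auto simp: span_of_def)
  then have "lin_fun (Pih 0 y) (Q0 ?w) = lin_fun (Pih 1 y) (Q0 ?w)"
    by (rule lin_fun_eq_on_span) (use Pih_noises1 in blast)
  ultimately show ?thesis by (simp add: remainder_def lin_fun_add)
qed

lemma span_trees0: "v \<in> span_of trees0 \<Longrightarrow> v \<in> span_of trees"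
  by (rule span_of_mono[OF trees0_subset_trees])

lemma Fdiff_hat_eq:
  assumes "v \<in> span_of trees0"
  shows "Fdiff_hat \<alpha> A R K \<xi> \<eta> x y v y = remainder x y v"
  unfolding Fdiff_hat_def malliavin_lin_Pih[OF assms] dGamma_eq by (rule remainder_eq[OF span_trees0[OF assms]])

text \<open>\<open>R\<close> is moved in turn past \<open>Q0\<close>, \<open>Gt\<close> and
  \<open>DXi\<close> until it acts on \<open>v\<close> itself.\<close>

lemma Fdiff_eq:
  assumes v: "v \<in> span_of trees0"
  shows "Fdiff \<alpha> A R K \<xi> \<eta> x y v y = remainder x y (lin R v)"
proof -
  have Rv: "lin R v \<in> span_of trees0" by (rule span_of_lin[OF v]) (rule R_trees0)
  have vT: "DXi v \<in> span_of trees" by (intro DXi_trees span_trees0 v)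
  have PR: "lin_fun (PiR \<alpha> 1 R K \<zeta> \<eta> x) v = lin_fun (PiHat \<alpha> 1 R K \<zeta> \<eta> x) (lin R v)" for \<zeta> x v
    unfolding lin_fun_lin by (simp add: PiR_def[abs_def])
  have "lin R (Q0 (Gt y x (DXi v))) = Q0 (Gt y x (DXi (lin R v)))"
    by (simp add: lin_R_Q0 Gt_trees vT lin_R_Gt lin_R_DXi v)
  then show ?thesis
    unfolding Fdiff_def PR malliavin_lin_Pih[OF Rv] dGamma_eq
    using remainder_eq[OF span_trees0[OF Rv], of x y] by simp
qed

lemma Gt_noises1:
  assumes "v \<in> span_of trees0"
  shows "Gt y x v \<in> span_of {\<tau>. noises1 \<tau> = 0}"
proof -
  have "{\<tau>. noises1 \<tau> = 0} = rule_trees (\<lambda>l m A. m = 0)" using noises1_eq_0_iff by blast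
  moreover have "v \<in> span_of {\<tau>. noises1 \<tau> = 0}"
    by (rule span_of_mono[OF _ assms]) (auto simp: trees0_noises1)
  ultimately show ?thesis using Gt_rule_trees[of "\<lambda>l m A. m = 0" v] by (simp add: down_closed_def)
qed

text \<open>Undifferentiated factors are free of \<open>Xi1\<close> and stay so under
  \<open>Gt\<close>, hence \<open>Q1\<close> acts on the differentiated factor alone;
  \<open>lin_Pih_Gt\<close> evaluates the other one as the index 1 model at
  \<open>x\<close>.\<close>

lemma remainder_mult:
  assumes u: "u \<in> span_of trees0" and v: "v \<in> span_of trees0"
  shows "remainder x y (u * v) = remainder x y u * lin_fun (Pih 1 x) v y + lin_fun (Pih 1 x) u y * remainder x y v"
proof -
  have T: "u \<in> span_of trees" "v \<in> span_of trees" "DXi u \<in> span_of trees" "DXi v \<in> span_of trees"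
    using u v by (auto intro: span_trees0 DXi_trees)
  have "Q1 (Gt y x (DXi (u * v))) = Q1 (Gt y x (DXi u)) * Gt y x v + Q1 (Gt y x (DXi v)) * Gt y x u"
    unfolding DXi_mult Gt_linear Q_linear Gt_mult[OF T(3) T(2)] Gt_mult[OF T(1) T(4)]
      mult.commute[of "Gt y x u"] Q1_mult[OF Gt_noises1[OF v]] Q1_mult[OF Gt_noises1[OF u]] ..
  moreover have "Q1 (Gt y x (DXi u)) \<in> span_of wide_trees" "Q1 (Gt y x (DXi v)) \<in> span_of wide_trees"
    "Gt y x u \<in> span_of wide_trees" "Gt y x v \<in> span_of wide_trees"
    using T by (auto intro!: span_trees_wide Q1_span_mono Gt_trees)
  ultimately show ?thesis
    by (simp add: remainder_def lin_fun_add lin_Pih_mult lin_Pih_Gt T mult.commute)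
qed

text \<open>At the base point only the Taylor term of order 0 survives and it equals the
  convolution; positive degree guarantees that this term is subtracted.\<close>

lemma Pih_graft_diagonal:
  assumes "\<tau> \<in> trees" and "0 < deg \<alpha> i (graft a \<tau>)"
  shows "Pih i y (graft a \<tau>) y = 0"
proof -
  have z: "mpow 0 b = (if b = 0 then 1 else 0)" for b
    by (cases b) (auto simp: mpow_def zero_prod_def power_0_left)
  have "(\<Sum>b | real (sdeg b) < deg \<alpha> i (graft a \<tau>).
        mpow (y - y) b / mfact b * convD K (a + b) (PiR \<alpha> i R K \<xi> \<eta> y \<tau>) y)
     = (\<Sum>b\<in>{0}. mpow (y - y) b / mfact b * convD K (a + b) (PiR \<alpha> i R K \<xi> \<eta> y \<tau>) y)"
    by (rule sum.mono_neutral_right[OF finite_sdeg_less]) (use assms(2) in \<open>auto simp: z sdeg_def simp del: split_paired_All\<close>)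
  then show ?thesis unfolding Pih_graft[OF assms(1)] by (simp add: z mfact_def)
qed

text \<open>
  Since \<open>\<alpha> \<ge> -2\<close>, integrating a tree that contains \<open>\<Xi>\<^sub>1\<close> gives positive \<open>deg 0\<close>, hence a function
  vanishing at its base point. This fails for \<open>II (0, 2)\<close>.
\<close>

lemma remainder_II:
  assumes v: "v \<in> span_of trees0"
  shows "remainder x y (II 0 v) = 0"
proof -
  let ?w = "Gt y x (DXi v)"
  obtain p where p: "p \<in> span_of (range monoX)" "Gt y x (II 0 (DXi v)) = II 0 ?w + p"
    using Gt_II by blast
  have "Q1 p = 0" by (rule Q1_zero, rule span_of_mono[OF _ p(1)]) auto
  then have Q: "Q1 (Gt y x (DXi (II 0 v))) = II 0 (Q1 ?w)"
    unfolding DXi_II p(2) Q_linear Q1_II by simp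
  have "DXi v \<in> span_of (rule_trees noise_rule)"
    unfolding DXi_def
  proof (rule span_of_lin[OF v])
    fix \<tau> assume "\<tau> \<in> trees0"
    then have "\<tau> \<in> rule_trees noise_rule" using trees0_subset_noise_rule by blast
    then show "DXi_tree \<tau> \<in> span_of (rule_trees noise_rule)"
      by (rule DXi_tree_rule_trees[rotated]) (auto simp: noise_rule_def)
  qed
  then have 1: "?w \<in> span_of (rule_trees noise_rule)" by (rule Gt_rule_trees[OF down_closed_noise_rule])
  have 2: "?w \<in> span_of trees" by (intro Gt_trees DXi_trees span_trees0 v)
  \<comment> \<open>Both supports matter: \<open>trees\<close> for the recursion equation of the
    model, \<open>noise_rule\<close> for the degree bound.\<close>
  have w: "Q1 ?w \<in> span_of {\<tau> \<in> trees. \<tau> \<in> rule_trees noise_rule \<and> noises1 \<tau> \<noteq> 0}"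
    using Q1_span[OF 1] Q1_span[OF 2] by (auto simp: span_of_def)
  have "lin_fun (Pih 0 y) (II 0 (Q1 ?w)) y = lin_real (\<lambda>s. Pih 0 y (graft 0 s) y) (Q1 ?w)"
    by (rule lin_Pih_II) (rule Q1_span_mono[OF 2])
  also have "\<dots> = lin_real (\<lambda>s. 0) (Q1 ?w)"
  proof (rule lin_real_eq_on_span[OF w])
    fix \<sigma> assume \<sigma>: "\<sigma> \<in> {\<tau> \<in> trees. \<tau> \<in> rule_trees noise_rule \<and> noises1 \<tau> \<noteq> 0}"
    then have "- 1/2 \<le> deg \<alpha> 0 \<sigma>" using noise_rule_deg_bound[OF \<alpha>] by blast
    then have "0 < deg \<alpha> 0 (graft 0 \<sigma>)" unfolding deg_graft by (simp add: sdeg_def)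
    then show "Pih 0 y (graft 0 \<sigma>) y = 0" using \<sigma> by (intro Pih_graft_diagonal) auto
  qed
  finally show ?thesis unfolding remainder_def Q by (simp add: lin_real_def)
qed

end

text \<open>Products of planted trees \<open>II 0\<close>. Unlike \<open>trees0\<close>, which
  allows at most one edge \<open>(0, 2)\<close> per node and no siblings of a noise, this set is
  closed under products.\<close>

definition bushes :: "dtree set" where
  "bushes = {\<tau>. \<exists>M. \<tau> = Tree 0 0 0 M \<and> (\<forall>a \<sigma>. (a, \<sigma>) \<in># M \<longrightarrow> a = 0 \<and> \<sigma> \<in> trees0)}"

lemma bushes_trees0: "bushes \<subseteq> trees0"
  unfolding bushes_def by (auto intro!: trees0.intros(1) simp del: split_paired_All)

lemma bushes_add: "\<sigma> \<in> bushes \<Longrightarrow> \<tau> \<in> bushes \<Longrightarrow> \<sigma> + \<tau> \<in> bushes"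
  unfolding bushes_def by (fastforce simp del: split_paired_All)

lemma span_bushes_II: "v \<in> span_of trees0 \<Longrightarrow> II 0 v \<in> span_of bushes"
  by (rule span_of_II) (auto simp: bushes_def)

lemma span_bushes_prod:
  assumes "\<And>i. i \<in> I \<Longrightarrow> t i \<in> span_of trees0"
  shows "(\<Prod>i\<in>I. II 0 (t i)) \<in> span_of bushes"
  using assms
proof (induction I rule: infinite_finite_induct)
  case (insert i I)
  then show ?case by (simp add: span_of_mult[OF span_bushes_II _ bushes_add])
qed (auto simp: bushes_def zero_dtree_def simp del: Tree_eq_0_iff)

lemma span_bushes_mult_II2:
  assumes "u \<in> span_of bushes" and "v \<in> span_of trees0"
  shows "u * II (0, 2) v \<in> span_of trees0"
proof (rule span_of_mult[OF assms(1)])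
  show "II (0, 2) v \<in> span_of (graft (0, 2) ` trees0)" by (rule span_of_II[OF assms(2)]) simp
  fix \<sigma> \<tau> assume "\<sigma> \<in> bushes" "\<tau> \<in> graft (0, 2) ` trees0"
  then obtain M \<rho> where "\<sigma> = Tree 0 0 0 M" "\<And>a \<sigma>. (a, \<sigma>) \<in># M \<Longrightarrow> a = 0 \<and> \<sigma> \<in> trees0"
      and "\<tau> = graft (0, 2) \<rho>" "\<rho> \<in> trees0"
    unfolding bushes_def by blast
  then show "\<sigma> + \<tau> \<in> trees0" using trees0.intros(2)[of M \<rho> 0] by simp
qed

section \<open>The product formula\<close>

context recentered_model
begin

text \<open>A derivation that vanishes on every factor vanishes on the product.\<close>

lemma remainder_prod:
  assumes "\<And>i. i \<in> I \<Longrightarrow> t i \<in> span_of trees0"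
  shows "remainder x y (\<Prod>i\<in>I. II 0 (t i)) = 0"
proof -
  have one: "remainder x y 1 = 0"
    unfolding basis_zero[symmetric] remainder_def DXi_basis DXi_tree_gen by (simp add: Gt_linear Q_linear)
  show ?thesis using assms
  proof (induction I rule: infinite_finite_induct)
    case (insert i I)
    have "II 0 (t i) \<in> span_of trees0" "(\<Prod>i\<in>I. II 0 (t i)) \<in> span_of trees0"
      by (rule span_of_mono[OF bushes_trees0 span_bushes_II[OF insert.prems]], simp)
        (rule span_of_mono[OF bushes_trees0 span_bushes_prod[OF insert.prems]], simp)
    then show ?case using insert by (simp add: remainder_mult remainder_II)
  qed (simp_all add: one)
qed

lemma lin_Pih_prod:
  assumes "\<And>i. i \<in> I \<Longrightarrow> t i \<in> span_of trees0"
  shows "lin_fun (Pih j x) (\<Prod>i\<in>I. II 0 (t i)) z = (\<Prod>i\<in>I. lin_fun (Pih j x) (II 0 (t i)) z)"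
proof -
  have one: "lin_fun (Pih j x) 1 z = 1" unfolding basis_zero[symmetric] lin_fun_basis Pih_gen ..
  have w: "v \<in> span_of bushes \<Longrightarrow> v \<in> span_of wide_trees" for v
    using bushes_trees0 by (blast intro: span_trees_wide span_trees0 span_of_mono)
  show ?thesis using assms
  proof (induction I rule: infinite_finite_induct)
    case (insert i I)
    have "II 0 (t i) \<in> span_of wide_trees" "(\<Prod>i\<in>I. II 0 (t i)) \<in> span_of wide_trees"
      by (rule w[OF span_bushes_II[OF insert.prems]], simp)
        (rule w[OF span_bushes_prod[OF insert.prems]], simp)
    then show ?case using insert by (simp add: lin_Pih_mult)
  qed (simp_all add: one)
qed

lemma Fdiff_product:
  assumes R: "lin R ((\<Prod>i\<in>I. II 0 (t i)) * II (0, 2) \<tau>) - (\<Prod>i\<in>I. II 0 (t i)) * II (0, 2) \<tau>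
                = (\<Sum>i\<in>J. scale (c i) (\<Prod>j\<in>L i. II 0 (s i j)))"
    and s: "\<And>i j. i \<in> J \<Longrightarrow> j \<in> L i \<Longrightarrow> s i j \<in> span_of trees0"
    and t: "\<And>i. i \<in> I \<Longrightarrow> t i \<in> span_of trees0" and \<tau>: "\<tau> \<in> span_of trees0"
  shows "Fdiff \<alpha> A R K \<xi> \<eta> x y ((\<Prod>i\<in>I. II 0 (t i)) * II (0, 2) \<tau>) y
           = (\<Prod>i\<in>I. lin_fun (Pih 1 x) (II 0 (t i)) y) * Fdiff_hat \<alpha> A R K \<xi> \<eta> x y (II (0, 2) \<tau>) y"
proof -
  let ?u = "\<Prod>i\<in>I. II 0 (t i)" and ?v = "II (0, 2) \<tau>"
  have u: "?u \<in> span_of bushes" by (rule span_bushes_prod[OF t])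
  then have u0: "?u \<in> span_of trees0" by (rule span_of_mono[OF bushes_trees0])
  have v0: "?v \<in> span_of trees0"
    using span_bushes_mult_II2[OF _ \<tau>, of 1] by (simp add: bushes_def zero_dtree_def del: Tree_eq_0_iff)
  have sum: "remainder x y (\<Sum>i\<in>F. scale (c i) (\<Prod>j\<in>L i. II 0 (s i j))) = 0" if "F \<subseteq> J" for F
    using that
    by (induction F rule: infinite_finite_induct) (simp_all add: remainder_linear remainder_prod s)
  have "lin R (?u * ?v) = ?u * ?v + (\<Sum>i\<in>J. scale (c i) (\<Prod>j\<in>L i. II 0 (s i j)))"
    using R by (simp add: algebra_simps)
  then have "Fdiff \<alpha> A R K \<xi> \<eta> x y (?u * ?v) y = remainder x y (?u * ?v)"
    by (simp add: Fdiff_eq span_bushes_mult_II2 u \<tau> remainder_linear sum)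
  \<comment> \<open>In the derivation rule the term that differentiates the product of the
    \<open>II 0\<close> factors is zero.\<close>
  also have "\<dots> = lin_fun (Pih 1 x) ?u y * remainder x y ?v"
    by (simp add: remainder_mult u0 v0 remainder_prod t)
  finally show ?thesis by (simp add: Fdiff_hat_eq v0 lin_Pih_prod t)
qed

end

theorem theorem4p6:
  fixes \<alpha> :: real
    and K \<xi> \<delta>\<xi> :: "real \<times> real \<Rightarrow> real"
    and R :: "dtree \<Rightarrow> tvec"
    and A :: "pmon \<Rightarrow> pvec"
    and I :: "nat set" and t :: "nat \<Rightarrow> tvec" and \<tau> :: tvec
    and x y :: "real \<times> real"
  assumes "- 2 \<le> \<alpha>"
    and "truncated_heat_kernel K"
    and "smooth \<xi>" and "smooth \<delta>\<xi>"
    and "is_antipode \<alpha> 0 A"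
    and "preparation_map \<alpha> R"
    and "\<forall>\<sigma>\<in>trees. lin R (Q0 (basis \<sigma>)) = Q0 (R \<sigma>)"
    and "\<And>(I :: nat set) (t :: nat \<Rightarrow> tvec) (\<tau> :: tvec).
           finite I \<Longrightarrow> (\<forall>i\<in>I. t i \<in> span_of trees0) \<Longrightarrow> \<tau> \<in> span_of trees0 \<Longrightarrow>
           \<exists>(J :: nat set) (L :: nat \<Rightarrow> nat set) (c :: nat \<Rightarrow> real) (s :: nat \<Rightarrow> nat \<Rightarrow> tvec).
              finite J \<and> (\<forall>i\<in>J. finite (L i) \<and> (\<forall>j\<in>L i. s i j \<in> span_of trees0)) \<and>
              lin R ((\<Prod>i\<in>I. II 0 (t i)) * II (0, 2) \<tau>) - (\<Prod>i\<in>I. II 0 (t i)) * II (0, 2) \<tau>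
                = (\<Sum>i\<in>J. scale (c i) (\<Prod>j\<in>L i. II 0 (s i j)))"
    and "finite I" and "\<forall>i\<in>I. t i \<in> span_of trees0" and "\<tau> \<in> span_of trees0"
  shows "Fdiff \<alpha> A R K \<xi> \<delta>\<xi> x y ((\<Prod>i\<in>I. II 0 (t i)) * II (0, 2) \<tau>) y
           = (\<Prod>i\<in>I. lin_fun (PiHat \<alpha> 1 R K \<xi> \<delta>\<xi> x) (II 0 (t i)) y)
             * Fdiff_hat \<alpha> A R K \<xi> \<delta>\<xi> x y (II (0, 2) \<tau>) y"
proof -
  interpret recentered_model \<alpha> K \<xi> \<delta>\<xi> R A
    by unfold_locales (fact assms)+
  obtain J :: "nat set" and L :: "nat \<Rightarrow> nat set" and c :: "nat \<Rightarrow> real" and s :: "nat \<Rightarrow> nat \<Rightarrow> tvec"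
    where s: "\<forall>i\<in>J. finite (L i) \<and> (\<forall>j\<in>L i. s i j \<in> span_of trees0)"
      and R: "lin R ((\<Prod>i\<in>I. II 0 (t i)) * II (0, 2) \<tau>) - (\<Prod>i\<in>I. II 0 (t i)) * II (0, 2) \<tau>
                = (\<Sum>i\<in>J. scale (c i) (\<Prod>j\<in>L i. II 0 (s i j)))"
    using assms(8)[OF assms(9-11)] by blast
  show ?thesis by (rule Fdiff_product[OF R]) (use s assms(10,11) in auto)
qed

end
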